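(* Let $\Omega\subseteq\mathbb{R}$ be compact, $k\in\mathbb{N}_0$, and let $\{x_n\}_{n\in\mathbb{Z}}\subseteq\mathbb{R}$ satisfy $x_n<x_{n+1}$ for all $n\in\mathbb{Z}$. Put $z_n=\frac{x_n+x_{n-1}}{2}$, $V_n=[z_n,z_{n+1}]$, and $\delta=\sup_{x\in\mathbb{R}}\inf_{n\in\mathbb{Z}}|x-x_n|$. Let the weights be $$\mu_{n,l}=\frac{1}{l!}\int_{V_n}(x-x_n)^{2l}\,\mathrm{d}x=\frac{(z_{n+1}-x_n)^{2l+1}-(z_n-x_n)^{2l+1}}{l!\,(2l+1)},\qquad l=0,\dots,k,\ n\in\mathbb{Z}.$$ If $$\delta<\frac{C(k)}{m_\Omega},\qquad C(k)=\frac{1}{c_{k+1}},$$ then $$A\|f\|^2\le\sum_{n\in\mathbb{Z}}\sum_{l=0}^k\mu_{n,l}|f^{(l)}(x_n)|^2\le B\|f\|^2,\qquad\forall f\in\mathrm{B}(\Omega),$$ where $$A\ge e^{-1}\left(1-(c_{k+1}\delta m_\Omega)^{k+1}\right)^2,\qquad B\le\left(1+2\delta m_\Omega/\pi\right)^2e^{(\delta m_\Omega)^2}.$$ Equivalently, the set $\{\sqrt{\mu_{n,l}}\,\frac{\mathrm{d}^l}{\mathrm{d}x^l}\Phi_\Omega(\cdot-x_n):n\in\mathbb{Z},\ l=0,\dots,k\}$ forms a frame for $\mathrm{B}(\Omega)$ with bounds $A$ and $B$.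
   Context: $\|\cdot\|$ is the norm of $L^2(\mathbb{R})$; $\hat f(\omega)=\int_{\mathbb{R}}f(x)e^{-i\omega x}\,\mathrm{d}x$; $\mathrm{B}(\Omega)=\{f\in L^2(\mathbb{R}):\operatorname{supp}(\hat f)\subseteq\Omega\}$ (smooth representatives are used); $m_\Omega=\sup_{\omega\in\Omega}|\omega|$; $\Phi_\Omega(x)=\frac{1}{2\pi}\int_\Omega e^{i\omega x}\,\mathrm{d}\omega$. For $j\in\mathbb{N}$, $c_j>0$ denotes the minimal constant such that $$\int_a^b|f(x)|^2\,\mathrm{d}x\le(c_j)^{2j}(b-a)^{2j}\int_a^b|f^{(j)}(x)|^2\,\mathrm{d}x$$ for all $f$ in the Sobolev space $H^j(a,b)$ satisfying either $f(a)=f'(a)=\dots=f^{(j-1)}(a)=0$ or $f(b)=f'(b)=\dots=f^{(j-1)}(b)=0$. A family $\{\phi_i\}$ in a Hilbert space is a frame with bounds $A,B>0$ if $A\|f\|^2\le\sum_i|\langle f,\phi_i\rangle|^2\le B\|f\|^2$ for all $f$. *)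

theory Defs
  imports "HOL-Analysis.Analysis"
begin

section \<open>Derivatives and square-integrable functions\<close>

definition nderiv :: "nat \<Rightarrow> (real \<Rightarrow> complex) \<Rightarrow> real \<Rightarrow> complex" where
  "nderiv l f = ((\<lambda>g x. vector_derivative g (at x)) ^^ l) f"

definition smooth :: "(real \<Rightarrow> complex) \<Rightarrow> bool" where
  "smooth f \<longleftrightarrow> (\<forall>l x. nderiv l f differentiable (at x))"

definition L2_on :: "real set \<Rightarrow> (real \<Rightarrow> complex) \<Rightarrow> bool" where
  "L2_on S f \<longleftrightarrow> set_borel_measurable lborel S f \<and>
     set_integrable lborel S (\<lambda>x. (cmod (f x))\<^sup>2)"

definition L2_inner :: "(real \<Rightarrow> complex) \<Rightarrow> (real \<Rightarrow> complex) \<Rightarrow> complex" where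
  "L2_inner f g = (LINT x|lborel. f x * cnj (g x))"

definition L2_norm :: "(real \<Rightarrow> complex) \<Rightarrow> real" where
  "L2_norm f = sqrt (LINT x|lborel. (cmod (f x))\<^sup>2)"


section \<open>Fourier transform on \<open>L\<^sup>2\<close> and bandlimited functions\<close>

text \<open>
  The integral of \<open>f x * exp (-\<i> \<omega> x)\<close> over the real line need not converge absolutely for
  square-integrable \<open>f\<close>; as usual the transform is the \<open>L\<^sup>2\<close>-limit of the transforms of the
  truncations of \<open>f\<close> to \<open>[-R, R]\<close>. It is determined up to null sets, hence a relation. The error
  is measured by an extended nonnegative integral, which cannot collapse to \<open>0\<close> through
  non-integrability.
\<close>

definition has_L2_fourier :: "(real \<Rightarrow> complex) \<Rightarrow> (real \<Rightarrow> complex) \<Rightarrow> bool" where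
  "has_L2_fourier f g \<longleftrightarrow> L2_on UNIV f \<and> L2_on UNIV g \<and>
     ((\<lambda>R::real. \<integral>\<^sup>+ \<omega>. ennreal ((cmod (g \<omega> -
          (LINT x:{-R..R}|lborel. f x * exp (- \<i> * complex_of_real (\<omega> * x)))))\<^sup>2) \<partial>lborel)
        \<longlongrightarrow> 0) at_top"

text \<open>
  Support of an almost-everywhere class: the complement of the largest open set on which
  \<open>g\<close> vanishes almost everywhere.
\<close>

definition ess_supp :: "(real \<Rightarrow> complex) \<Rightarrow> real set" where
  "ess_supp g = - \<Union>{U. open U \<and> (AE \<omega> in lborel. \<omega> \<in> U \<longrightarrow> g \<omega> = 0)}"

text \<open>Each class of bandlimited functions is represented by its unique smooth member.\<close>

definition bandlimited :: "real set \<Rightarrow> (real \<Rightarrow> complex) set" where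
  "bandlimited \<Omega> = {f. smooth f \<and> L2_on UNIV f \<and> (\<exists>g. has_L2_fourier f g \<and> ess_supp g \<subseteq> \<Omega>)}"

text \<open>
  \<open>m\<^sub>\<Omega>\<close>, with the supremum taken in \<open>[0, \<infinity>]\<close>, so that it is \<open>0\<close> for empty \<open>\<Omega>\<close>.
\<close>

definition band_radius :: "real set \<Rightarrow> ennreal" where
  "band_radius \<Omega> = (SUP \<omega>\<in>\<Omega>. ennreal \<bar>\<omega>\<bar>)"

definition band_kernel :: "real set \<Rightarrow> real \<Rightarrow> complex" where
  "band_kernel \<Omega> x =
     complex_of_real (1 / (2 * pi)) * (LINT \<omega>:\<Omega>|lborel. exp (\<i> * complex_of_real (\<omega> * x)))"


section \<open>Sobolev spaces on an interval and the constants \<open>c\<^sub>j\<close>\<close>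

definition test_function :: "real \<Rightarrow> real \<Rightarrow> (real \<Rightarrow> complex) \<Rightarrow> bool" where
  "test_function a b \<phi> \<longleftrightarrow> smooth \<phi> \<and>
     (\<exists>K. compact K \<and> K \<subseteq> {a<..<b} \<and> (\<forall>x. x \<notin> K \<longrightarrow> \<phi> x = 0))"

definition locally_integrable_on :: "real \<Rightarrow> real \<Rightarrow> (real \<Rightarrow> complex) \<Rightarrow> bool" where
  "locally_integrable_on a b f \<longleftrightarrow>
     (\<forall>K. compact K \<and> K \<subseteq> {a<..<b} \<longrightarrow> set_integrable lborel K f)"

text \<open>\<open>weak_deriv a b i f g\<close>: on \<open>(a, b)\<close>, \<open>g\<close> is an \<open>i\<close>-th weak derivative of \<open>f\<close>.\<close>

definition weak_deriv ::
  "real \<Rightarrow> real \<Rightarrow> nat \<Rightarrow> (real \<Rightarrow> complex) \<Rightarrow> (real \<Rightarrow> complex) \<Rightarrow> bool" where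
  "weak_deriv a b i f g \<longleftrightarrow>
     locally_integrable_on a b f \<and> locally_integrable_on a b g \<and>
     (\<forall>\<phi>. test_function a b \<phi> \<longrightarrow>
        (LINT x:{a<..<b}|lborel. f x * nderiv i \<phi> x) =
        (- 1) ^ i * (LINT x:{a<..<b}|lborel. g x * \<phi> x))"

definition sobolev :: "real \<Rightarrow> real \<Rightarrow> nat \<Rightarrow> (real \<Rightarrow> complex) set" where
  "sobolev a b j = {f. L2_on {a<..<b} f \<and>
     (\<forall>i\<in>{1..j}. \<exists>g. weak_deriv a b i f g \<and> L2_on {a<..<b} g)}"

text \<open>
  The derivatives of \<open>f\<close> of order \<open>0, \<dots>, j - 1\<close> vanish at the endpoint \<open>p\<close>: point values are
  those of the representatives of the weak derivatives that are continuous on \<open>[a, b]\<close>.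
\<close>

definition vanishes_to_order :: "real \<Rightarrow> real \<Rightarrow> nat \<Rightarrow> real \<Rightarrow> (real \<Rightarrow> complex) \<Rightarrow> bool" where
  "vanishes_to_order a b j p f \<longleftrightarrow>
     (\<forall>i<j. \<exists>g. continuous_on {a..b} g \<and> weak_deriv a b i f g \<and> g p = 0)"

text \<open>
  The minimal \<open>c > 0\<close> for which the inequality holds; by scaling it does not matter whether
  this is asked for one interval \<open>(a, b)\<close> or, as here, for all of them. The notion is meant
  for \<open>j \<ge> 1\<close>.
\<close>

definition poincare_const :: "nat \<Rightarrow> real" where
  "poincare_const j = (LEAST c. 0 < c \<and>
     (\<forall>a b f g. a < b \<longrightarrow> f \<in> sobolev a b j \<longrightarrow>
        vanishes_to_order a b j a f \<or> vanishes_to_order a b j b f \<longrightarrow>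
        weak_deriv a b j f g \<longrightarrow> L2_on {a<..<b} g \<longrightarrow>
        (LINT x:{a<..<b}|lborel. (cmod (f x))\<^sup>2)
          \<le> c ^ (2 * j) * (b - a) ^ (2 * j) * (LINT x:{a<..<b}|lborel. (cmod (g x))\<^sup>2)))"


section \<open>Sampling points, weights and frames\<close>

definition midpt :: "(int \<Rightarrow> real) \<Rightarrow> int \<Rightarrow> real" where
  "midpt x n = (x n + x (n - 1)) / 2"

definition voronoi :: "(int \<Rightarrow> real) \<Rightarrow> int \<Rightarrow> real set" where
  "voronoi x n = {midpt x n .. midpt x (n + 1)}"

definition max_gap :: "(int \<Rightarrow> real) \<Rightarrow> ennreal" where
  "max_gap x = (SUP t. INF n. ennreal \<bar>t - x n\<bar>)"

definition sampling_weight :: "(int \<Rightarrow> real) \<Rightarrow> int \<Rightarrow> nat \<Rightarrow> real" where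
  "sampling_weight x n l = (1 / fact l) * (LINT t:voronoi x n|lborel. (t - x n) ^ (2 * l))"

lemma sampling_weight_eq:
  assumes "\<And>n. x n < x (n + 1)"
  shows "sampling_weight x n l =
    ((midpt x (n + 1) - x n) ^ (2 * l + 1) - (midpt x n - x n) ^ (2 * l + 1))
      / (fact l * real (2 * l + 1))"
proof -
  define F where "F = (\<lambda>t. (t - x n) ^ (2 * l + 1) / real (2 * l + 1))"
  have "midpt x n \<le> midpt x (n + 1)"
    using assms[of n] assms[of "n - 1"] by (simp add: midpt_def)
  moreover have "(F has_vector_derivative (t - x n) ^ (2 * l))
      (at t within {midpt x n .. midpt x (n + 1)})" for t
    unfolding F_def has_real_derivative_iff_has_vector_derivative[symmetric]
    by (rule derivative_eq_intros refl | simp)+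
  moreover have "continuous_on {midpt x n .. midpt x (n + 1)} (\<lambda>t. (t - x n) ^ (2 * l))"
    by (intro continuous_intros)
  ultimately have "(LINT t|lborel. indicator {midpt x n .. midpt x (n + 1)} t *\<^sub>R (t - x n) ^ (2 * l))
      = F (midpt x (n + 1)) - F (midpt x n)"
    by (intro integral_FTC_Icc) auto
  then show ?thesis
    by (simp add: sampling_weight_def voronoi_def set_lebesgue_integral_def F_def
        diff_divide_distrib [symmetric] mult.commute)
qed

definition deriv_sampling_bounds ::
  "real set \<Rightarrow> nat \<Rightarrow> (int \<Rightarrow> real) \<Rightarrow> real \<Rightarrow> real \<Rightarrow> bool" where
  "deriv_sampling_bounds \<Omega> k x A B \<longleftrightarrow> (\<forall>f\<in>bandlimited \<Omega>.
     let S = (\<lambda>n. \<Sum>l\<le>k. sampling_weight x n l * (cmod (nderiv l f (x n)))\<^sup>2)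
     in S summable_on UNIV \<and>
        A * (L2_norm f)\<^sup>2 \<le> (\<Sum>\<^sub>\<infinity>n. S n) \<and> (\<Sum>\<^sub>\<infinity>n. S n) \<le> B * (L2_norm f)\<^sup>2)"

text \<open>
  \<open>L2_frame H I \<phi> A B\<close>: the family \<open>\<phi>\<close>, indexed by \<open>I\<close>, is a frame with bounds \<open>A\<close>, \<open>B\<close> for the
  subspace \<open>H\<close> of \<open>L\<^sup>2\<close> (given by representatives).
\<close>

definition L2_frame ::
  "(real \<Rightarrow> complex) set \<Rightarrow> 'i set \<Rightarrow> ('i \<Rightarrow> real \<Rightarrow> complex) \<Rightarrow> real \<Rightarrow> real \<Rightarrow> bool" where
  "L2_frame H I \<phi> A B \<longleftrightarrow> 0 < A \<and> 0 < B \<and> (\<forall>i\<in>I. \<phi> i \<in> H) \<and>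
     (\<forall>f\<in>H. (\<lambda>i. (cmod (L2_inner f (\<phi> i)))\<^sup>2) summable_on I \<and>
        A * (L2_norm f)\<^sup>2 \<le> (\<Sum>\<^sub>\<infinity>i\<in>I. (cmod (L2_inner f (\<phi> i)))\<^sup>2) \<and>
        (\<Sum>\<^sub>\<infinity>i\<in>I. (cmod (L2_inner f (\<phi> i)))\<^sup>2) \<le> B * (L2_norm f)\<^sup>2)"

definition sampling_atom ::
  "real set \<Rightarrow> (int \<Rightarrow> real) \<Rightarrow> int \<times> nat \<Rightarrow> real \<Rightarrow> complex" where
  "sampling_atom \<Omega> x = (\<lambda>(n, l) t.
     complex_of_real (sqrt (sampling_weight x n l)) * nderiv l (\<lambda>s. band_kernel \<Omega> (s - x n)) t)"

end

theory Submission
  imports Defs "HOL-Probability.Probability"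
begin

text \<open>
  Why the sampling inequality holds. On the cell \<open>V\<^sub>n\<close> replace \<open>f\<close> by its Taylor polynomial \<open>T\<^sub>n\<close> of
  degree \<open>k\<close> at \<open>x\<^sub>n\<close>. The remainder \<open>f - T\<^sub>n\<close> vanishes to order \<open>k + 1\<close> at \<open>x\<^sub>n\<close>, and \<open>x\<^sub>n\<close> cuts the
  cell into two intervals of length at most \<open>\<delta>\<close>, each with \<open>x\<^sub>n\<close> as an endpoint. This is the situation for
  which \<open>c = c\<^bsub>k+1\<^esub>\<close> is defined, so on the cell the energy of \<open>f - T\<^sub>n\<close> is at most \<open>(c \<delta>)\<^bsup>2(k+1)\<^esup>\<close> times
  that of the derivative of \<open>f\<close> of order \<open>k + 1\<close>. After summation over the cells, Bernstein's inequality
  \<open>\<parallel>f\<^bsup>(l)\<^esup>\<parallel> \<le> m\<^sup>l \<parallel>f\<parallel>\<close> shows that the piecewise polynomial built from the samples has norm at least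
  \<open>(1 - (c \<delta> m)\<^bsup>k+1\<^esup>) \<parallel>f\<parallel>\<close>. Cauchy-Schwarz with the weights \<open>1 / l!\<close>, whose sum is at most \<open>e\<close>, bounds
  the square of that norm by \<open>e\<close> times the weighted sum of the samples, which is the lower bound
  (\<open>samples_lower\<close>).

  For the upper bound each order \<open>l\<close> is treated separately. The weight is at most \<open>\<delta>\<^bsup>2l\<^esup> |V\<^sub>n| / l!\<close>, and
  \<open>\<Sum> |V\<^sub>n| |f\<^bsup>(l)\<^esup>(x\<^sub>n)|\<^sup>2\<close> is the squared norm of a step function, whose distance to \<open>f\<^bsup>(l)\<^esup>\<close> is at most
  \<open>(2 \<delta> / \<pi>) \<parallel>f\<^bsup>(l+1)\<^esup>\<parallel>\<close> by Wirtinger's inequality. With Bernstein's inequality the sum over \<open>l\<close> becomes a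
  partial sum of the exponential series (\<open>samples_upper\<close>).

  The frame statement says the same: the inner product of \<open>f\<close> with an atom is, up to sign, the
  weighted sample of \<open>f\<close> (\<open>sampling_atom_inner\<close>).

  Two bodies of theory feed this argument. First, \<open>c\<^sub>j\<close> is defined as a least element, so one has to know
  that the Poincare inequality holds with some constant for all Sobolev functions and that the infimum of
  the admissible constants is positive and attained (\<open>poincare_const\<close>). For weakly differentiable
  functions this rests on the lemma of du Bois-Reymond, which is obtained by testing with smooth
  approximations of indicator functions. Second, Bernstein's inequality and the
  reproducing property need the Fourier transform on \<open>L\<^sup>2\<close>. Plancherel's theorem is proved for functions
  \<open>p\<close> continuous and cut off to a compact set \<open>K\<close>, by Gaussian regularisation. This class contains the
  truncations of smooth functions as well as the spectra of the atoms; bandlimited functions with a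
  general square-integrable spectrum are reached from it by duality.
\<close>

abbreviation energy :: "(real \<Rightarrow> complex) \<Rightarrow> real" where
  "energy f \<equiv> LBINT x. (cmod (f x))\<^sup>2"

abbreviation energy_on :: "real set \<Rightarrow> (real \<Rightarrow> complex) \<Rightarrow> real" where
  "energy_on S f \<equiv> LBINT x:S. (cmod (f x))\<^sup>2"

section \<open>Smooth functions\<close>

lemma nderiv_0 [simp]: "nderiv 0 f = f"
  by (simp add: nderiv_def)

lemma nderiv_Suc: "nderiv (Suc l) f = (\<lambda>x. vector_derivative (nderiv l f) (at x))"
  by (simp add: nderiv_def)

lemma nderiv_nderiv: "nderiv i (nderiv j f) = nderiv (i + j) f"
  by (simp add: nderiv_def funpow_add)

lemma smooth_has_vector_derivative:
  "smooth f \<Longrightarrow> (nderiv l f has_vector_derivative nderiv (Suc l) f x) (at x within S)"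
  unfolding nderiv_Suc smooth_def
  by (metis vector_derivative_works has_vector_derivative_at_within)

lemma smooth_nderiv: "smooth f \<Longrightarrow> smooth (nderiv j f)"
  by (simp add: smooth_def nderiv_nderiv)

lemma smooth_isCont: "smooth f \<Longrightarrow> isCont (nderiv l f) x"
  by (metis smooth_has_vector_derivative has_vector_derivative_continuous)

lemma smooth_continuous_on: "smooth f \<Longrightarrow> continuous_on S (nderiv l f)"
  by (simp add: continuous_at_imp_continuous_on smooth_isCont)

lemma nderiv_eqI:
  assumes F: "\<And>l x. (F l has_vector_derivative F (Suc l) x) (at x)"
  shows "nderiv l (F 0) = F l"
  by (induction l) (auto simp: nderiv_Suc intro!: ext vector_derivative_at F)

lemma smoothI_seq:
  assumes F: "\<And>l x. (F l has_vector_derivative F (Suc l) x) (at x)"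
  shows "smooth (F 0)"
  unfolding smooth_def nderiv_eqI[of F, OF F]
  using F differentiableI_vector by blast

text \<open>
  By coinduction, smoothness follows from membership in a set of functions that is closed under
  differentiation. So it is enough to know the shape of the first derivative of each member.
\<close>

lemma smooth_coinduct:
  assumes f: "f \<in> C"
    and step: "\<And>w. w \<in> C \<Longrightarrow> \<exists>w'\<in>C. \<forall>x. (w has_vector_derivative w' x) (at x)"
  shows "smooth f"
proof -
  obtain d where d: "\<And>w. w \<in> C \<Longrightarrow> d w \<in> C" "\<And>w x. w \<in> C \<Longrightarrow> (w has_vector_derivative d w x) (at x)"
    using step by metis
  have C: "(d ^^ l) f \<in> C" for l
    by (induction l) (auto simp: f d)
  have "smooth ((d ^^ 0) f)"
    by (rule smoothI_seq) (auto intro: d C)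
  then show ?thesis by simp
qed

text \<open>
  The sums of products of derivatives of \<open>u\<close> and \<open>v\<close>, a set that the product rule shows to be
  closed under differentiation.
\<close>

inductive_set product_span :: "(real \<Rightarrow> complex) \<Rightarrow> (real \<Rightarrow> complex) \<Rightarrow> (real \<Rightarrow> complex) set"
  for u v where
  prod: "(\<lambda>x. nderiv i u x * nderiv j v x) \<in> product_span u v"
| add: "w1 \<in> product_span u v \<Longrightarrow> w2 \<in> product_span u v \<Longrightarrow> (\<lambda>x. w1 x + w2 x) \<in> product_span u v"

lemma smooth_mult:
  assumes u: "smooth u" and v: "smooth v"
  shows "smooth (\<lambda>x. u x * v x)"
proof (rule smooth_coinduct)
  show "(\<lambda>x. u x * v x) \<in> product_span u v"
    using product_span.prod[of 0 u 0 v] by simp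
  fix w assume "w \<in> product_span u v"
  then show "\<exists>w'\<in>product_span u v. \<forall>x. (w has_vector_derivative w' x) (at x)"
  proof induction
    case (prod i j)
    have "((\<lambda>x. nderiv i u x * nderiv j v x) has_vector_derivative
        nderiv i u x * nderiv (Suc j) v x + nderiv (Suc i) u x * nderiv j v x) (at x)" for x
      by (intro has_vector_derivative_mult smooth_has_vector_derivative u v)
    moreover have "(\<lambda>x. nderiv i u x * nderiv (Suc j) v x + nderiv (Suc i) u x * nderiv j v x) \<in> product_span u v"
      by (intro product_span.intros)
    ultimately show ?case by (intro bexI[of _ "\<lambda>x. nderiv i u x * nderiv (Suc j) v x + nderiv (Suc i) u x * nderiv j v x"] allI)
  next
    case (add w1 w2)
    then obtain d1 d2 where "d1 \<in> product_span u v" "d2 \<in> product_span u v"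
      "\<And>x. (w1 has_vector_derivative d1 x) (at x)" "\<And>x. (w2 has_vector_derivative d2 x) (at x)"
      by metis
    then show ?case
      by (intro bexI[of _ "\<lambda>x. d1 x + d2 x"] allI has_vector_derivative_add product_span.add)
  qed
qed

lemma smooth_affine:
  assumes f: "smooth f"
  shows "smooth (\<lambda>x. f (a * x + b))"
proof -
  define F where "F l x = complex_of_real a ^ l * nderiv l f (a * x + b)" for l x
  have *: "(F l has_vector_derivative F (Suc l) x) (at x)" for l x
  proof -
    have "(nderiv l f has_vector_derivative nderiv (Suc l) f (a * x + b)) (at (a * x + b))"
      by (rule smooth_has_vector_derivative[OF f])
    moreover have "((\<lambda>x. a * x + b) has_vector_derivative a) (at x)"
      by (auto intro!: derivative_eq_intros)
    ultimately have "((\<lambda>x. nderiv l f (a * x + b)) has_vector_derivative a *\<^sub>R nderiv (Suc l) f (a * x + b)) (at x)"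
      using vector_diff_chain_at[of "\<lambda>x. a * x + b" a x "nderiv l f"] by (simp add: o_def)
    then have "(F l has_vector_derivative of_real a ^ l * (a *\<^sub>R nderiv (Suc l) f (a * x + b))) (at x)"
      unfolding F_def by (rule has_vector_derivative_mult_right)
    then show ?thesis by (simp add: F_def scaleR_conv_of_real mult_ac)
  qed
  have F0: "F 0 = (\<lambda>x. f (a * x + b))" by (simp add: F_def fun_eq_iff)
  show "smooth (\<lambda>x. f (a * x + b))" using smoothI_seq[of F, OF *] by (simp add: F0)
qed

lemma
  assumes f: "smooth f" and g: "smooth g"
  shows smooth_diff: "smooth (\<lambda>x. f x - g x)"
    and nderiv_diff: "nderiv l (\<lambda>x. f x - g x) = (\<lambda>x. nderiv l f x - nderiv l g x)"
proof -
  define F where "F l x = nderiv l f x - nderiv l g x" for l x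
  have *: "(F l has_vector_derivative F (Suc l) x) (at x)" for l x
    unfolding F_def by (intro has_vector_derivative_diff smooth_has_vector_derivative f g)
  have F0: "F 0 = (\<lambda>x. f x - g x)" by (simp add: F_def fun_eq_iff)
  show "smooth (\<lambda>x. f x - g x)" using smoothI_seq[of F, OF *] by (simp add: F0)
  show "nderiv l (\<lambda>x. f x - g x) = (\<lambda>x. nderiv l f x - nderiv l g x)"
    using nderiv_eqI[of F l, OF *] unfolding F0 by (simp add: F_def fun_eq_iff)
qed

lemma tendsto_poly_exp_neg: "((\<lambda>y. poly p y * exp (- y)) \<longlongrightarrow> (0::real)) at_top"
proof -
  have "((\<lambda>y. \<Sum>i\<le>degree p. coeff p i * (y ^ i / exp y)) \<longlongrightarrow> (\<Sum>i\<le>degree p. coeff p i * 0)) at_top"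
    by (intro tendsto_sum tendsto_mult tendsto_const tendsto_power_div_exp_0)
  then show ?thesis
    by (simp add: poly_altdef sum_distrib_left exp_minus divide_inverse mult_ac)
qed

text \<open>
  The family of functions \<open>P (1 / x) exp (- 1 / x)\<close>, extended by \<open>0\<close> to \<open>x \<le> 0\<close>. Its member
  with \<open>P = 1\<close> is the standard smooth function that is not analytic at \<open>0\<close>; the polynomial factor makes the
  family closed under differentiation.
\<close>

definition flat :: "real poly \<Rightarrow> real \<Rightarrow> real" where
  "flat p x = (if 0 < x then poly p (1 / x) * exp (- (1 / x)) else 0)"

lemma flat_has_derivative:
  "(flat p has_real_derivative flat ((p - pderiv p) * [:0, 0, 1:]) x) (at x)"
proof -
  consider "x > 0" | "x < 0" | "x = 0" by linarith
  then show ?thesis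
  proof cases
    case 1
    have "((\<lambda>x. poly p (1 / x) * exp (- (1 / x))) has_real_derivative
        flat ((p - pderiv p) * [:0, 0, 1:]) x) (at x)"
      unfolding flat_def using 1
      by (auto intro!: derivative_eq_intros DERIV_chain2[OF poly_DERIV] simp: field_simps power2_eq_square)
    then show ?thesis
      by (rule has_field_derivative_transform_within_open[where S="{0<..}"]) (use 1 in \<open>auto simp: flat_def\<close>)
  next
    case 2
    have "((\<lambda>x. 0) has_real_derivative 0) (at x)" by simp
    then have "(flat p has_real_derivative 0) (at x)"
      by (rule has_field_derivative_transform_within_open[where S="{..<0}"]) (use 2 in \<open>auto simp: flat_def\<close>)
    then show ?thesis using 2 by (simp add: flat_def)
  next
    case 3
    have "((\<lambda>y. flat p y / y) \<longlongrightarrow> 0) (at_left 0)"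
      by (rule tendsto_eventually) (auto simp: flat_def eventually_at_filter)
    moreover have "((\<lambda>y. flat p y / y) \<longlongrightarrow> 0) (at_right 0)"
    proof -
      have "((\<lambda>y. poly (p * [:0, 1:]) (inverse y) * exp (- inverse y)) \<longlongrightarrow> (0::real)) (at_right 0)"
        by (rule filterlim_compose[OF tendsto_poly_exp_neg filterlim_inverse_at_top_right])
      then show ?thesis
        by (rule Lim_transform_eventually)
           (auto simp: flat_def eventually_at_filter divide_simps)
    qed
    ultimately have "((\<lambda>y. flat p y / y) \<longlongrightarrow> 0) (at 0)"
      by (simp add: filterlim_at_split)
    moreover have "flat q 0 = 0" for q by (simp add: flat_def)
    ultimately show ?thesis using 3 by (simp add: has_field_derivative_iff del: One_nat_def)
  qed
qed

lemma smooth_flat: "smooth (\<lambda>x. complex_of_real (flat p x))"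
proof (rule smooth_coinduct)
  show "(\<lambda>x. complex_of_real (flat p x)) \<in> {\<lambda>x. complex_of_real (flat p x) | p. True}" by blast
  fix w assume "w \<in> {\<lambda>x. complex_of_real (flat p x) | p. True}"
  then obtain p where w: "w = (\<lambda>x. complex_of_real (flat p x))" by blast
  have "(w has_vector_derivative complex_of_real (flat ((p - pderiv p) * [:0, 0, 1:]) x)) (at x)" for x
    unfolding w
    by (intro has_vector_derivative_of_real flat_has_derivative)
  then show "\<exists>w'\<in>{\<lambda>x. complex_of_real (flat p x) | p. True}. \<forall>x. (w has_vector_derivative w' x) (at x)"
    by (intro bexI[of _ "\<lambda>x. complex_of_real (flat ((p - pderiv p) * [:0, 0, 1:]) x)"]) auto
qed

text \<open>
  The product \<open>exp (- 1 / x) exp (- 1 / (1 - x))\<close> is a smooth bump on \<open>(0, 1)\<close>; the step is its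
  normalised antiderivative.
\<close>

lemma smooth_step:
  obtains \<psi> \<beta> :: "real \<Rightarrow> real" where
    "smooth (\<lambda>x. complex_of_real (\<psi> x))" "\<And>x. (\<psi> has_real_derivative \<beta> x) (at x)"
    "continuous_on UNIV \<beta>" "\<And>x. x \<notin> {0..1} \<Longrightarrow> \<beta> x = 0"
    "\<And>x. x \<le> 0 \<Longrightarrow> \<psi> x = 0" "\<And>x. 1 \<le> x \<Longrightarrow> \<psi> x = 1" "\<And>x. 0 \<le> \<psi> x \<and> \<psi> x \<le> 1"
proof -
  define b where "b x = flat 1 x * flat 1 (- 1 * x + 1)" for x
  have fpos: "0 < flat 1 x \<longleftrightarrow> 0 < x" "0 \<le> flat 1 x" for x
    by (auto simp: flat_def)
  have b0: "b x = 0" if "x \<notin> {0<..<1}" for x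
    using that by (auto simp: b_def flat_def)
  have bnn: "0 \<le> b x" for x by (simp add: b_def fpos)
  have bc: "isCont b x" for x
  proof -
    have c: "isCont (flat 1) x" for x by (meson DERIV_isCont flat_has_derivative)
    show ?thesis unfolding b_def by (intro continuous_intros c isCont_o2[OF _ c])
  qed
  have bsm: "smooth (\<lambda>x. complex_of_real (b x))"
    unfolding b_def of_real_mult
    by (intro smooth_mult smooth_flat smooth_affine[OF smooth_flat])
  have "\<exists>F. \<forall>x::real. (-\<infinity>::ereal) < x \<longrightarrow> x < \<infinity> \<longrightarrow> (F has_vector_derivative b x) (at x)"
    by (rule einterval_antiderivative) (auto intro: bc)
  then obtain F where F: "\<And>x. (F has_real_derivative b x) (at x)"
    by (auto simp: has_real_derivative_iff_has_vector_derivative)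
  have mono: "F x \<le> F y" if "x \<le> y" for x y
    using that F bnn by (metis DERIV_nonneg_imp_nondecreasing)
  have F01: "F 0 < F 1"
  proof -
    have "F 0 \<noteq> F 1"
    proof
      assume "F 0 = F 1"
      then have *: "F x = F 0" if "x \<in> {0<..<1}" for x using that mono[of 0 x] mono[of x 1] by auto
      have "((\<lambda>x. F 0) has_real_derivative b (1/2)) (at (1/2))"
        by (rule has_field_derivative_transform_within_open[OF F, where S="{0<..<1}"]) (use * in auto)
      then have "b (1/2) = 0" using DERIV_unique DERIV_const by metis
      then show False by (auto simp: b_def flat_def)
    qed
    then show ?thesis using mono[of 0 1] by simp
  qed
  define \<kappa> where "\<kappa> = F 1 - F 0"
  have \<kappa>: "\<kappa> > 0" using F01 by (simp add: \<kappa>_def)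
  define \<psi> where "\<psi> x = (F x - F 0) / \<kappa>" for x
  define \<beta> where "\<beta> x = b x / \<kappa>" for x
  have d: "(\<psi> has_real_derivative \<beta> x) (at x)" for x
    unfolding \<psi>_def[abs_def] \<beta>_def using \<kappa> by (auto intro!: derivative_eq_intros F)
  have const: "F x = F y" if "x < y" "y \<le> 0 \<or> 1 \<le> x" for x y
  proof -
    have "(F has_real_derivative 0) (at z)" if "x < z" "z < y" for z
      using F[of z] b0[of z] that \<open>y \<le> 0 \<or> 1 \<le> x\<close> by auto
    then show ?thesis
      using DERIV_isconst_end[of x y F] F that by (metis DERIV_isCont continuous_at_imp_continuous_on)
  qed
  have \<psi>0: "\<psi> x = 0" if "x \<le> 0" for x
    using that const[of x 0] by (cases "x = 0") (auto simp: \<psi>_def)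
  have \<psi>1: "\<psi> x = 1" if "1 \<le> x" for x
    using that const[of 1 x] \<kappa> by (cases "x = 1") (auto simp: \<psi>_def \<kappa>_def)
  have sm: "smooth (\<lambda>x. complex_of_real (\<psi> x))"
  proof -
    have sb: "smooth (\<lambda>x. complex_of_real (\<beta> x))"
    proof -
      have "smooth (\<lambda>x. complex_of_real (1 / \<kappa>))"
        by (rule smoothI_seq[of "\<lambda>l x. if l = 0 then complex_of_real (1 / \<kappa>) else 0", simplified if_True refl])
           auto
      from smooth_mult[OF this bsm] show ?thesis by (simp add: \<beta>_def)
    qed
    show ?thesis
    proof (rule smooth_coinduct)
      let ?C = "insert (\<lambda>x. complex_of_real (\<psi> x)) {w. smooth w}"
      show "(\<lambda>x. complex_of_real (\<psi> x)) \<in> ?C" by simp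
      fix w assume "w \<in> ?C"
      then consider "w = (\<lambda>x. complex_of_real (\<psi> x))" | "smooth w" by auto
      then show "\<exists>w'\<in>?C. \<forall>x. (w has_vector_derivative w' x) (at x)"
      proof cases
        case 1
        then show ?thesis using d sb
          by (intro bexI[of _ "\<lambda>x. complex_of_real (\<beta> x)"])
             (auto intro!: has_vector_derivative_of_real simp flip: has_real_derivative_iff_has_vector_derivative)
      next
        case 2
        then show ?thesis using smooth_has_vector_derivative[of w 0] smooth_nderiv[of w 1]
          by (intro bexI[of _ "nderiv 1 w"]) auto
      qed
    qed
  qed
  show thesis
  proof (rule that[OF sm d])
    show "continuous_on UNIV \<beta>" unfolding \<beta>_def
      using \<kappa> bc by (auto intro!: continuous_intros continuous_at_imp_continuous_on)
    show "\<beta> x = 0" if "x \<notin> {0..1}" for x using that b0 by (auto simp: \<beta>_def)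
    show "\<psi> x = 0" if "x \<le> 0" for x by (fact \<psi>0[OF that])
    show "\<psi> x = 1" if "1 \<le> x" for x by (fact \<psi>1[OF that])
    show "0 \<le> \<psi> x \<and> \<psi> x \<le> 1" for x
    proof -
      consider "x \<le> 0" | "1 \<le> x" | "0 \<le> x" "x \<le> 1" by linarith
      then show ?thesis
      proof cases
        case 3
        then show ?thesis using mono[of 0 x] mono[of x 1] \<kappa> by (auto simp: \<psi>_def \<kappa>_def divide_simps)
      qed (auto simp: \<psi>0 \<psi>1)
    qed
  qed
qed

section \<open>Weak derivatives on an interval\<close>

text \<open>
  The bumps \<open>N \<beta> (N (x - s))\<close> concentrate at \<open>s\<close>; the substitution \<open>x = s + u / N\<close> turns this into
  dominated convergence.
\<close>

lemma tendsto_integral_bump: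
  fixes G :: "real \<Rightarrow> complex" and \<beta> :: "real \<Rightarrow> real"
  assumes G[measurable]: "G \<in> borel_measurable borel" and bd: "\<And>x. cmod (G x) \<le> C"
    and cont: "isCont G s"
    and \<beta>: "integrable lborel \<beta>"
    and N: "filterlim N at_top sequentially" and N0: "\<And>n. N n > (0::real)"
  shows "(\<lambda>n. LBINT x. G x * complex_of_real (N n * \<beta> (N n * (x - s))))
      \<longlonglongrightarrow> G s * complex_of_real (LBINT u. \<beta> u)"
proof -
  have [measurable]: "\<beta> \<in> borel_measurable borel" using \<beta> by auto
  have "(LBINT x. G x * complex_of_real (N n * \<beta> (N n * (x - s))))
      = (LBINT u. G (s + u / N n) * complex_of_real (\<beta> u))" for n
    by (subst lborel_integral_real_affine[of "1 / N n" _ s])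
       (use N0[of n] in \<open>auto simp: scaleR_conv_of_real mult_ac simp flip: integral_mult_right_zero\<close>)
  moreover have "(\<lambda>n. LBINT u. G (s + u / N n) * complex_of_real (\<beta> u))
      \<longlonglongrightarrow> (LBINT u. G s * complex_of_real (\<beta> u))"
  proof (rule integral_dominated_convergence[where w="\<lambda>u. C * \<bar>\<beta> u\<bar>"])
    show "integrable lborel (\<lambda>u. C * \<bar>\<beta> u\<bar>)" using \<beta> by auto
    show "AE u in lborel. (\<lambda>n. G (s + u / N n) * complex_of_real (\<beta> u)) \<longlonglongrightarrow> G s * complex_of_real (\<beta> u)"
    proof (intro AE_I2 tendsto_mult_right)
      fix u
      have "(\<lambda>n. s + u / N n) \<longlonglongrightarrow> s + 0"
        by (intro tendsto_add tendsto_const tendsto_divide_0[OF tendsto_const] filterlim_at_top_imp_at_infinity N)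
      then show "(\<lambda>n. G (s + u / N n)) \<longlonglongrightarrow> G s"
        using isCont_tendsto_compose[OF cont] by simp
    qed
    show "AE u in lborel. norm (G (s + u / N n) * complex_of_real (\<beta> u)) \<le> C * \<bar>\<beta> u\<bar>" for n
      using bd by (auto simp: norm_mult intro!: mult_right_mono)
  qed auto
  ultimately show ?thesis by simp
qed

text \<open>
  The differences \<open>\<psi> (N (x - s)) - \<psi> (N (x - t))\<close> of steepening steps. They converge to the indicator of
  \<open>(s, t]\<close>, while their derivatives converge to the difference of point masses at \<open>s\<close> and \<open>t\<close>, so
  that a weak derivative tested against them yields the fundamental theorem of calculus.
\<close>

lemma test_functions_to_indicator:
  assumes ab: "a < s" "s < t" "t < b"
  obtains \<phi> :: "nat \<Rightarrow> real \<Rightarrow> complex" where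
    "\<And>n. test_function a b (\<phi> n)"
    "\<And>n x. cmod (\<phi> n x) \<le> 1"
    "\<And>x. (\<lambda>n. \<phi> n x) \<longlonglongrightarrow> indicator {s<..t} x"
    "\<And>g. continuous_on {a..b} g \<Longrightarrow>
      (\<lambda>n. LBINT x:{a<..<b}. g x * nderiv 1 (\<phi> n) x) \<longlonglongrightarrow> g s - g t"
proof -
  obtain \<psi> \<beta> :: "real \<Rightarrow> real" where \<psi>:
    "smooth (\<lambda>x. complex_of_real (\<psi> x))" "\<And>x. (\<psi> has_real_derivative \<beta> x) (at x)"
    "continuous_on UNIV \<beta>" "\<And>x. x \<notin> {0..1} \<Longrightarrow> \<beta> x = 0"
    "\<And>x. x \<le> 0 \<Longrightarrow> \<psi> x = 0" "\<And>x. 1 \<le> x \<Longrightarrow> \<psi> x = 1" "\<And>x. 0 \<le> \<psi> x \<and> \<psi> x \<le> 1"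
    by (rule smooth_step) blast
  \<comment> \<open>The offset keeps \<open>t + 1 / N n\<close> below \<open>b\<close>, so that all these functions are test functions.\<close>
  define N where "N n = (1 + 1 / (b - t)) + real n" for n
  have Npos: "N n > 0" "1 / N n < b - t" for n
  proof -
    have "1 / (b - t) > 0" using ab by simp
    then show "N n > 0" by (simp add: N_def add_pos_nonneg)
    have "1 / (b - t) < N n" by (simp add: N_def)
    then show "1 / N n < b - t" using ab \<open>N n > 0\<close> by (simp add: field_simps)
  qed
  have Nlim: "filterlim N at_top sequentially"
    unfolding N_def by (intro filterlim_tendsto_add_at_top[OF tendsto_const] filterlim_real_sequentially)
  have \<beta>int: "integrable lborel \<beta>" and \<beta>1: "(LBINT u. \<beta> u) = 1"
  proof -
    have "has_bochner_integral lborel (\<lambda>x. \<beta> x * indicator {0..1} x) (\<psi> 1 - \<psi> 0)"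
      using \<psi>(2,3) by (intro has_bochner_integral_FTC_Icc_real) (auto simp: continuous_on_eq_continuous_at)
    moreover have "(\<lambda>x. \<beta> x * indicator {0..1} x) = \<beta>"
      using \<psi>(4) by (auto simp: fun_eq_iff indicator_def)
    ultimately show "integrable lborel \<beta>" "(LBINT u. \<beta> u) = 1"
      using \<psi>(5)[of 0] \<psi>(6)[of 1] by (auto simp: has_bochner_integral_iff)
  qed
  define \<phi> where "\<phi> n x = complex_of_real (\<psi> (N n * x + - N n * s)) - complex_of_real (\<psi> (N n * x + - N n * t))" for n x
  have arg: "N n * x + - N n * r = N n * (x - r)" for n x r by (simp add: algebra_simps)
  have sm: "smooth (\<phi> n)" for n
    unfolding \<phi>_def by (intro smooth_diff smooth_affine \<psi>)
  have der: "nderiv 1 (\<phi> n) x = complex_of_real (N n * \<beta> (N n * (x - s))) - complex_of_real (N n * \<beta> (N n * (x - t)))" for n x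
  proof -
    have "((\<lambda>x. \<psi> (N n * x + - N n * r)) has_real_derivative N n * \<beta> (N n * (x - r))) (at x)" for r
    proof -
      have "((\<lambda>x. N n * x + - N n * r) has_real_derivative N n) (at x)"
        by (auto intro!: derivative_eq_intros)
      from DERIV_chain2[OF \<psi>(2) this] show ?thesis unfolding arg mult.commute[of _ "N n"] .
    qed
    then have "((\<phi> n) has_vector_derivative complex_of_real (N n * \<beta> (N n * (x - s))) - complex_of_real (N n * \<beta> (N n * (x - t)))) (at x)"
      unfolding \<phi>_def by (intro has_vector_derivative_diff has_vector_derivative_of_real)
    then show ?thesis by (simp add: nderiv_Suc vector_derivative_at)
  qed
  show thesis
  proof (rule that[of \<phi>])
    show "test_function a b (\<phi> n)" for n
      unfolding test_function_def
    proof (intro conjI exI[of _ "{s..t + 1 / N n}"] allI impI sm)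
      show "{s..t + 1 / N n} \<subseteq> {a<..<b}" using ab Npos[of n] by auto
      fix x assume x: "x \<notin> {s..t + 1 / N n}"
      then consider "x < s" | "x > t + 1 / N n" by force
      then show "\<phi> n x = 0"
      proof cases
        case 1
        then have "N n * (x - s) \<le> 0" "N n * (x - t) \<le> 0"
          using Npos(1)[of n] ab by (auto simp: mult_le_0_iff)
        then show ?thesis unfolding \<phi>_def arg by (simp add: \<psi>)
      next
        case 2
        then have "N n * (1 / N n) \<le> N n * (x - t)"
          using Npos(1)[of n] by (intro mult_left_mono) auto
        moreover have "N n * (x - t) \<le> N n * (x - s)"
          using Npos(1)[of n] ab by (intro mult_left_mono) auto
        moreover have "N n * (1 / N n) = 1" using Npos(1)[of n] by simp
        ultimately have "1 \<le> N n * (x - t)" "1 \<le> N n * (x - s)" by linarith+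
        then show ?thesis unfolding \<phi>_def arg by (simp add: \<psi>)
      qed
    qed simp
    show "cmod (\<phi> n x) \<le> 1" for n x
    proof -
      have "\<bar>\<psi> u - \<psi> v\<bar> \<le> 1" for u v using \<psi>(7)[of u] \<psi>(7)[of v] by auto
      then show ?thesis unfolding \<phi>_def by (simp only: norm_of_real flip: of_real_diff)
    qed
    have lim: "(\<lambda>n. complex_of_real (\<psi> (N n * (x - r)))) \<longlonglongrightarrow> (if r < x then 1 else 0)" for x r
    proof (cases "r < x")
      case True
      then have "filterlim (\<lambda>n. (x - r) * N n) at_top sequentially"
        by (intro filterlim_tendsto_pos_mult_at_top[OF tendsto_const] Nlim) auto
      then have "\<forall>\<^sub>F n in sequentially. 1 \<le> (x - r) * N n"
        by (simp add: filterlim_at_top)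
      then have "\<forall>\<^sub>F n in sequentially. complex_of_real (\<psi> (N n * (x - r))) = 1"
        by eventually_elim (simp add: \<psi> mult.commute)
      then show ?thesis using True by (simp add: tendsto_eventually)
    next
      case False
      then have "N n * (x - r) \<le> 0" for n using Npos(1)[of n] by (auto simp: mult_le_0_iff)
      then show ?thesis using False by (simp add: \<psi>)
    qed
    show "(\<lambda>n. \<phi> n x) \<longlonglongrightarrow> indicator {s<..t} x" for x
      unfolding \<phi>_def arg using tendsto_diff[OF lim[of x s] lim[of x t]] ab
      by (auto simp: indicator_def split: if_splits)
    fix g :: "real \<Rightarrow> complex" assume g: "continuous_on {a..b} g"
    define G where "G x = indicator {a<..<b} x *\<^sub>R g x" for x
    have g': "continuous_on {a<..<b} g" using g by (rule continuous_on_subset) auto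
    have Gm[measurable]: "G \<in> borel_measurable borel"
      unfolding G_def by (intro borel_measurable_continuous_on_indicator g') auto
    have "compact (g ` {a..b})" using g by (intro compact_continuous_image) auto
    then have "bounded (g ` {a..b})" by (rule compact_imp_bounded)
    then obtain C where "C > 0" "\<forall>x\<in>{a..b}. cmod (g x) \<le> C" by (auto simp: bounded_pos)
    then have C: "\<And>x. x \<in> {a..b} \<Longrightarrow> cmod (g x) \<le> C" "C > 0" by auto
    have GC: "cmod (G x) \<le> C" for x
      using C by (auto simp: G_def indicator_def less_imp_le)
    have Gc: "isCont G r" if "r \<in> {a<..<b}" for r
    proof -
      have "isCont g r" using g' that by (simp add: continuous_on_eq_continuous_at)
      moreover have "\<forall>\<^sub>F x in nhds r. G x = g x"
        using that eventually_nhds_in_open[of "{a<..<b}" r] by (auto elim!: eventually_mono simp: G_def)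
      ultimately show ?thesis by (subst isCont_cong) auto
    qed
    have lim: "(\<lambda>n. LBINT x. G x * complex_of_real (N n * \<beta> (N n * (x - r)))) \<longlonglongrightarrow> g r"
      if "r \<in> {a<..<b}" for r
      using tendsto_integral_bump[OF Gm GC Gc[OF that] \<beta>int Nlim Npos(1)] that by (simp add: \<beta>1 G_def)
    have int: "integrable lborel (\<lambda>x. G x * complex_of_real (N n * \<beta> (N n * (x - r))))" for n r
    proof (rule Bochner_Integration.integrable_bound)
      have "integrable lborel (\<lambda>x. \<beta> (- N n * r + N n * x))"
        using Npos(1)[of n] by (intro lborel_integrable_real_affine \<beta>int) auto
      then show "integrable lborel (\<lambda>x. C * (N n * \<bar>\<beta> (N n * (x - r))\<bar>))"
        by (auto simp: algebra_simps)
      have [measurable]: "\<beta> \<in> borel_measurable borel" using \<beta>int by auto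
      show "(\<lambda>x. G x * complex_of_real (N n * \<beta> (N n * (x - r)))) \<in> borel_measurable lborel" by measurable
      show "AE x in lborel. norm (G x * complex_of_real (N n * \<beta> (N n * (x - r))))
          \<le> norm (C * (N n * \<bar>\<beta> (N n * (x - r))\<bar>))"
        using GC C(2) Npos(1)[of n] by (auto simp: norm_mult abs_mult intro!: mult_right_mono)
    qed
    have "(LBINT x:{a<..<b}. g x * nderiv 1 (\<phi> n) x) =
      (LBINT x. G x * complex_of_real (N n * \<beta> (N n * (x - s)))) - (LBINT x. G x * complex_of_real (N n * \<beta> (N n * (x - t))))" for n
      unfolding Bochner_Integration.integral_diff[OF int int, symmetric] set_lebesgue_integral_def der
      by (intro Bochner_Integration.integral_cong) (auto simp: G_def algebra_simps indicator_def)
    then show "(\<lambda>n. LBINT x:{a<..<b}. g x * nderiv 1 (\<phi> n) x) \<longlonglongrightarrow> g s - g t"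
      using tendsto_diff[OF lim lim, of s t] ab by simp
  qed
qed

lemma tendsto_integral_test_functions:
  fixes h :: "real \<Rightarrow> complex"
  assumes h: "set_integrable lborel {a<..<b} h" and ab: "a < s" "t < b"
    and \<phi>: "\<And>n. test_function a b (\<phi> n)" "\<And>n x. cmod (\<phi> n x) \<le> 1"
       "\<And>x. (\<lambda>n. \<phi> n x) \<longlonglongrightarrow> indicator {s<..t} x"
  shows "(\<lambda>n. LBINT x:{a<..<b}. h x * \<phi> n x) \<longlonglongrightarrow> (LBINT x:{s<..t}. h x)"
  unfolding set_lebesgue_integral_def
proof (rule integral_dominated_convergence[where w="\<lambda>x. norm (indicator {a<..<b} x *\<^sub>R h x)"])
  note [measurable] = h[unfolded set_integrable_def, THEN borel_measurable_integrable]
  have [measurable]: "\<phi> n \<in> borel_measurable borel" for n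
  proof -
    have "continuous_on UNIV (\<phi> n)" using smooth_continuous_on[of "\<phi> n" UNIV 0] \<phi>(1)[of n] by (simp add: test_function_def)
    then show ?thesis by (rule borel_measurable_continuous_onI)
  qed
  have "set_integrable lborel {s<..t} h"
    by (rule set_integrable_subset[OF h]) (use ab in auto)
  then show "(\<lambda>x. indicator {s<..t} x *\<^sub>R h x) \<in> borel_measurable lborel"
    by (simp add: set_integrable_def)
  have "(\<lambda>x. (indicator {a<..<b} x *\<^sub>R h x) * \<phi> n x) \<in> borel_measurable lborel" for n by measurable
  then show "(\<lambda>x. indicator {a<..<b} x *\<^sub>R (h x * \<phi> n x)) \<in> borel_measurable lborel" for n by simp
  show "integrable lborel (\<lambda>x. norm (indicator {a<..<b} x *\<^sub>R h x))"
    by (rule integrable_norm[OF h[unfolded set_integrable_def]])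
  show "AE x in lborel. norm (indicator {a<..<b} x *\<^sub>R (h x * \<phi> n x)) \<le> norm (indicator {a<..<b} x *\<^sub>R h x)" for n
    using mult_left_mono[OF \<phi>(2)[of n] norm_ge_zero[of "h _"]]
    by (auto simp: norm_mult indicator_def)
  show "AE x in lborel. (\<lambda>n. indicator {a<..<b} x *\<^sub>R (h x * \<phi> n x)) \<longlonglongrightarrow> indicator {s<..t} x *\<^sub>R h x"
  proof (rule AE_I2)
    fix x
    have "(\<lambda>n. indicator {a<..<b} x *\<^sub>R (h x * \<phi> n x)) \<longlonglongrightarrow> indicator {a<..<b} x *\<^sub>R (h x * indicator {s<..t} x)"
      by (intro tendsto_intros \<phi>(3))
    also have "indicator {a<..<b} x *\<^sub>R (h x * indicator {s<..t} x) = indicator {s<..t} x *\<^sub>R h x"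
      using ab by (auto simp: indicator_def)
    finally show "(\<lambda>n. indicator {a<..<b} x *\<^sub>R (h x * \<phi> n x)) \<longlonglongrightarrow> indicator {s<..t} x *\<^sub>R h x" .
  qed
qed

text \<open>
  The lemma of du Bois-Reymond, in the form in which it is used: a continuous function with an integrable
  weak derivative is its antiderivative.
\<close>

lemma weak_deriv_FTC:
  assumes g: "continuous_on {a..b} g" and h: "set_integrable lborel {a<..<b} h"
    and weak: "\<And>\<phi>. test_function a b \<phi> \<Longrightarrow>
      (LBINT x:{a<..<b}. g x * nderiv 1 \<phi> x) = - (LBINT x:{a<..<b}. h x * \<phi> x)"
    and st: "a < s" "s < t" "t < b"
  shows "g t - g s = (LBINT x:{s<..t}. h x)"
proof -
  obtain \<phi> :: "nat \<Rightarrow> real \<Rightarrow> complex" where \<phi>: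
    "\<And>n. test_function a b (\<phi> n)"
    "\<And>n x. cmod (\<phi> n x) \<le> 1"
    "\<And>x. (\<lambda>n. \<phi> n x) \<longlonglongrightarrow> indicator {s<..t} x"
    "\<And>g. continuous_on {a..b} g \<Longrightarrow>
      (\<lambda>n. LBINT x:{a<..<b}. g x * nderiv 1 (\<phi> n) x) \<longlonglongrightarrow> g s - g t"
    by (rule test_functions_to_indicator[OF st]) blast
  have "(\<lambda>n. - (LBINT x:{a<..<b}. h x * \<phi> n x)) \<longlonglongrightarrow> - (LBINT x:{s<..t}. h x)"
    by (intro tendsto_minus tendsto_integral_test_functions[OF h _ _ \<phi>(1-3)]) (use st in auto)
  moreover have "(\<lambda>n. - (LBINT x:{a<..<b}. h x * \<phi> n x)) \<longlonglongrightarrow> g s - g t"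
    using \<phi>(4)[OF g] weak[OF \<phi>(1)] by simp
  ultimately have "- (LBINT x:{s<..t}. h x) = g s - g t" by (rule LIMSEQ_unique)
  then show ?thesis by (simp add: algebra_simps)
qed

text \<open>
  The half lines generate the Borel sets and are closed under intersection, so by Dynkin's theorem the integral
  vanishes over every Borel set.
\<close>

lemma integral_atMost_zero_imp_AE_zero:
  fixes F :: "real \<Rightarrow> complex"
  assumes F: "integrable lborel F" and z: "\<And>t. (LBINT x:{..t}. F x) = 0"
  shows "AE x in lborel. F x = 0"
proof (rule sigma_finite_measure.density_zero[OF lborel.sigma_finite_measure_axioms F])
  have [simp]: "set_integrable lborel A F" if "A \<in> sets borel" for A
    using F that unfolding set_integrable_def by (intro integrable_mult_indicator) auto
  have U: "(LBINT x:UNIV. F x) = 0"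
  proof -
    have "(\<lambda>n. LBINT x:{..real n}. F x) \<longlonglongrightarrow> (LBINT x:(\<Union>n. {..real n}). F x)"
      by (rule set_integral_cont_up) (auto simp: incseq_def)
    also have "(\<Union>n. {..real n}) = UNIV" by (auto simp: real_arch_simple)
    finally show ?thesis by (simp add: z LIMSEQ_const_iff)
  qed
  have sb: "sigma_sets UNIV (range (\<lambda>a::real. {..a})) = sets borel"
    by (subst borel_eq_atMost) (simp add: sets_measure_of)
  fix A assume "A \<in> sets (lborel :: real measure)"
  then have A: "A \<in> sigma_sets UNIV (range (\<lambda>a::real. {..a}))"
    by (simp add: sb)
  have "Int_stable (range (\<lambda>a::real. {..a}))"
    by (auto simp: Int_stable_def)
  moreover have "range (\<lambda>a::real. {..a}) \<subseteq> Pow UNIV" by simp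
  ultimately show "(LBINT x:A. F x) = 0" using A
  proof (induction rule: sigma_sets_induct_disjoint)
    case (compl A)
    then have A: "A \<in> sets borel" by (simp add: sb)
    have "(LBINT x:A \<union> (UNIV - A). F x) = (LBINT x:A. F x) + (LBINT x:UNIV - A. F x)"
      by (rule set_integral_Un) (use A in auto)
    then show ?case using compl U by simp
  next
    case (union A)
    then have A: "A n \<in> sets borel" for n by (auto simp: sb)
    have "(LBINT x:(\<Union>i. A i). F x) = (\<Sum>i. (LBINT x:(A i). F x))"
      by (rule lebesgue_integral_countable_add) (use A union in \<open>auto simp: disjoint_family_on_def\<close>)
    then show ?case using union by simp
  qed (use z in \<open>auto simp: set_lebesgue_integral_def\<close>)
qed

text \<open>
  Testing with approximations of indicators shows that the integral over each \<open>(s, t]\<close> vanishes.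
\<close>

lemma weak_zero_imp_AE_zero:
  fixes u :: "real \<Rightarrow> complex"
  assumes u: "set_integrable lborel {a<..<b} u" and ab: "a < b"
    and weak: "\<And>\<phi>. test_function a b \<phi> \<Longrightarrow> (LBINT x:{a<..<b}. u x * \<phi> x) = 0"
  shows "AE x in lborel. x \<in> {a<..<b} \<longrightarrow> u x = 0"
proof -
  have z: "(LBINT x:{s<..t}. u x) = 0" if st: "a < s" "t < b" for s t
  proof (cases "s < t")
    case True
    obtain \<phi> :: "nat \<Rightarrow> real \<Rightarrow> complex" where \<phi>:
      "\<And>n. test_function a b (\<phi> n)"
      "\<And>n x. cmod (\<phi> n x) \<le> 1"
      "\<And>x. (\<lambda>n. \<phi> n x) \<longlonglongrightarrow> indicator {s<..t} x"
      by (rule test_functions_to_indicator[OF st(1) True st(2)]) blast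
    have "(\<lambda>n. (LBINT x:{a<..<b}. u x * \<phi> n x)) \<longlonglongrightarrow> (LBINT x:{s<..t}. u x)"
      by (intro tendsto_integral_test_functions[OF u _ _ \<phi>(1-3)]) (use st in auto)
    then show ?thesis using weak[OF \<phi>(1)] by (simp add: LIMSEQ_const_iff)
  qed (simp add: set_lebesgue_integral_def)
  let ?F = "\<lambda>x. indicator {a<..<b} x *\<^sub>R u x"
  have F: "integrable lborel ?F" using u by (simp add: set_integrable_def)
  have "AE x in lborel. ?F x = 0"
  proof (rule integral_atMost_zero_imp_AE_zero[OF F])
    fix t
    define d where "d n = (b - a) / (real n + 1)" for n
    have d: "d n > 0" for n using ab by (simp add: d_def)
    have dlim: "d \<longlonglongrightarrow> 0" unfolding d_def by real_asymp
    have "(\<lambda>n. LBINT x. indicator {a + d n<..min t (b - d n)} x *\<^sub>R ?F x) \<longlonglongrightarrow> (LBINT x. indicator {..t} x *\<^sub>R ?F x)"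
    proof (rule integral_dominated_convergence[where w="\<lambda>x. norm (?F x)"])
      note [measurable] = borel_measurable_integrable[OF F]
      show "integrable lborel (\<lambda>x. norm (?F x))" by (rule integrable_norm[OF F])
      show "AE x in lborel. (\<lambda>n. indicator {a + d n<..min t (b - d n)} x *\<^sub>R ?F x) \<longlonglongrightarrow> indicator {..t} x *\<^sub>R ?F x"
      proof (rule AE_I2)
        fix x
        show "(\<lambda>n. indicator {a + d n<..min t (b - d n)} x *\<^sub>R ?F x) \<longlonglongrightarrow> indicator {..t} x *\<^sub>R ?F x"
        proof (cases "x \<in> {a<..<b}")
          case True
          then have "\<forall>\<^sub>F n in sequentially. d n < min (x - a) (b - x)"
            by (intro order_tendstoD[OF dlim]) auto
          then have "\<forall>\<^sub>F n in sequentially. indicator {a + d n<..min t (b - d n)} x *\<^sub>R ?F x = indicator {..t} x *\<^sub>R ?F x"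
            by eventually_elim (auto simp: indicator_def)
          then show ?thesis by (rule tendsto_eventually)
        qed auto
      qed
      show "AE x in lborel. norm (indicator {a + d n<..min t (b - d n)} x *\<^sub>R ?F x) \<le> norm (?F x)" for n
        by (auto simp: indicator_def)
    qed (intro borel_measurable_scaleR borel_measurable_indicator borel_measurable_integrable[OF F]; simp)+
    moreover have "(LBINT x. indicator {a + d n<..min t (b - d n)} x *\<^sub>R ?F x) = 0" for n
    proof -
      have "(LBINT x. indicator {a + d n<..min t (b - d n)} x *\<^sub>R ?F x) = (LBINT x:{a + d n<..min t (b - d n)}. u x)"
        unfolding set_lebesgue_integral_def
        by (intro Bochner_Integration.integral_cong) (use d[of n] in \<open>auto simp: indicator_def\<close>)
      also have "\<dots> = 0" by (rule z) (use d[of n] in auto)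
      finally show ?thesis .
    qed
    ultimately show "(LBINT x:{..t}. ?F x) = 0"
      by (simp add: LIMSEQ_const_iff set_lebesgue_integral_def)
  qed
  then show ?thesis by eventually_elim (auto simp: indicator_def)
qed

lemma Cauchy_Schwarz_integral:
  fixes u v :: "'a \<Rightarrow> real"
  assumes [measurable]: "u \<in> borel_measurable M" "v \<in> borel_measurable M"
    and u: "integrable M (\<lambda>x. (u x)\<^sup>2)" and v: "integrable M (\<lambda>x. (v x)\<^sup>2)"
  shows integrable_mult_L2: "integrable M (\<lambda>x. u x * v x)"
    and Cauchy_Schwarz_integral_abs: "(\<integral>x. \<bar>u x * v x\<bar> \<partial>M)\<^sup>2 \<le> (\<integral>x. (u x)\<^sup>2 \<partial>M) * (\<integral>x. (v x)\<^sup>2 \<partial>M)"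
proof -
  show uv: "integrable M (\<lambda>x. u x * v x)"
  proof (rule Bochner_Integration.integrable_bound)
    show "integrable M (\<lambda>x. (u x)\<^sup>2 + (v x)\<^sup>2)" using u v by auto
    have "\<bar>a * b\<bar> \<le> a\<^sup>2 + b\<^sup>2" for a b :: real
    proof -
      have "2 * (\<bar>a\<bar> * \<bar>b\<bar>) \<le> a\<^sup>2 + b\<^sup>2"
        using sum_squares_bound[of "\<bar>a\<bar>" "\<bar>b\<bar>"] by (simp add: mult.assoc)
      moreover have "0 \<le> \<bar>a\<bar> * \<bar>b\<bar>" by simp
      ultimately show ?thesis unfolding abs_mult by linarith
    qed
    then show "AE x in M. norm (u x * v x) \<le> norm ((u x)\<^sup>2 + (v x)\<^sup>2)" by auto
  qed measurable
  define X Y Z where "X = (\<integral>x. (u x)\<^sup>2 \<partial>M)" and "Y = (\<integral>x. (v x)\<^sup>2 \<partial>M)" and "Z = (\<integral>x. \<bar>u x * v x\<bar> \<partial>M)"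
  have nn: "0 \<le> X" "0 \<le> Y" "0 \<le> Z" by (auto simp: X_def Y_def Z_def)
  have quad: "0 \<le> X - 2 * t * Z + t\<^sup>2 * Y" for t
  proof -
    have "0 \<le> (\<integral>x. (u x)\<^sup>2 - 2 * t * \<bar>u x * v x\<bar> + t\<^sup>2 * (v x)\<^sup>2 \<partial>M)"
    proof (intro Bochner_Integration.integral_nonneg)
      fix x
      have "0 \<le> (\<bar>u x\<bar> - t * \<bar>v x\<bar>)\<^sup>2" by simp
      then show "0 \<le> (u x)\<^sup>2 - 2 * t * \<bar>u x * v x\<bar> + t\<^sup>2 * (v x)\<^sup>2"
        by (simp add: power2_diff power_mult_distrib abs_mult algebra_simps)
    qed
    also have "\<dots> = X - 2 * t * Z + t\<^sup>2 * Y"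
      using u v integrable_abs[OF uv] by (simp add: X_def Y_def Z_def)
    finally show ?thesis .
  qed
  have "Z\<^sup>2 \<le> X * Y"
  proof (cases "Y = 0")
    case True
    have "Z = 0"
    proof (rule ccontr)
      assume "Z \<noteq> 0"
      then show False using quad[of "(X + 1) / (2 * Z)"] True by simp
    qed
    then show ?thesis using nn by simp
  next
    case False
    then have "0 \<le> (X - 2 * (Z / Y) * Z + (Z / Y)\<^sup>2 * Y) * Y" using quad[of "Z / Y"] nn by (intro mult_nonneg_nonneg)
    also have "\<dots> = X * Y - Z\<^sup>2" using False by (simp add: field_simps power2_eq_square)
    finally show ?thesis by simp
  qed
  then show "(\<integral>x. \<bar>u x * v x\<bar> \<partial>M)\<^sup>2 \<le> (\<integral>x. (u x)\<^sup>2 \<partial>M) * (\<integral>x. (v x)\<^sup>2 \<partial>M)"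
    by (simp add: X_def Y_def Z_def)
qed

lemma set_integral_Ioo_eq_Icc: "(LBINT x:{a<..<b}. f x) = (LBINT x:{a..b}. f x)"
  for f :: "real \<Rightarrow> 'b::{banach, second_countable_topology}"
  by (rule set_integral_discrete_difference[where X="{a, b}"]) auto

lemma continuous_on_Icc_imp_integrable_Ioo:
  fixes f :: "real \<Rightarrow> complex"
  shows "continuous_on {a..b} f \<Longrightarrow> set_integrable lborel {a<..<b} f"
  by (rule set_integrable_subset[OF borel_integrable_atLeastAtMost']) auto

lemma continuous_on_Icc_imp_L2_on:
  fixes f :: "real \<Rightarrow> complex"
  assumes f: "continuous_on {a..b} f"
  shows "L2_on {a<..<b} f"
proof -
  have "set_integrable lborel {a<..<b} (\<lambda>x. (cmod (f x))\<^sup>2)"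
    by (rule set_integrable_subset[OF borel_integrable_atLeastAtMost'])
       (auto intro!: continuous_intros f)
  then show ?thesis
    using continuous_on_Icc_imp_integrable_Ioo[OF f]
    by (auto simp: L2_on_def set_integrable_def set_borel_measurable_def)
qed

lemma L2_on_interval_integrable:
  assumes f: "L2_on {a<..<b} f" and ab: "a \<le> b"
  shows "set_integrable lborel {a<..<b} f"
    and "(LBINT x:{a<..<b}. cmod (f x))\<^sup>2 \<le> (b - a) * energy_on {a<..<b} f"
proof -
  let ?I = "indicator {a<..<b} :: real \<Rightarrow> real"
  have m[measurable]: "(\<lambda>x. ?I x *\<^sub>R f x) \<in> borel_measurable borel"
    using f by (simp add: L2_on_def set_borel_measurable_def)
  have n: "(\<lambda>x. cmod (?I x *\<^sub>R f x)) \<in> borel_measurable lborel"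
    using measurable_compose[OF m borel_measurable_norm] by (simp only: measurable_lborel2)
  have sq: "(\<lambda>x. (cmod (?I x *\<^sub>R f x))\<^sup>2) = (\<lambda>x. ?I x *\<^sub>R (cmod (f x))\<^sup>2)"
    by (auto simp: fun_eq_iff indicator_def)
  have Isq: "(\<lambda>x. (?I x)\<^sup>2) = ?I" by (auto simp: fun_eq_iff indicator_def)
  have I2: "integrable lborel (\<lambda>x. (?I x)\<^sup>2)"
    unfolding Isq using ab by (intro integrable_real_indicator) auto
  have f2: "integrable lborel (\<lambda>x. (cmod (?I x *\<^sub>R f x))\<^sup>2)"
    unfolding sq using f by (simp add: L2_on_def set_integrable_def)
  have e: "?I x * cmod (?I x *\<^sub>R f x) = ?I x *\<^sub>R cmod (f x)" for x by (auto simp: indicator_def)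
  have im: "?I \<in> borel_measurable lborel" by simp
  have "integrable lborel (\<lambda>x. ?I x *\<^sub>R cmod (f x))"
    using integrable_mult_L2[OF im n I2 f2] unfolding e .
  then have "integrable lborel (\<lambda>x. cmod (?I x *\<^sub>R f x))" by simp
  then show "set_integrable lborel {a<..<b} f"
    using m unfolding set_integrable_def by (subst (asm) integrable_norm_iff) auto
  have e2: "(\<lambda>x. \<bar>?I x * cmod (?I x *\<^sub>R f x)\<bar>) = (\<lambda>x. ?I x *\<^sub>R cmod (f x))"
    by (auto simp: fun_eq_iff indicator_def)
  have I: "(\<integral>x. (?I x)\<^sup>2 \<partial>lborel) = b - a"
    unfolding Isq using ab by simp
  show "(LBINT x:{a<..<b}. cmod (f x))\<^sup>2 \<le> (b - a) * energy_on {a<..<b} f"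
    using Cauchy_Schwarz_integral_abs[OF im n I2 f2] unfolding sq e2 I set_lebesgue_integral_def .
qed

lemma test_function_nderiv:
  assumes "test_function a b \<phi>"
  shows "test_function a b (nderiv i \<phi>)"
proof -
  obtain K where K: "smooth \<phi>" "compact K" "K \<subseteq> {a<..<b}" "\<And>x. x \<notin> K \<Longrightarrow> \<phi> x = 0"
    using assms by (auto simp: test_function_def)
  have "nderiv i \<phi> x = 0" if "x \<notin> K" for x
    using that
  proof (induction i arbitrary: x)
    case (Suc i)
    have "((\<lambda>x. 0) has_vector_derivative 0) (at x)" by simp
    then have "(nderiv i \<phi> has_vector_derivative 0) (at x)"
      by (rule has_vector_derivative_transform_within_open[where S="- K"])
         (use Suc K in \<open>auto simp: compact_imp_closed\<close>)
    then show ?case by (simp add: nderiv_Suc vector_derivative_at)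
  qed (simp add: K)
  then show ?thesis using K by (auto simp: test_function_def smooth_nderiv)
qed

text \<open>
  A derivative of a test function is a test function, so the weak derivatives of \<open>f\<close> of consecutive
  orders are weak derivatives of one another; the definition only relates each of them to \<open>f\<close>.
\<close>

lemma weak_deriv_Suc:
  assumes g: "weak_deriv a b i f g" and h: "weak_deriv a b (Suc i) f h" and \<phi>: "test_function a b \<phi>"
  shows "(LBINT x:{a<..<b}. g x * nderiv 1 \<phi> x) = - (LBINT x:{a<..<b}. h x * \<phi> x)"
proof -
  let ?G = "LBINT x:{a<..<b}. g x * nderiv 1 \<phi> x" and ?H = "LBINT x:{a<..<b}. h x * \<phi> x"
  have "(- 1) ^ i * ?G = (LBINT x:{a<..<b}. f x * nderiv i (nderiv 1 \<phi>) x)"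
    using g test_function_nderiv[OF \<phi>, of 1] by (simp add: weak_deriv_def)
  also have "\<dots> = (- 1) ^ Suc i * ?H"
    using h \<phi> by (simp add: weak_deriv_def nderiv_nderiv)
  finally have "(- 1) ^ i * ?G = (- 1) ^ i * (- ?H)" by simp
  then show ?thesis by (metis mult_left_cancel power_not_zero neg_equal_0_iff_equal zero_neq_one)
qed

text \<open>
  Inside the interval this is \<open>weak_deriv_FTC\<close>; continuity carries it to the endpoints, where the boundary
  values of Sobolev functions are taken.
\<close>

lemma weak_deriv_increment_bound:
  assumes g: "continuous_on {a..b} g" and h: "set_integrable lborel {a<..<b} h"
    and weak: "\<And>\<phi>. test_function a b \<phi> \<Longrightarrow>
      (LBINT x:{a<..<b}. g x * nderiv 1 \<phi> x) = - (LBINT x:{a<..<b}. h x * \<phi> x)"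
    and ab: "a < b" and st: "s \<in> {a..b}" "t \<in> {a..b}"
  shows "cmod (g t - g s) \<le> (LBINT x:{a<..<b}. cmod (h x))"
proof -
  let ?M = "LBINT x:{a<..<b}. cmod (h x)"
  have hn: "set_integrable lborel {a<..<b} (\<lambda>x. cmod (h x))"
    using integrable_norm[OF h[unfolded set_integrable_def]] unfolding set_integrable_def by simp
  have M0: "0 \<le> ?M" unfolding set_lebesgue_integral_def by simp
  have 1: "cmod (g t - g s) \<le> ?M" if "a < s" "s < t" "t < b" for s t
  proof -
    have "g t - g s = (LBINT x:{s<..t}. h x)"
      by (rule weak_deriv_FTC[OF g h weak that])
    also have "cmod \<dots> \<le> (LBINT x:{s<..t}. cmod (h x))"
      by (rule set_integral_norm_bound[OF set_integrable_subset[OF h]]) (use that in auto)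
    also have "\<dots> \<le> ?M"
      unfolding set_lebesgue_integral_def
    proof (rule integral_mono)
      show "integrable lborel (\<lambda>x. indicat_real {s<..t} x *\<^sub>R cmod (h x))"
      proof -
        have "{s<..t} \<subseteq> {a<..<b}" using that by auto
        then show ?thesis using set_integrable_subset[OF hn, of "{s<..t}"] by (simp add: set_integrable_def)
      qed
      show "integrable lborel (\<lambda>x. indicat_real {a<..<b} x *\<^sub>R cmod (h x))"
        using hn by (simp add: set_integrable_def)
    qed (use that in \<open>auto simp: indicator_def\<close>)
    finally show ?thesis .
  qed
  have 2: "cmod (g t - g s) \<le> ?M" if "s \<in> {a<..<b}" "t \<in> {a<..<b}" for s t
  proof -
    consider "s < t" | "s = t" | "t < s" by linarith
    then show ?thesis
    proof cases
      case 3
      then show ?thesis using 1[of t s] that by (simp add: norm_minus_commute)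
    qed (use 1[of s t] that M0 in auto)
  qed
  have cl: "closure {a<..<b} = {a..b}" using ab by simp
  have 3: "cmod (g t - g s) \<le> ?M" if "s \<in> {a<..<b}" "t \<in> {a..b}" for s t
    by (rule continuous_on_closure_norm_le[where s="{a<..<b}" and f="\<lambda>t. g t - g s"])
       (use that 2 in \<open>auto simp: cl intro!: continuous_intros g\<close>)
  show ?thesis
    by (rule continuous_on_closure_norm_le[where s="{a<..<b}" and f="\<lambda>s. g t - g s"])
       (use st 3 in \<open>auto simp: cl intro!: continuous_intros g\<close>)
qed

lemma weak_deriv_0_AE_eq:
  assumes f: "set_integrable lborel {a<..<b} f" and g: "continuous_on {a..b} g" and ab: "a < b"
    and weak: "weak_deriv a b 0 f g"
  shows "AE x in lborel. x \<in> {a<..<b} \<longrightarrow> f x = g x"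
proof -
  have gi: "set_integrable lborel {a<..<b} g" by (rule continuous_on_Icc_imp_integrable_Ioo[OF g])
  have "AE x in lborel. x \<in> {a<..<b} \<longrightarrow> f x - g x = 0"
  proof (rule weak_zero_imp_AE_zero[OF _ ab])
    show "set_integrable lborel {a<..<b} (\<lambda>x. f x - g x)" using f gi by simp
    fix \<phi> assume \<phi>: "test_function a b \<phi>"
    have c: "continuous_on UNIV \<phi>" using smooth_continuous_on[of \<phi> UNIV 0] \<phi> by (simp add: test_function_def)
    then have "compact (\<phi> ` {a..b})" by (intro compact_continuous_image continuous_on_subset[OF c]) auto
    then have "bounded (\<phi> ` {a..b})" by (rule compact_imp_bounded)
    then obtain C where "\<forall>x\<in>{a..b}. cmod (\<phi> x) \<le> C" by (auto simp: bounded_iff)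
    then have C: "\<And>x. x \<in> {a..b} \<Longrightarrow> cmod (\<phi> x) \<le> C" by auto
    have int: "set_integrable lborel {a<..<b} (\<lambda>x. u x * \<phi> x)" if u: "set_integrable lborel {a<..<b} u" for u
      unfolding set_integrable_def
    proof (rule Bochner_Integration.integrable_bound)
      show "integrable lborel (\<lambda>x. C * norm (indicator {a<..<b} x *\<^sub>R u x))"
        using integrable_norm[OF u[unfolded set_integrable_def]] by (rule integrable_mult_right)
      have "(\<lambda>x. (indicator {a<..<b} x *\<^sub>R u x) * \<phi> x) \<in> borel_measurable borel"
        using u by (intro borel_measurable_times[OF _ borel_measurable_continuous_onI[OF c]]) (auto simp: set_integrable_def)
      then show "(\<lambda>x. indicator {a<..<b} x *\<^sub>R (u x * \<phi> x)) \<in> borel_measurable lborel" by simp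
      show "AE x in lborel. norm (indicator {a<..<b} x *\<^sub>R (u x * \<phi> x)) \<le> norm (C * norm (indicator {a<..<b} x *\<^sub>R u x))"
      proof (rule AE_I2)
        fix x
        have "x \<in> {a<..<b} \<Longrightarrow> cmod (u x) * cmod (\<phi> x) \<le> \<bar>C\<bar> * cmod (u x)"
          using C[of x] by (subst mult.commute) (intro mult_right_mono, auto)
        then show "norm (indicator {a<..<b} x *\<^sub>R (u x * \<phi> x)) \<le> norm (C * norm (indicator {a<..<b} x *\<^sub>R u x))"
          by (auto simp: indicator_def norm_mult abs_mult)
      qed
    qed
    show "(LBINT x:{a<..<b}. (f x - g x) * \<phi> x) = 0"
      using weak \<phi> int[OF f] int[OF gi] by (simp add: weak_deriv_def algebra_simps)
  qed
  then show ?thesis by simp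
qed

text \<open>
  Integrating down from order \<open>j\<close>, each integration from the common zero \<open>p\<close> costs a factor \<open>b - a\<close>. So the
  constant \<open>1\<close> is admissible, which is enough to make the set of admissible constants nonempty.
\<close>

lemma poincare_crude:
  assumes ab: "a < b" and j: "0 < j" and f: "L2_on {a<..<b} f"
    and van: "vanishes_to_order a b j p f" and p: "p \<in> {a..b}"
    and wh: "weak_deriv a b j f h" and h: "L2_on {a<..<b} h"
  shows "energy_on {a<..<b} f \<le> (b - a) ^ (2 * j) * energy_on {a<..<b} h"
proof -
  obtain G where G: "\<And>i. i < j \<Longrightarrow> continuous_on {a..b} (G i)" "\<And>i. i < j \<Longrightarrow> weak_deriv a b i f (G i)" "\<And>i. i < j \<Longrightarrow> G i p = 0"
    using van unfolding vanishes_to_order_def by metis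
  define H where "H i = (if i < j then G i else h)" for i
  define M where "M i = (LBINT x:{a<..<b}. cmod (H i x))" for i
  have Hi: "set_integrable lborel {a<..<b} (H i)" for i
    using continuous_on_Icc_imp_integrable_Ioo[OF G(1)] L2_on_interval_integrable(1)[OF h] ab by (simp add: H_def)
  have bound: "cmod (G i t) \<le> M (Suc i)" if i: "i < j" and t: "t \<in> {a..b}" for i t
  proof -
    have w: "weak_deriv a b (Suc i) f (H (Suc i))"
      using G(2)[of "Suc i"] wh i by (cases "Suc i = j") (auto simp: H_def)
    have "cmod (G i t - G i p) \<le> M (Suc i)"
      unfolding M_def
      by (rule weak_deriv_increment_bound[OF G(1)[OF i] Hi weak_deriv_Suc[OF G(2)[OF i] w] ab p t])
    then show ?thesis by (simp add: G(3)[OF i])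
  qed
  have M0: "0 \<le> M i" for i unfolding M_def set_lebesgue_integral_def by simp
  have const: "(LBINT x:{a<..<b}. c) = (b - a) * c" for c :: real
    using ab by (subst set_integral_const) auto
  have normi: "set_integrable lborel {a<..<b} (\<lambda>x. cmod (H i x))" for i
    using integrable_norm[OF Hi[of i, unfolded set_integrable_def]] unfolding set_integrable_def by simp
  have consti: "set_integrable lborel {a<..<b} (\<lambda>x. c)" for c :: real
    by (rule set_integrable_subset[OF borel_integrable_atLeastAtMost'[of a b]]) auto
  have Mstep: "M i \<le> (b - a) * M (Suc i)" if i: "i < j" for i
  proof -
    have "M i \<le> (LBINT x:{a<..<b}. M (Suc i))"
      unfolding M_def[of i]
      by (rule set_integral_mono[OF normi consti]) (use bound[OF i] i in \<open>auto simp: H_def\<close>)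
    then show ?thesis by (simp add: const)
  qed
  have Mchain: "M (j - m) \<le> (b - a) ^ m * M j" if "m \<le> j" for m
    using that
  proof (induction m)
    case (Suc m)
    have "M (j - Suc m) \<le> (b - a) * M (j - m)" using Mstep[of "j - Suc m"] Suc.prems by (simp add: Suc_diff_Suc)
    also have "\<dots> \<le> (b - a) * ((b - a) ^ m * M j)" using Suc ab by (intro mult_left_mono) auto
    finally show ?case by (simp add: mult.assoc)
  qed simp
  have M1: "M 1 \<le> (b - a) ^ (j - 1) * M j" using Mchain[of "j - 1"] j by simp
  have Mj: "(M j)\<^sup>2 \<le> (b - a) * energy_on {a<..<b} h"
    using L2_on_interval_integrable(2)[OF h] ab by (simp add: M_def H_def)
  have ae: "AE x in lborel. x \<in> {a<..<b} \<longrightarrow> f x = G 0 x"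
    by (rule weak_deriv_0_AE_eq[OF _ _ ab]) (use G j L2_on_interval_integrable(1)[OF f] ab in auto)
  have "energy_on {a<..<b} f \<le> (LBINT x:{a<..<b}. (M 1)\<^sup>2)"
    unfolding set_lebesgue_integral_def
  proof (rule integral_mono_AE)
    show "integrable lborel (\<lambda>x. indicat_real {a<..<b} x *\<^sub>R (cmod (f x))\<^sup>2)"
      using f by (simp add: L2_on_def set_integrable_def)
    show "integrable lborel (\<lambda>x. indicat_real {a<..<b} x *\<^sub>R (M 1)\<^sup>2)"
      using consti by (simp add: set_integrable_def)
    show "AE x in lborel. indicat_real {a<..<b} x *\<^sub>R (cmod (f x))\<^sup>2 \<le> indicat_real {a<..<b} x *\<^sub>R (M 1)\<^sup>2"
      using ae
    proof eventually_elim
      case (elim x)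
      then show ?case using bound[OF j, of x] by (auto simp: indicator_def intro!: power_mono)
    qed
  qed
  also have "\<dots> = (b - a) * (M 1)\<^sup>2" by (rule const)
  also have "\<dots> \<le> (b - a) * ((b - a) ^ (j - 1) * M j)\<^sup>2"
    using ab M1 M0 by (intro mult_left_mono power_mono) auto
  also have "\<dots> = (b - a) * ((b - a) ^ (j - 1))\<^sup>2 * (M j)\<^sup>2" by (simp add: power_mult_distrib)
  also have "\<dots> \<le> (b - a) * ((b - a) ^ (j - 1))\<^sup>2 * ((b - a) * energy_on {a<..<b} h)"
    using ab Mj by (intro mult_left_mono) auto
  also have "\<dots> = (b - a) ^ (2 * j) * energy_on {a<..<b} h"
    using j by (cases j) (simp_all add: power_mult power2_eq_square power_mult_distrib mult_ac)
  finally show ?thesis .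
qed

section \<open>The Poincare constants\<close>

lemma integral_by_parts_test_function:
  assumes f: "smooth f" and \<phi>: "test_function a b \<phi>"
  shows "(LBINT x:{a<..<b}. f x * nderiv 1 \<phi> x) = - (LBINT x:{a<..<b}. nderiv 1 f x * \<phi> x)"
proof (cases "a < b")
  case True
  obtain K where K: "smooth \<phi>" "K \<subseteq> {a<..<b}" "\<And>x. x \<notin> K \<Longrightarrow> \<phi> x = 0"
    using \<phi> by (auto simp: test_function_def)
  have "a \<notin> K" "b \<notin> K" using K(2) by auto
  then have ends: "\<phi> a = 0" "\<phi> b = 0" by (auto simp: K(3))
  have c: "continuous_on {a..b} (nderiv l f)" "continuous_on {a..b} (nderiv l \<phi>)" for l
    by (intro smooth_continuous_on f K)+
  note c0 = c[of 0, simplified]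
  have d: "((\<lambda>x. f x * \<phi> x) has_vector_derivative f x * nderiv 1 \<phi> x + nderiv 1 f x * \<phi> x) (at x within {a..b})" for x
    using has_vector_derivative_mult[OF smooth_has_vector_derivative[OF f, of 0] smooth_has_vector_derivative[OF K(1), of 0]] by simp
  have "(LBINT x:{a..b}. f x * nderiv 1 \<phi> x + nderiv 1 f x * \<phi> x) = f b * \<phi> b - f a * \<phi> a"
    unfolding set_lebesgue_integral_def
    by (rule integral_FTC_Icc) (use True d in \<open>auto intro!: continuous_intros c c0\<close>)
  moreover have "set_integrable lborel {a..b} (\<lambda>x. f x * nderiv 1 \<phi> x)" "set_integrable lborel {a..b} (\<lambda>x. nderiv 1 f x * \<phi> x)"
    by (intro borel_integrable_atLeastAtMost' continuous_intros c c0)+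
  ultimately show ?thesis
    by (simp add: set_integral_Ioo_eq_Icc ends add_eq_0_iff2)
qed (simp add: set_lebesgue_integral_def)

lemma weak_deriv_smooth:
  assumes f: "smooth f"
  shows "weak_deriv a b i f (nderiv i f)"
proof -
  have loc: "locally_integrable_on a b (nderiv l f)" for l
    unfolding locally_integrable_on_def set_integrable_def
    by (auto intro!: borel_integrable_compact smooth_continuous_on f)
  have "(LBINT x:{a<..<b}. f x * nderiv i \<phi> x) = (- 1) ^ i * (LBINT x:{a<..<b}. nderiv i f x * \<phi> x)"
    if "smooth f" "test_function a b \<phi>" for f \<phi>
    using that
  proof (induction i arbitrary: f)
    case (Suc i)
    have "(LBINT x:{a<..<b}. f x * nderiv (Suc i) \<phi> x) = (LBINT x:{a<..<b}. f x * nderiv 1 (nderiv i \<phi>) x)"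
      by (simp add: nderiv_nderiv)
    also have "\<dots> = - (LBINT x:{a<..<b}. nderiv 1 f x * nderiv i \<phi> x)"
      by (rule integral_by_parts_test_function[OF Suc.prems(1) test_function_nderiv[OF Suc.prems(2)]])
    also have "\<dots> = - ((- 1) ^ i * (LBINT x:{a<..<b}. nderiv i (nderiv 1 f) x * \<phi> x))"
      using Suc.IH[OF smooth_nderiv[OF Suc.prems(1), of 1] Suc.prems(2)] by simp
    finally show ?case by (simp add: nderiv_nderiv)
  qed simp
  then show ?thesis using loc[of 0] loc[of i] f by (simp add: weak_deriv_def)
qed

lemma smooth_L2_on: "smooth f \<Longrightarrow> L2_on {a<..<b} (nderiv l f)"
  by (intro continuous_on_Icc_imp_L2_on smooth_continuous_on)

lemma smooth_sobolev: "smooth f \<Longrightarrow> f \<in> sobolev a b j"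
  using weak_deriv_smooth smooth_L2_on[of f _ _ 0] smooth_L2_on[of f] by (fastforce simp: sobolev_def)

text \<open>
  The polynomial whose derivatives at \<open>p\<close> are \<open>c 0, \<dots>, c (n - 1)\<close>. With this normalisation
  differentiation is a shift of \<open>c\<close>.
\<close>

definition taylor_poly :: "(nat \<Rightarrow> complex) \<Rightarrow> nat \<Rightarrow> real \<Rightarrow> real \<Rightarrow> complex" where
  "taylor_poly c n p x = (\<Sum>i<n. c i * complex_of_real ((x - p) ^ i / fact i))"

lemma taylor_poly_has_vector_derivative:
  "(taylor_poly c n p has_vector_derivative taylor_poly (\<lambda>i. c (Suc i)) (n - 1) p x) (at x)"
proof (cases n)
  case (Suc m)
  have mono: "((\<lambda>x. (x - p) ^ Suc i / fact (Suc i)) has_real_derivative (x - p) ^ i / fact i) (at x)" for i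
  proof -
    have "((\<lambda>x. (x - p) ^ Suc i / fact (Suc i)) has_real_derivative real (Suc i) * (x - p) ^ i / fact (Suc i)) (at x)"
      by (auto intro!: derivative_eq_intros simp del: fact_Suc power_Suc of_nat_Suc)
    then show ?thesis by (simp del: of_nat_Suc)
  qed
  have "((\<lambda>x. c 0 + (\<Sum>i<m. c (Suc i) * complex_of_real ((x - p) ^ Suc i / fact (Suc i)))) has_vector_derivative
      0 + (\<Sum>i<m. c (Suc i) * complex_of_real ((x - p) ^ i / fact i))) (at x)"
    by (intro has_vector_derivative_add has_vector_derivative_const has_vector_derivative_sum
        has_vector_derivative_mult_right has_vector_derivative_of_real mono)
  moreover have "taylor_poly c n p = (\<lambda>x. c 0 + (\<Sum>i<m. c (Suc i) * complex_of_real ((x - p) ^ Suc i / fact (Suc i))))"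
    unfolding taylor_poly_def Suc by (subst sum.lessThan_Suc_shift) simp
  ultimately show ?thesis by (simp add: taylor_poly_def Suc)
qed (simp add: taylor_poly_def[abs_def])

lemma
  shows smooth_taylor_poly: "smooth (taylor_poly c n p)"
    and nderiv_taylor_poly: "nderiv l (taylor_poly c n p) = taylor_poly (\<lambda>i. c (i + l)) (n - l) p"
proof -
  define F where "F l = taylor_poly (\<lambda>i. c (i + l)) (n - l) p" for l
  have F: "(F l has_vector_derivative F (Suc l) x) (at x)" for l x
    using taylor_poly_has_vector_derivative[of "\<lambda>i. c (i + l)" "n - l" p x] by (simp add: F_def)
  show "smooth (taylor_poly c n p)" using smoothI_seq[of F, OF F] by (simp add: F_def)
  show "nderiv l (taylor_poly c n p) = taylor_poly (\<lambda>i. c (i + l)) (n - l) p"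
    using nderiv_eqI[of F l, OF F] by (simp add: F_def)
qed

lemma taylor_poly_at_center: "taylor_poly c n p p = (if n = 0 then 0 else c 0)"
  by (cases n) (simp_all add: taylor_poly_def sum.lessThan_Suc_shift)

lemma smooth_vanishes_to_order:
  assumes f: "smooth f" and "\<And>i. i < j \<Longrightarrow> nderiv i f p = 0"
  shows "vanishes_to_order a b j p f"
  unfolding vanishes_to_order_def using assms weak_deriv_smooth smooth_continuous_on by blast

text \<open>
  The condition on \<open>c\<close> is closed, so it passes to the infimum of the admissible constants. That infimum is
  positive since \<open>c = 0\<close> would force \<open>l\<^sub>0 \<le> 0\<close>.
\<close>

lemma least_scaling_const:
  fixes T :: "(real \<times> real) set" and n :: nat
  assumes n: "0 < n" and ex: "0 < c1" "\<And>l r. (l, r) \<in> T \<Longrightarrow> l \<le> c1 ^ n * r"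
    and pos: "(l0, r0) \<in> T" "0 < l0"
  defines "c \<equiv> (LEAST c. 0 < c \<and> (\<forall>(l, r) \<in> T. l \<le> c ^ n * r))"
  shows "0 < c \<and> (\<forall>(l, r) \<in> T. l \<le> c ^ n * r)"
proof -
  define S where "S = {c. 0 < c \<and> (\<forall>(l, r) \<in> T. l \<le> c ^ n * r)}"
  have "c1 \<in> S" using ex by (auto simp: S_def)
  then have S: "S \<noteq> {}" "bdd_below S" by (auto simp: S_def intro!: bdd_belowI[of _ 0] less_imp_le)
  have cl: "Inf S \<in> closure S" by (rule closure_contains_Inf[OF S])
  have le: "l \<le> Inf S ^ n * r" if "(l, r) \<in> T" for l r
  proof -
    have "closed {c. l \<le> c ^ n * r}" by (intro closed_Collect_le continuous_intros)
    moreover have "S \<subseteq> {c. l \<le> c ^ n * r}" using that by (auto simp: S_def)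
    ultimately show ?thesis using cl closure_minimal by blast
  qed
  have "0 \<le> Inf S" using S by (intro cInf_greatest) (auto simp: S_def)
  moreover have "Inf S \<noteq> 0" using le[OF pos(1)] pos(2) n by (auto simp: power_0_left)
  ultimately have "Inf S \<in> S" using le by (auto simp: S_def)
  moreover have "c = Inf S"
    unfolding c_def using calculation S(2) by (intro Least_equality) (auto simp: S_def intro: cInf_lower)
  ultimately show ?thesis by (auto simp: S_def)
qed

text \<open>
  The pairs of numbers compared by the inequality that defines the constant of order \<open>j\<close>.
\<close>

definition poincare_data :: "nat \<Rightarrow> (real \<times> real) set" where
  "poincare_data j = {(energy_on {a<..<b} f,
      (b - a) ^ (2 * j) * energy_on {a<..<b} g) | a b f g.
     a < b \<and> f \<in> sobolev a b j \<and> (vanishes_to_order a b j a f \<or> vanishes_to_order a b j b f) \<and>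
     weak_deriv a b j f g \<and> L2_on {a<..<b} g}"

lemma poincare_const_eq:
  "poincare_const j = (LEAST c. 0 < c \<and> (\<forall>(l, r) \<in> poincare_data j. l \<le> c ^ (2 * j) * r))"
proof -
  have "(\<forall>a b f g. a < b \<longrightarrow> f \<in> sobolev a b j \<longrightarrow>
        vanishes_to_order a b j a f \<or> vanishes_to_order a b j b f \<longrightarrow>
        weak_deriv a b j f g \<longrightarrow> L2_on {a<..<b} g \<longrightarrow>
        energy_on {a<..<b} f
          \<le> c ^ (2 * j) * (b - a) ^ (2 * j) * energy_on {a<..<b} g) \<longleftrightarrow>
     (\<forall>(l, r) \<in> poincare_data j. l \<le> c ^ (2 * j) * r)" for c
    unfolding poincare_data_def mult.assoc by blast
  then show ?thesis unfolding poincare_const_def by presburger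
qed

lemma smooth_poincare_data:
  assumes r: "smooth r" and ab: "a < b" and p: "p = a \<or> p = b" and van: "\<And>i. i < j \<Longrightarrow> nderiv i r p = 0"
  shows "(energy_on {a<..<b} r,
      (b - a) ^ (2 * j) * energy_on {a<..<b} (nderiv j r)) \<in> poincare_data j"
proof -
  have "vanishes_to_order a b j a r \<or> vanishes_to_order a b j b r"
    using smooth_vanishes_to_order[OF r van] p by auto
  then show ?thesis
    unfolding poincare_data_def
    using ab smooth_sobolev[OF r] weak_deriv_smooth[OF r] smooth_L2_on[OF r] by blast
qed

text \<open>
  Attainment of the minimum: the constant \<open>1\<close> is admissible, and the monomial \<open>x\<^sup>j / j!\<close> on \<open>(0, 1)\<close>, which
  vanishes to order \<open>j\<close> at \<open>0\<close>, excludes \<open>0\<close>.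
\<close>

lemma poincare_const:
  assumes j: "0 < j"
  shows poincare_const_pos: "0 < poincare_const j"
    and poincare_const_le: "(l, r) \<in> poincare_data j \<Longrightarrow> l \<le> poincare_const j ^ (2 * j) * r"
proof -
  define f where "f = taylor_poly (\<lambda>i. if i = j then 1 else 0) (j + 1) 0"
  have fx: "f x = complex_of_real (x ^ j / fact j)" for x
  proof -
    have "f x = (\<Sum>i<j + 1. if i = j then complex_of_real (x ^ i / fact i) else 0)"
      unfolding f_def taylor_poly_def by (intro sum.cong) auto
    then show ?thesis by simp
  qed
  have sf: "smooth f" unfolding f_def by (rule smooth_taylor_poly)
  have pos: "0 < energy_on {0<..<1} f"
  proof -
    let ?F = "\<lambda>x::real. x ^ (2 * j + 1) / (real (2 * j + 1) * (fact j)\<^sup>2)"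
    have "(LBINT x:{0..1}. (x ^ j / fact j)\<^sup>2) = ?F 1 - ?F 0"
      unfolding set_lebesgue_integral_def
    proof (rule integral_FTC_Icc)
      fix x :: real
      have "(?F has_real_derivative (x ^ j / fact j)\<^sup>2) (at x)"
      proof -
        have "(?F has_real_derivative (real (2 * j + 1) * x ^ (2 * j)) / (real (2 * j + 1) * (fact j)\<^sup>2)) (at x)"
          by (rule derivative_eq_intros refl | simp)+
        then show ?thesis by (simp add: power_divide power_mult[symmetric] mult.commute del: of_nat_add of_nat_mult)
      qed
      then show "(?F has_vector_derivative (x ^ j / fact j)\<^sup>2) (at x within {0..1})"
        by (simp add: has_real_derivative_iff_has_vector_derivative has_vector_derivative_at_within)
    qed (auto intro!: continuous_intros)
    then have "(LBINT x:{0..1}. (x ^ j / fact j)\<^sup>2) > (0::real)" by simp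
    moreover have "(cmod (f x))\<^sup>2 = (x ^ j / fact j)\<^sup>2" for x
      unfolding fx norm_of_real power2_abs ..
    ultimately show ?thesis by (simp add: set_integral_Ioo_eq_Icc)
  qed
  have van: "nderiv i f 0 = 0" if "i < j" for i
    using that by (simp add: f_def nderiv_taylor_poly taylor_poly_at_center)
  have in_data: "(energy_on {0<..<1} f, (1 - 0) ^ (2 * j) * energy_on {0<..<1} (nderiv j f)) \<in> poincare_data j"
    by (rule smooth_poincare_data[OF sf, of 0 1 0]) (use van in auto)
  have crude: "l \<le> 1 ^ (2 * j) * r" if "(l, r) \<in> poincare_data j" for l r
    using that poincare_crude[OF _ j] unfolding poincare_data_def sobolev_def
    by (fastforce simp: less_imp_le)
  have "0 < poincare_const j \<and> (\<forall>(l, r) \<in> poincare_data j. l \<le> poincare_const j ^ (2 * j) * r)"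
    unfolding poincare_const_eq
    by (rule least_scaling_const[OF _ _ crude in_data pos]) (use j in auto)
  then show "0 < poincare_const j" "(l, r) \<in> poincare_data j \<Longrightarrow> l \<le> poincare_const j ^ (2 * j) * r" by auto
qed

lemma poincare_smooth:
  assumes r: "smooth r" and j: "0 < j" and ab: "a < b" and p: "p = a \<or> p = b"
    and van: "\<And>i. i < j \<Longrightarrow> nderiv i r p = 0"
  shows "energy_on {a..b} r
    \<le> (poincare_const j * (b - a)) ^ (2 * j) * energy_on {a..b} (nderiv j r)"
  using poincare_const_le[OF j smooth_poincare_data[OF r ab p van]]
  by (simp add: set_integral_Ioo_eq_Icc power_mult_distrib mult.assoc)

section \<open>Wirtinger's inequality\<close>

text \<open>
  For a solution \<open>p\<close> of the Riccati equation \<open>p' = - (\<beta>\<^sup>2 + p\<^sup>2)\<close>, expanding the square gives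
  \<open>|f'|\<^sup>2 - \<beta>\<^sup>2 |f|\<^sup>2 = |f' - p f|\<^sup>2 + (p |f|\<^sup>2)'\<close>, and the last term integrates to a boundary
  contribution.
\<close>

lemma integral_square_weight_le:
  fixes f f' :: "real \<Rightarrow> complex" and p :: "real \<Rightarrow> real"
  assumes ab: "a \<le> b"
    and f: "\<And>x. x \<in> {a..b} \<Longrightarrow> (f has_vector_derivative f' x) (at x)"
    and f': "continuous_on {a..b} f'"
    and p: "\<And>x. x \<in> {a..b} \<Longrightarrow> (p has_real_derivative - (\<beta>\<^sup>2 + (p x)\<^sup>2)) (at x)"
    and boundary: "p a * (cmod (f a))\<^sup>2 \<le> p b * (cmod (f b))\<^sup>2"
  shows "\<beta>\<^sup>2 * energy_on {a..b} f \<le> energy_on {a..b} f'"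
proof -
  have fc: "continuous_on {a..b} f"
    using f by (meson has_vector_derivative_continuous continuous_at_imp_continuous_on)
  have pc: "continuous_on {a..b} p"
    using p by (meson DERIV_isCont continuous_at_imp_continuous_on)
  define q where "q x = (cmod (f' x - p x *\<^sub>R f x))\<^sup>2" for x
  define D where "D x = p x * (2 * (f x \<bullet> f' x)) - (\<beta>\<^sup>2 + (p x)\<^sup>2) * (f x \<bullet> f x)" for x
  have id: "(cmod (f' x))\<^sup>2 - \<beta>\<^sup>2 * (cmod (f x))\<^sup>2 = q x + D x" for x
    unfolding q_def D_def power2_norm_eq_inner
    by (simp add: inner_diff_left inner_diff_right inner_commute algebra_simps power2_eq_square)
  have [simp]: "set_integrable lborel {a..b} (\<lambda>x. (cmod (f x))\<^sup>2)" "set_integrable lborel {a..b} (\<lambda>x. (cmod (f' x))\<^sup>2)"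
    "set_integrable lborel {a..b} q" "set_integrable lborel {a..b} D"
    unfolding q_def D_def by (intro borel_integrable_atLeastAtMost' continuous_intros fc f' pc)+
  have der: "((\<lambda>x. p x * (f x \<bullet> f x)) has_vector_derivative D x) (at x within {a..b})" if x: "x \<in> {a..b}" for x
  proof -
    have fd: "(f has_derivative (\<lambda>h. h *\<^sub>R f' x)) (at x)" using f[OF x] by (simp add: has_vector_derivative_def)
    have "((\<lambda>x. f x \<bullet> f x) has_derivative (\<lambda>h. f x \<bullet> (h *\<^sub>R f' x) + (h *\<^sub>R f' x) \<bullet> f x)) (at x)"
      by (rule has_derivative_inner[OF fd fd])
    then have "((\<lambda>x. f x \<bullet> f x) has_real_derivative 2 * (f x \<bullet> f' x)) (at x)"
      unfolding has_field_derivative_def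
      by (rule has_derivative_eq_rhs) (auto simp: fun_eq_iff inner_commute)
    then have "((\<lambda>x. p x * (f x \<bullet> f x)) has_real_derivative D x) (at x)"
      by (auto intro!: derivative_eq_intros p[OF x] simp: D_def algebra_simps)
    then show ?thesis
      by (simp add: has_real_derivative_iff_has_vector_derivative has_vector_derivative_at_within)
  qed
  have "(LBINT x:{a..b}. D x) = p b * (f b \<bullet> f b) - p a * (f a \<bullet> f a)"
    unfolding set_lebesgue_integral_def D_def
    by (rule integral_FTC_Icc[OF ab]) (use der in \<open>auto simp: D_def intro!: continuous_intros fc f' pc\<close>)
  then have "0 \<le> (LBINT x:{a..b}. D x)"
    using boundary by (simp add: power2_norm_eq_inner)
  moreover have "0 \<le> (LBINT x:{a..b}. q x)"
    unfolding set_lebesgue_integral_def by (intro Bochner_Integration.integral_nonneg) (auto simp: q_def)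
  moreover have "energy_on {a..b} f' - \<beta>\<^sup>2 * energy_on {a..b} f
      = (LBINT x:{a..b}. q x) + (LBINT x:{a..b}. D x)"
    by (simp flip: set_integral_mult_right set_integral_diff(2) set_integral_add(2) add: id)
  ultimately show ?thesis by simp
qed

text \<open>
  The weight of \<open>integral_square_weight_le\<close> is a shifted cotangent. For \<open>\<beta>\<close> equal to the critical value
  \<open>\<pi> / (2 (b - a))\<close> it would be singular at the zero of \<open>f\<close>; below it there is room for a shift \<open>\<eta> > 0\<close> that
  makes the weight smooth on the closed interval and zero at the other endpoint. The sharp constant is reached
  in the limit.
\<close>

lemma wirtinger_inequality:
  fixes f f' :: "real \<Rightarrow> complex"
  assumes ab: "a < b"
    and f: "\<And>x. x \<in> {a..b} \<Longrightarrow> (f has_vector_derivative f' x) (at x)"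
    and f': "continuous_on {a..b} f'"
    and zero: "f a = 0 \<or> f b = 0"
  shows "energy_on {a..b} f
    \<le> (2 * (b - a) / pi)\<^sup>2 * energy_on {a..b} f'"
proof -
  define L where "L = b - a"
  have L: "L > 0" using ab by (simp add: L_def)
  let ?I = "LBINT x:{a..b}. (cmod (f x))\<^sup>2" and ?J = "LBINT x:{a..b}. (cmod (f' x))\<^sup>2"
  have \<beta>: "\<beta>\<^sup>2 * ?I \<le> ?J" if \<beta>: "0 < \<beta>" "\<beta> < pi / (2 * L)" for \<beta>
  proof -
    define \<eta> where "\<eta> = pi / 2 - \<beta> * L"
    have \<eta>: "\<eta> > 0" using \<beta> L by (simp add: \<eta>_def field_simps)
    have rng: "0 < \<beta> * u + \<eta>" "\<beta> * u + \<eta> < pi" if "u \<in> {0..L}" for u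
    proof -
      have "0 \<le> \<beta> * u" "\<beta> * u \<le> \<beta> * L" using that \<beta> by (auto intro!: mult_left_mono)
      then show "0 < \<beta> * u + \<eta>" "\<beta> * u + \<eta> < pi" using \<eta> pi_gt_zero unfolding \<eta>_def by linarith+
    qed
    have sin: "sin (\<beta> * u + \<eta>) \<noteq> 0" if "u \<in> {0..L}" for u
      using sin_gt_zero[OF rng[OF that]] by simp
    have cot: "inverse (sin y) * inverse (sin y) = 1 + cot y * cot y" if "sin y \<noteq> 0" for y :: real
      using that sin_cos_squared_add[of y] by (simp add: cot_def field_simps power2_eq_square)
    have end0: "cot (\<beta> * L + \<eta>) = 0" by (simp add: \<eta>_def cot_def)
    show ?thesis
      using zero
    proof
      assume fa: "f a = 0"
      show ?thesis
      proof (rule integral_square_weight_le[where p="\<lambda>x. \<beta> * cot (\<beta> * (x - a) + \<eta>)"])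
        fix x assume x: "x \<in> {a..b}"
        have "sin (\<beta> * (x - a) + \<eta>) \<noteq> 0" by (rule sin) (use x in \<open>auto simp: L_def\<close>)
        then show "((\<lambda>x. \<beta> * cot (\<beta> * (x - a) + \<eta>)) has_real_derivative - (\<beta>\<^sup>2 + (\<beta> * cot (\<beta> * (x - a) + \<eta>))\<^sup>2)) (at x)"
          by (auto intro!: derivative_eq_intros DERIV_chain2[OF DERIV_cot] simp: cot power2_eq_square algebra_simps)
      qed (use ab f f' fa end0 in \<open>auto simp: L_def\<close>)
    next
      assume fb: "f b = 0"
      show ?thesis
      proof (rule integral_square_weight_le[where p="\<lambda>x. - \<beta> * cot (\<beta> * (b - x) + \<eta>)"])
        fix x assume x: "x \<in> {a..b}"
        have "sin (\<beta> * (b - x) + \<eta>) \<noteq> 0" by (rule sin) (use x in \<open>auto simp: L_def\<close>)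
        then show "((\<lambda>x. - \<beta> * cot (\<beta> * (b - x) + \<eta>)) has_real_derivative - (\<beta>\<^sup>2 + (- \<beta> * cot (\<beta> * (b - x) + \<eta>))\<^sup>2)) (at x)"
          by (auto intro!: derivative_eq_intros DERIV_chain2[OF DERIV_cot] simp: cot power2_eq_square algebra_simps)
      qed (use ab f f' fb end0 in \<open>auto simp: L_def\<close>)
    qed
  qed
  have "(pi / (2 * L))\<^sup>2 * ?I \<le> ?J"
  proof (rule tendsto_upperbound)
    show "((\<lambda>\<beta>. \<beta>\<^sup>2 * ?I) \<longlongrightarrow> (pi / (2 * L))\<^sup>2 * ?I) (at_left (pi / (2 * L)))"
      by (intro tendsto_intros)
    have "pi / (2 * L) > 0" using L by simp
    then show "\<forall>\<^sub>F \<beta> in at_left (pi / (2 * L)). \<beta>\<^sup>2 * ?I \<le> ?J"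
      using \<beta> by (auto simp: eventually_at_left_field intro!: exI[of _ 0])
  qed simp
  then have "(2 * L / pi)\<^sup>2 * ((pi / (2 * L))\<^sup>2 * ?I) \<le> (2 * L / pi)\<^sup>2 * ?J"
    by (intro mult_left_mono) auto
  also have "(2 * L / pi)\<^sup>2 * ((pi / (2 * L))\<^sup>2 * ?I) = ?I"
    using L pi_gt_zero unfolding mult.assoc[symmetric] power_mult_distrib[symmetric] by simp
  finally show ?thesis unfolding L_def .
qed

section \<open>Plancherel's theorem for functions on a compact set\<close>

definition fourier_integral :: "(real \<Rightarrow> complex) \<Rightarrow> real \<Rightarrow> complex" where
  "fourier_integral h \<omega> = (LBINT x. h x * exp (- \<i> * complex_of_real (\<omega> * x)))"

text \<open>
  Both the truncation of a continuous signal to an interval and the spectrum of an atom on \<open>\<Omega>\<close> have this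
  shape with \<open>p\<close> continuous. The set \<open>K\<close> is an arbitrary compact set, whose boundary may have positive measure,
  so such a function need not be continuous almost everywhere.
\<close>

definition cutoff :: "real set \<Rightarrow> (real \<Rightarrow> complex) \<Rightarrow> real \<Rightarrow> complex" where
  "cutoff K p x = indicator K x *\<^sub>R p x"

text \<open>
  The form of Fubini's theorem in which all exchanges of integrals below occur.
\<close>

lemma integral_kernel_swap:
  fixes u v :: "real \<Rightarrow> complex" and k :: "real \<Rightarrow> real \<Rightarrow> complex"
  assumes u: "integrable lborel u" and v: "integrable lborel v"
    and k: "case_prod k \<in> borel_measurable (borel \<Otimes>\<^sub>M borel)" and C: "\<And>x y. cmod (k x y) \<le> C"
  shows "(LBINT x. u x * (LBINT y. v y * k x y)) = (LBINT y. v y * (LBINT x. u x * k x y))"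
proof -
  have um: "u \<in> borel_measurable borel" "v \<in> borel_measurable borel" using u v by auto
  have um': "(\<lambda>z. u (fst z) * v (snd z)) \<in> borel_measurable (lborel \<Otimes>\<^sub>M lborel)"
    using um by measurable
  have km: "(\<lambda>z. k (fst z) (snd z)) \<in> borel_measurable (lborel \<Otimes>\<^sub>M lborel)"
    using k by (simp add: case_prod_unfold)
  have uv: "integrable (lborel \<Otimes>\<^sub>M lborel) (\<lambda>z. u (fst z) * v (snd z))"
  proof (rule lborel_pair.Fubini_integrable[OF um'])
    show "integrable lborel (\<lambda>x. LBINT y. norm (u (fst (x, y)) * v (snd (x, y))))"
      using u by (simp add: norm_mult)
    show "AE x in lborel. integrable lborel (\<lambda>y. u (fst (x, y)) * v (snd (x, y)))"
      using v by simp
  qed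
  have "integrable (lborel \<Otimes>\<^sub>M lborel) (\<lambda>z. u (fst z) * v (snd z) * k (fst z) (snd z))"
  proof (rule Bochner_Integration.integrable_bound)
    show "integrable (lborel \<Otimes>\<^sub>M lborel) (\<lambda>z. C * norm (u (fst z) * v (snd z)))"
      using integrable_norm[OF uv] by (rule integrable_mult_right)
    show "AE z in lborel \<Otimes>\<^sub>M lborel. norm (u (fst z) * v (snd z) * k (fst z) (snd z)) \<le> norm (C * norm (u (fst z) * v (snd z)))"
    proof (rule AE_I2)
      fix z
      have "cmod (u (fst z) * v (snd z)) * cmod (k (fst z) (snd z)) \<le> cmod (u (fst z) * v (snd z)) * \<bar>C\<bar>"
        using C[of "fst z" "snd z"] by (intro mult_left_mono) auto
      then show "norm (u (fst z) * v (snd z) * k (fst z) (snd z)) \<le> norm (C * norm (u (fst z) * v (snd z)))"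
        by (simp add: norm_mult abs_mult mult_ac)
    qed
  qed (intro borel_measurable_times um' km)
  then have "(LBINT y. LBINT x. u x * v y * k x y) = (LBINT x. LBINT y. u x * v y * k x y)"
    by (intro lborel_pair.Fubini_integral) (simp add: case_prod_unfold)
  moreover have "(LBINT x. u x * v y * k x y) = v y * (LBINT x. u x * k x y)" for y
    by (subst integral_mult_right_zero[symmetric]) (simp add: mult_ac)
  moreover have "(LBINT y. u x * v y * k x y) = u x * (LBINT y. v y * k x y)" for x
    by (subst integral_mult_right_zero[symmetric]) (simp add: mult_ac)
  ultimately show ?thesis by simp
qed

lemma integrable_times_bounded:
  fixes u :: "real \<Rightarrow> complex"
  assumes u: "integrable lborel u" and k: "k \<in> borel_measurable borel" and C: "\<And>x. cmod (k x) \<le> C"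
  shows "integrable lborel (\<lambda>x. u x * k x)"
proof (rule Bochner_Integration.integrable_bound)
  show "integrable lborel (\<lambda>x. C * norm (u x))" using u by simp
  show "(\<lambda>x. u x * k x) \<in> borel_measurable lborel" using u k by (intro borel_measurable_times) auto
  show "AE x in lborel. norm (u x * k x) \<le> norm (C * norm (u x))"
  proof (rule AE_I2)
    fix x
    have "cmod (u x) * cmod (k x) \<le> cmod (u x) * \<bar>C\<bar>" using C[of x] by (intro mult_left_mono) auto
    then show "norm (u x * k x) \<le> norm (C * norm (u x))" by (simp add: norm_mult abs_mult mult_ac)
  qed
qed

lemma cmod_exp_i [simp]: "cmod (iexp t) = 1" "cmod (exp (- \<i> * complex_of_real t)) = 1"
  "cmod (exp (- (\<i> * complex_of_real t))) = 1"
  by (simp_all add: norm_exp_eq_Re)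

lemma measurable_exp_i [measurable]:
  "(\<lambda>x::real. iexp (a * x)) \<in> borel_measurable borel"
  "(\<lambda>x::real. iexp (x * a)) \<in> borel_measurable borel"
  "(\<lambda>x::real. exp (- \<i> * complex_of_real (a * x))) \<in> borel_measurable borel"
  "(\<lambda>x::real. exp (- \<i> * complex_of_real (x * a))) \<in> borel_measurable borel"
  by (intro borel_measurable_continuous_onI continuous_intros)+

lemma measurable_exp_i_pair [measurable]:
  "(\<lambda>z::real \<times> real. iexp (fst z * snd z)) \<in> borel_measurable (borel \<Otimes>\<^sub>M borel)"
  "(\<lambda>z::real \<times> real. exp (- \<i> * complex_of_real (fst z * snd z))) \<in> borel_measurable (borel \<Otimes>\<^sub>M borel)"
  unfolding borel_prod by (intro borel_measurable_continuous_onI continuous_intros)+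

lemma fourier_integral_measurable:
  assumes "integrable lborel h"
  shows "fourier_integral h \<in> borel_measurable borel"
proof -
  have h: "h \<in> borel_measurable borel" using assms by auto
  have e: "borel_measurable (borel \<Otimes>\<^sub>M lborel) = (borel_measurable (borel \<Otimes>\<^sub>M borel) :: (real \<times> real \<Rightarrow> complex) set)"
    by (rule measurable_cong_sets[OF sets_pair_measure_cong]) auto
  have "(\<lambda>z. h (snd z) * exp (- \<i> * complex_of_real (fst z * snd z))) \<in> borel_measurable (borel \<Otimes>\<^sub>M lborel)"
    unfolding e by (intro borel_measurable_times measurable_exp_i_pair(2) measurable_compose[OF measurable_snd h])
  then have "(\<lambda>\<omega>. LBINT x. h (snd (\<omega>, x)) * exp (- \<i> * complex_of_real (fst (\<omega>, x) * snd (\<omega>, x)))) \<in> borel_measurable borel"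
    by (intro lborel.borel_measurable_lebesgue_integral) (simp add: case_prod_unfold)
  then show ?thesis by (simp add: fourier_integral_def[abs_def])
qed

lemma fourier_integral_bound:
  "cmod (fourier_integral h \<omega>) \<le> (LBINT x. cmod (h x))"
  unfolding fourier_integral_def
  using integral_norm_bound[of lborel "\<lambda>x. h x * exp (- \<i> * complex_of_real (\<omega> * x))"] by (simp add: norm_mult)

lemma gaussian_fourier:
  assumes "0 < \<epsilon>"
  shows "(LBINT \<omega>. complex_of_real (exp (- (\<epsilon> * \<omega>)\<^sup>2 / 2)) * iexp (\<omega> * t))
    = complex_of_real (2 * pi / \<epsilon> * std_normal_density (t / \<epsilon>))"
proof -
  have nd: "exp (- (\<epsilon> * \<omega>)\<^sup>2 / 2) = sqrt (2 * pi) * std_normal_density (\<epsilon> * \<omega>)" for \<omega>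
    by (simp add: std_normal_density_def)
  have "(LBINT v. std_normal_density v *\<^sub>R iexp (s * v)) = complex_of_real (exp (- s\<^sup>2 / 2))" for s
    using fun_cong[OF char_std_normal_distribution, of s]
    by (simp add: char_def integral_density normal_density_nonneg)
  from this[of "t / \<epsilon>"]
  have *: "(LBINT v. std_normal_density v *\<^sub>R iexp (t / \<epsilon> * v)) = complex_of_real (sqrt (2 * pi) * std_normal_density (t / \<epsilon>))"
    by (simp add: std_normal_density_def)
  have "(LBINT \<omega>. complex_of_real (exp (- (\<epsilon> * \<omega>)\<^sup>2 / 2)) * iexp (\<omega> * t))
    = (1 / \<epsilon>) *\<^sub>R (LBINT v. complex_of_real (sqrt (2 * pi)) * (std_normal_density v *\<^sub>R iexp (t / \<epsilon> * v)))"
    unfolding nd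
    by (subst lborel_integral_real_affine[of "1 / \<epsilon>" _ 0])
       (use assms in \<open>auto simp: scaleR_conv_of_real mult_ac\<close>)
  also have "\<dots> = complex_of_real (1 / \<epsilon> * (sqrt (2 * pi) * (sqrt (2 * pi) * std_normal_density (t / \<epsilon>))))"
    unfolding integral_mult_right_zero * by (simp add: scaleR_conv_of_real)
  also have "1 / \<epsilon> * (sqrt (2 * pi) * (sqrt (2 * pi) * std_normal_density (t / \<epsilon>))) = 2 * pi / \<epsilon> * std_normal_density (t / \<epsilon>)"
    using pi_gt_zero by (simp add: mult.assoc[symmetric])
  finally show ?thesis .
qed

lemma
  assumes K: "compact K" and p: "continuous_on UNIV p"
  shows cutoff_integrable: "integrable lborel (cutoff K p)"
    and cutoff_square_integrable: "integrable lborel (\<lambda>x. (cmod (cutoff K p x))\<^sup>2)"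
    and cutoff_bounded: "\<exists>C>0. \<forall>x. cmod (cutoff K p x) \<le> C"
proof -
  have pK: "continuous_on K p" using p by (rule continuous_on_subset) auto
  show "integrable lborel (cutoff K p)"
    unfolding cutoff_def[abs_def] by (rule borel_integrable_compact[OF K pK])
  have "integrable lborel (\<lambda>x. indicator K x *\<^sub>R (cmod (p x))\<^sup>2)"
    by (rule borel_integrable_compact[OF K]) (intro continuous_intros pK)
  moreover have "(\<lambda>x. indicator K x *\<^sub>R (cmod (p x))\<^sup>2) = (\<lambda>x. (cmod (cutoff K p x))\<^sup>2)"
    by (auto simp: cutoff_def indicator_def fun_eq_iff)
  ultimately show "integrable lborel (\<lambda>x. (cmod (cutoff K p x))\<^sup>2)" by simp
  have "bounded (p ` K)" by (intro compact_imp_bounded compact_continuous_image pK K)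
  then obtain C where "C > 0" "\<forall>x\<in>K. cmod (p x) \<le> C" by (auto simp: bounded_pos)
  then show "\<exists>C>0. \<forall>x. cmod (cutoff K p x) \<le> C"
    by (intro exI[of _ C]) (auto simp: cutoff_def indicator_def)
qed

lemma cutoff_measurable: "compact K \<Longrightarrow> continuous_on UNIV p \<Longrightarrow> cutoff K p \<in> borel_measurable borel"
  using borel_measurable_integrable[OF cutoff_integrable] by simp

text \<open>
  Since \<open>K\<close> is closed, a point outside \<open>K\<close> stays outside the translates for small shifts, so the integral of the
  positive part of the difference tends to \<open>0\<close>. The integral of the difference itself is \<open>0\<close> by translation invariance, so the negative
  part contributes equally. This is the continuity of translations in \<open>L\<^sup>1\<close>.
\<close>

lemma translate_indicator_tendsto:
  assumes K: "compact K" and s: "s \<longlonglongrightarrow> (0::real)"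
  shows "(\<lambda>n. LBINT y. \<bar>indicator K (y - s n) - indicator K y :: real\<bar>) \<longlonglongrightarrow> 0"
proof -
  have Km[measurable]: "K \<in> sets borel" using K by (simp add: compact_imp_closed borel_closed)
  have I: "integrable lborel (indicator K :: real \<Rightarrow> real)"
    using K by (intro integrable_real_indicator emeasure_compact_finite) auto
  have It: "integrable lborel (\<lambda>y. indicator K (y - s n) :: real)" for n
    using lborel_integrable_real_affine[OF I, of 1 "- s n"] by (simp add: algebra_simps)
  have eq: "(LBINT y. indicator K (y - s n)) = (LBINT y. indicator K y :: real)" for n
    using lborel_integral_real_affine[of 1 "indicator K :: real \<Rightarrow> real" "- s n"] by (simp add: algebra_simps)
  obtain B where B: "\<forall>x\<in>K. \<bar>x\<bar> \<le> B" using compact_imp_bounded[OF K] by (auto simp: bounded_iff)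
  obtain S where S: "\<And>n. \<bar>s n\<bar> \<le> S" using convergent_imp_bounded[OF s] by (auto simp: bounded_iff)
  have "(\<lambda>n. LBINT y. max 0 (indicator K (y - s n) - indicator K y :: real)) \<longlonglongrightarrow> (LBINT y::real. 0)"
  proof (rule integral_dominated_convergence[where w="indicator {-(B + S)..B + S}"])
    show "integrable lborel (indicator {-(B + S)..B + S} :: real \<Rightarrow> real)"
      by (intro integrable_real_indicator) (auto simp: emeasure_lborel_Icc_eq)
    show "AE y in lborel. (\<lambda>n. max 0 (indicator K (y - s n) - indicator K y :: real)) \<longlonglongrightarrow> 0"
    proof (rule AE_I2)
      fix y
      show "(\<lambda>n. max 0 (indicator K (y - s n) - indicator K y :: real)) \<longlonglongrightarrow> 0"
      proof (cases "y \<in> K")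
        case True
        then have "max 0 (indicator K (y - s n) - indicator K y :: real) = 0" for n by (auto simp: indicator_def)
        then show ?thesis by simp
      next
        case False
        have "(\<lambda>n. y - s n) \<longlonglongrightarrow> y - 0" by (intro tendsto_intros s)
        moreover have "open (- K)" using K by (simp add: compact_imp_closed open_Compl)
        ultimately have "\<forall>\<^sub>F n in sequentially. y - s n \<in> - K"
          using False by (intro topological_tendstoD) auto
        then have "\<forall>\<^sub>F n in sequentially. max 0 (indicator K (y - s n) - indicator K y :: real) = 0"
          by eventually_elim (auto simp: indicator_def)
        then show ?thesis by (rule tendsto_eventually)
      qed
    qed
    show "AE y in lborel. norm (max 0 (indicator K (y - s n) - indicator K y :: real)) \<le> indicator {-(B + S)..B + S} y" for n
    proof (rule AE_I2)
      fix y
      show "norm (max 0 (indicator K (y - s n) - indicator K y :: real)) \<le> indicator {-(B + S)..B + S} y"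
        using B[rule_format, of "y - s n"] S[of n] by (auto simp: indicator_def abs_le_iff)
    qed
  qed auto
  then have "(\<lambda>n. 2 * (LBINT y. max 0 (indicator K (y - s n) - indicator K y :: real))) \<longlonglongrightarrow> 2 * 0"
    by (intro tendsto_mult tendsto_const) simp
  moreover have "(LBINT y. \<bar>indicator K (y - s n) - indicator K y :: real\<bar>)
      = 2 * (LBINT y. max 0 (indicator K (y - s n) - indicator K y :: real))" for n
  proof -
    have "(LBINT y. \<bar>indicator K (y - s n) - indicator K y :: real\<bar>)
      = (LBINT y. 2 * max 0 (indicator K (y - s n) - indicator K y) - (indicator K (y - s n) - indicator K y :: real))"
      by (intro Bochner_Integration.integral_cong) (auto simp: indicator_def)
    also have "\<dots> = 2 * (LBINT y. max 0 (indicator K (y - s n) - indicator K y :: real))"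
      using I It eq by (subst Bochner_Integration.integral_diff) auto
    finally show ?thesis .
  qed
  ultimately show ?thesis by simp
qed

text \<open>
  First the shift of the indicator is removed, at the price of a uniform bound on \<open>p1\<close> near \<open>K2\<close>; the shift of
  the continuous \<open>p1\<close> is then harmless.
\<close>

lemma cutoff_correlation_tendsto:
  assumes K1: "compact K1" and p1: "continuous_on UNIV p1" and K2: "compact K2" and p2: "continuous_on UNIV p2"
    and s: "s \<longlonglongrightarrow> (0::real)"
  shows "(\<lambda>n. LBINT y. cnj (cutoff K2 p2 y) * cutoff K1 p1 (y - s n)) \<longlonglongrightarrow>
    (LBINT y. cnj (cutoff K2 p2 y) * cutoff K1 p1 y)"
proof -
  let ?h2 = "\<lambda>y. cnj (cutoff K2 p2 y)"
  have K1m[measurable]: "K1 \<in> sets borel" using K1 by (simp add: compact_imp_closed borel_closed)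
  have [measurable]: "p1 \<in> borel_measurable borel" using p1 by (rule borel_measurable_continuous_onI)
  have [measurable]: "cutoff K2 p2 \<in> borel_measurable borel" by (rule cutoff_measurable[OF K2 p2])
  have h2i: "integrable lborel ?h2" using cutoff_integrable[OF K2 p2] by simp
  have [measurable]: "?h2 \<in> borel_measurable borel" using borel_measurable_integrable[OF h2i] by simp
  obtain C2 where C2: "C2 > 0" "\<And>x. cmod (cutoff K2 p2 x) \<le> C2" using cutoff_bounded[OF K2 p2] by auto
  obtain B where B: "\<forall>x\<in>K2. \<bar>x\<bar> \<le> B" using compact_imp_bounded[OF K2] by (auto simp: bounded_iff)
  obtain S where S: "\<And>n. \<bar>s n\<bar> \<le> S" using convergent_imp_bounded[OF s] by (auto simp: bounded_iff)
  have "bounded (p1 ` {-(B + S)..B + S})"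
    by (intro compact_imp_bounded compact_continuous_image continuous_on_subset[OF p1]) auto
  then obtain C1 where C1: "C1 > 0" "\<forall>x\<in>{-(B + S)..B + S}. cmod (p1 x) \<le> C1" by (auto simp: bounded_pos)
  have p1b: "cmod (p1 (y - s n)) \<le> C1" if "y \<in> K2" for y n
    using that B[rule_format, of y] S[of n] by (intro C1(2)[rule_format]) (auto simp: abs_le_iff)
  have b: "cmod (?h2 y * p1 (y - s n)) \<le> C2 * C1" for y n
  proof (cases "y \<in> K2")
    case True
    then show ?thesis using C2 C1 p1b[of y n] by (simp add: norm_mult mult_mono)
  next
    case False
    then show ?thesis using C2 C1 by (simp add: cutoff_def)
  qed
  have b2: "cmod (?h2 y * p1 (y - s n)) \<le> C1 * cmod (?h2 y)" for y n
  proof (cases "y \<in> K2")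
    case True
    then show ?thesis using p1b[of y n] by (subst mult.commute) (simp add: norm_mult mult_mono)
  next
    case False
    then show ?thesis by (simp add: cutoff_def)
  qed
  have main: "(\<lambda>n. LBINT y. indicator K1 y *\<^sub>R (?h2 y * p1 (y - s n))) \<longlonglongrightarrow> (LBINT y. indicator K1 y *\<^sub>R (?h2 y * p1 y))"
  proof (rule integral_dominated_convergence[where w="\<lambda>y. C1 * cmod (?h2 y)"])
    show "integrable lborel (\<lambda>y. C1 * cmod (?h2 y))" using h2i by (intro integrable_mult_right integrable_norm)
    show "AE y in lborel. (\<lambda>n. indicator K1 y *\<^sub>R (?h2 y * p1 (y - s n))) \<longlonglongrightarrow> indicator K1 y *\<^sub>R (?h2 y * p1 y)"
    proof (intro AE_I2 tendsto_scaleR tendsto_mult tendsto_const)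
      fix y
      have "(\<lambda>n. y - s n) \<longlonglongrightarrow> y - 0" by (intro tendsto_intros s)
      then show "(\<lambda>n. p1 (y - s n)) \<longlonglongrightarrow> p1 y"
        using p1 by (intro isCont_tendsto_compose[of y p1]) (auto simp: continuous_on_eq_continuous_at)
    qed
    show "AE y in lborel. norm (indicator K1 y *\<^sub>R (?h2 y * p1 (y - s n))) \<le> C1 * cmod (?h2 y)" for n
      using b2[of _ n] C1 by (auto simp: indicator_def)
  qed measurable
  have int1: "integrable lborel (\<lambda>y. indicator K1 y *\<^sub>R (?h2 y * p1 (y - s n)))" for n
    by (rule Bochner_Integration.integrable_bound[where f="\<lambda>y. C1 * cmod (?h2 y)"])
       (use h2i b2[of _ n] C1 in \<open>auto simp: indicator_def intro!: integrable_mult_right integrable_norm\<close>)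
  have int2: "integrable lborel (\<lambda>y. indicator K1 (y - s n) *\<^sub>R (?h2 y * p1 (y - s n)))" for n
    by (rule Bochner_Integration.integrable_bound[where f="\<lambda>y. C1 * cmod (?h2 y)"])
       (use h2i b2[of _ n] C1 in \<open>auto simp: indicator_def intro!: integrable_mult_right integrable_norm\<close>)
  have diff: "(\<lambda>n. (LBINT y. indicator K1 (y - s n) *\<^sub>R (?h2 y * p1 (y - s n)))
      - (LBINT y. indicator K1 y *\<^sub>R (?h2 y * p1 (y - s n)))) \<longlonglongrightarrow> 0"
  proof (rule Lim_null_comparison)
    show "(\<lambda>n. C2 * C1 * (LBINT y. \<bar>indicator K1 (y - s n) - indicator K1 y :: real\<bar>)) \<longlonglongrightarrow> 0"
      using tendsto_mult[OF tendsto_const translate_indicator_tendsto[OF K1 s]] by simp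
    have I: "integrable lborel (indicator K1 :: real \<Rightarrow> real)"
      using K1 by (intro integrable_real_indicator emeasure_compact_finite) auto
    have It: "integrable lborel (\<lambda>y. indicator K1 (y - s n) :: real)" for n
      using lborel_integrable_real_affine[OF I, of 1 "- s n"] by (simp add: algebra_simps)
    have "norm ((LBINT y. indicator K1 (y - s n) *\<^sub>R (?h2 y * p1 (y - s n)))
      - (LBINT y. indicator K1 y *\<^sub>R (?h2 y * p1 (y - s n)))) \<le> C2 * C1 * (LBINT y. \<bar>indicator K1 (y - s n) - indicator K1 y :: real\<bar>)" for n
    proof -
      have "(LBINT y. indicator K1 (y - s n) *\<^sub>R (?h2 y * p1 (y - s n))) - (LBINT y. indicator K1 y *\<^sub>R (?h2 y * p1 (y - s n)))
        = (LBINT y. (indicator K1 (y - s n) - indicator K1 y) *\<^sub>R (?h2 y * p1 (y - s n)))"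
        using int1 int2 by (subst Bochner_Integration.integral_diff[symmetric]) (auto simp: scaleR_diff_left)
      also have "norm \<dots> \<le> (LBINT y. C2 * C1 * \<bar>indicator K1 (y - s n) - indicator K1 y :: real\<bar>)"
      proof (rule Bochner_Integration.integral_norm_bound_integral)
        show "integrable lborel (\<lambda>y. (indicator K1 (y - s n) - indicator K1 y) *\<^sub>R (?h2 y * p1 (y - s n)))"
          using int1 int2 by (simp add: scaleR_diff_left)
        show "integrable lborel (\<lambda>y. C2 * C1 * \<bar>indicator K1 (y - s n) - indicator K1 y :: real\<bar>)"
          using I It by (intro integrable_mult_right integrable_abs Bochner_Integration.integrable_diff)
        fix y
        show "norm ((indicator K1 (y - s n) - indicator K1 y) *\<^sub>R (?h2 y * p1 (y - s n))) \<le> C2 * C1 * \<bar>indicator K1 (y - s n) - indicator K1 y :: real\<bar>"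
          unfolding norm_scaleR using b[of y n] by (subst mult.commute) (intro mult_right_mono, auto)
      qed
      finally show ?thesis by simp
    qed
    then show "\<forall>\<^sub>F n in sequentially. norm ((LBINT y. indicator K1 (y - s n) *\<^sub>R (?h2 y * p1 (y - s n)))
      - (LBINT y. indicator K1 y *\<^sub>R (?h2 y * p1 (y - s n)))) \<le> C2 * C1 * (LBINT y. \<bar>indicator K1 (y - s n) - indicator K1 y :: real\<bar>)"
      by simp
  qed
  have "(\<lambda>n. LBINT y. indicator K1 (y - s n) *\<^sub>R (?h2 y * p1 (y - s n))) \<longlonglongrightarrow> 0 + (LBINT y. indicator K1 y *\<^sub>R (?h2 y * p1 y))"
    using tendsto_add[OF diff main] by simp
  then show ?thesis by (simp add: cutoff_def[of K1] mult_scaleR_right)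
qed

lemma gaussian_weight_integrable:
  assumes "0 < \<epsilon>"
  shows "integrable lborel (\<lambda>\<omega>::real. exp (- (\<epsilon> * \<omega>)\<^sup>2 / 2))"
proof -
  have "integrable lborel std_normal_density" by simp
  from lborel_integrable_real_affine[OF this, of \<epsilon> 0]
  have "integrable lborel (\<lambda>\<omega>. sqrt (2 * pi) * std_normal_density (\<epsilon> * \<omega>))" using assms by simp
  then show ?thesis by (simp add: std_normal_density_def)
qed

text \<open>
  With the Gaussian factor the double integral over frequency and time converges absolutely. The Gaussian is
  transformed into a Gaussian of width \<open>\<epsilon>\<close>, which averages the correlation of \<open>h1\<close> and \<open>h2\<close> over
  shifts of size \<open>\<epsilon>\<close>.
\<close>

lemma regularised_parseval:
  fixes h1 h2 :: "real \<Rightarrow> complex"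
  assumes h1: "integrable lborel h1" "\<And>x. cmod (h1 x) \<le> C1"
    and h2: "integrable lborel h2" and \<epsilon>: "0 < \<epsilon>"
  shows "(LBINT \<omega>. fourier_integral h1 \<omega> * cnj (fourier_integral h2 \<omega>) * complex_of_real (exp (- (\<epsilon> * \<omega>)\<^sup>2 / 2)))
    = 2 * pi * (LBINT u. complex_of_real (std_normal_density u) * (LBINT y. cnj (h2 y) * h1 (y - \<epsilon> * u)))"
proof -
  define W where "W \<omega> = complex_of_real (exp (- (\<epsilon> * \<omega>)\<^sup>2 / 2))" for \<omega>
  have W: "integrable lborel W" unfolding W_def
    using gaussian_weight_integrable[OF \<epsilon>] by (rule integrable_of_real)
  have h1m[measurable]: "h1 \<in> borel_measurable borel" using borel_measurable_integrable[OF h1(1)] by simp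
  have h2c: "integrable lborel (\<lambda>y. cnj (h2 y))" using h2 by simp
  have FW: "integrable lborel (\<lambda>\<omega>. fourier_integral h1 \<omega> * W \<omega>)"
    using integrable_times_bounded[OF W fourier_integral_measurable[OF h1(1)] fourier_integral_bound] by (simp add: mult.commute)
  have "(LBINT \<omega>. fourier_integral h1 \<omega> * cnj (fourier_integral h2 \<omega>) * W \<omega>)
      = (LBINT \<omega>. (fourier_integral h1 \<omega> * W \<omega>) * (LBINT y. cnj (h2 y) * iexp (\<omega> * y)))"
  proof (intro Bochner_Integration.integral_cong refl)
    fix \<omega>
    have "cnj (fourier_integral h2 \<omega>) = (LBINT y. cnj (h2 y) * iexp (\<omega> * y))"
      unfolding fourier_integral_def by (subst Bochner_Integration.integral_cnj[symmetric]) (simp add: exp_cnj)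
    then show "fourier_integral h1 \<omega> * cnj (fourier_integral h2 \<omega>) * W \<omega> =
      (fourier_integral h1 \<omega> * W \<omega>) * (LBINT y. cnj (h2 y) * iexp (\<omega> * y))" by simp
  qed
  also have "\<dots> = (LBINT y. cnj (h2 y) * (LBINT \<omega>. (fourier_integral h1 \<omega> * W \<omega>) * iexp (\<omega> * y)))"
    by (rule integral_kernel_swap[OF FW h2c, where C=1]) (use measurable_exp_i_pair(1) in \<open>simp_all add: case_prod_unfold\<close>)
  also have "\<dots> = (LBINT y. cnj (h2 y) * (2 * pi * (LBINT u. complex_of_real (std_normal_density u) * h1 (y - \<epsilon> * u))))"
  proof (intro Bochner_Integration.integral_cong refl arg_cong2[where f="(*)"])
    fix y
    have "(LBINT \<omega>. (fourier_integral h1 \<omega> * W \<omega>) * iexp (\<omega> * y))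
      = (LBINT \<omega>. W \<omega> * (LBINT x. h1 x * iexp (\<omega> * (y - x))))"
    proof (intro Bochner_Integration.integral_cong refl)
      fix \<omega>
      have "exp (- \<i> * complex_of_real (\<omega> * x)) * iexp (\<omega> * y) = iexp (\<omega> * (y - x))" for x
        by (simp flip: exp_add add: algebra_simps)
      then have "fourier_integral h1 \<omega> * iexp (\<omega> * y) = (LBINT x. h1 x * iexp (\<omega> * (y - x)))"
        unfolding fourier_integral_def by (subst integral_mult_left_zero[symmetric]) (simp add: mult.assoc)
      then show "(fourier_integral h1 \<omega> * W \<omega>) * iexp (\<omega> * y) = W \<omega> * (LBINT x. h1 x * iexp (\<omega> * (y - x)))"
        by (simp add: mult_ac)
    qed
    also have "\<dots> = (LBINT x. h1 x * (LBINT \<omega>. W \<omega> * iexp (\<omega> * (y - x))))"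
    proof (rule integral_kernel_swap[OF W h1(1), where C=1])
      show "(\<lambda>(\<omega>, x). iexp (\<omega> * (y - x))) \<in> borel_measurable (borel \<Otimes>\<^sub>M borel)"
        unfolding borel_prod case_prod_unfold by (intro borel_measurable_continuous_onI continuous_intros)
    qed simp
    also have "\<dots> = (LBINT x. h1 x * complex_of_real (2 * pi / \<epsilon> * std_normal_density ((y - x) / \<epsilon>)))"
      unfolding W_def gaussian_fourier[OF \<epsilon>] ..
    also have "\<dots> = \<epsilon> *\<^sub>R (LBINT u. complex_of_real (2 * pi / \<epsilon>) * (complex_of_real (std_normal_density u) * h1 (y - \<epsilon> * u)))"
      by (subst lborel_integral_real_affine[of "- \<epsilon>" _ y])
         (use \<epsilon> in \<open>simp_all add: mult_ac\<close>)
    also have "\<dots> = 2 * pi * (LBINT u. complex_of_real (std_normal_density u) * h1 (y - \<epsilon> * u))"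
      unfolding integral_mult_right_zero using \<epsilon> by (simp add: scaleR_conv_of_real)
    finally show "(LBINT \<omega>. (fourier_integral h1 \<omega> * W \<omega>) * iexp (\<omega> * y))
      = 2 * pi * (LBINT u. complex_of_real (std_normal_density u) * h1 (y - \<epsilon> * u))" .
  qed
  also have "\<dots> = 2 * pi * (LBINT y. cnj (h2 y) * (LBINT u. complex_of_real (std_normal_density u) * h1 (y - \<epsilon> * u)))"
    by (subst integral_mult_right_zero[symmetric]) (simp add: mult_ac)
  also have "(LBINT y. cnj (h2 y) * (LBINT u. complex_of_real (std_normal_density u) * h1 (y - \<epsilon> * u)))
    = (LBINT u. complex_of_real (std_normal_density u) * (LBINT y. cnj (h2 y) * h1 (y - \<epsilon> * u)))"
  proof (rule integral_kernel_swap[OF h2c _ _ h1(2)])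
    show "integrable lborel (\<lambda>u. complex_of_real (std_normal_density u))" by (intro integrable_of_real) simp
    have "(\<lambda>z::real \<times> real. fst z - \<epsilon> * snd z) \<in> borel_measurable (borel \<Otimes>\<^sub>M borel)" by measurable
    from measurable_compose[OF this h1m]
    show "(\<lambda>(y, u). h1 (y - \<epsilon> * u)) \<in> borel_measurable (borel \<Otimes>\<^sub>M borel)" by (simp add: case_prod_unfold)
  qed
  finally show ?thesis unfolding W_def .
qed

lemma regularised_parseval_tendsto:
  assumes K1: "compact K1" and p1: "continuous_on UNIV p1" and K2: "compact K2" and p2: "continuous_on UNIV p2"
  shows "(\<lambda>n. LBINT \<omega>. fourier_integral (cutoff K1 p1) \<omega> * cnj (fourier_integral (cutoff K2 p2) \<omega>) *
        complex_of_real (exp (- (\<omega> / real (Suc n))\<^sup>2 / 2)))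
    \<longlonglongrightarrow> 2 * pi * (LBINT y. cnj (cutoff K2 p2 y) * cutoff K1 p1 y)"
proof -
  let ?h1 = "cutoff K1 p1" and ?h2 = "\<lambda>y. cnj (cutoff K2 p2 y)"
  obtain C1 where C1: "C1 > 0" "\<And>x. cmod (?h1 x) \<le> C1" using cutoff_bounded[OF K1 p1] by auto
  have i1: "integrable lborel ?h1" and i2: "integrable lborel (cutoff K2 p2)"
    using cutoff_integrable K1 p1 K2 p2 by auto
  have i2c: "integrable lborel ?h2" using i2 by simp
  have h1m[measurable]: "?h1 \<in> borel_measurable borel" using borel_measurable_integrable[OF i1] by simp
  have h2m[measurable]: "?h2 \<in> borel_measurable borel" using borel_measurable_integrable[OF i2c] by simp
  define A where "A s = (LBINT y. ?h2 y * ?h1 (y - s))" for s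
  have Am: "A \<in> borel_measurable borel"
  proof -
    have e: "borel_measurable (borel \<Otimes>\<^sub>M lborel) = (borel_measurable (borel \<Otimes>\<^sub>M borel) :: (real \<times> real \<Rightarrow> complex) set)"
      by (rule measurable_cong_sets[OF sets_pair_measure_cong]) auto
    have "(\<lambda>z::real \<times> real. snd z - fst z) \<in> borel_measurable (borel \<Otimes>\<^sub>M borel)" by measurable
    then have "(\<lambda>z. ?h2 (snd z) * ?h1 (snd z - fst z)) \<in> borel_measurable (borel \<Otimes>\<^sub>M lborel)"
      unfolding e by (intro borel_measurable_times measurable_compose[OF _ h1m] measurable_compose[OF measurable_snd h2m])
    then show ?thesis unfolding A_def[abs_def]
      by (intro lborel.borel_measurable_lebesgue_integral) (simp add: case_prod_unfold)
  qed
  have Ab: "cmod (A s) \<le> C1 * (LBINT y. cmod (?h2 y))" for s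
  proof -
    have "cmod (A s) \<le> (LBINT y. C1 * cmod (?h2 y))"
      unfolding A_def
    proof (rule Bochner_Integration.integral_norm_bound_integral)
      have "(\<lambda>y. ?h1 (y - s)) \<in> borel_measurable borel" by measurable
      then show "integrable lborel (\<lambda>y. ?h2 y * ?h1 (y - s))"
        by (rule integrable_times_bounded[OF i2c _ C1(2)])
      show "integrable lborel (\<lambda>y. C1 * cmod (?h2 y))" using i2c by (intro integrable_mult_right integrable_norm)
      fix y
      show "norm (?h2 y * ?h1 (y - s)) \<le> C1 * cmod (?h2 y)"
        unfolding norm_mult by (subst mult.commute) (intro mult_right_mono C1(2), simp)
    qed
    then show ?thesis by simp
  qed
  have "(\<lambda>n. LBINT u. complex_of_real (std_normal_density u) * A ((1 / real (Suc n)) * u))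
    \<longlonglongrightarrow> (LBINT u. complex_of_real (std_normal_density u) * A 0)"
  proof (rule integral_dominated_convergence[where w="\<lambda>u. std_normal_density u * (C1 * (LBINT y. cmod (?h2 y)))"])
    show "(\<lambda>u. complex_of_real (std_normal_density u) * A ((1 / real (Suc n)) * u)) \<in> borel_measurable lborel" for n
    proof -
      have "(\<lambda>u. A ((1 / real (Suc n)) * u)) \<in> borel_measurable borel"
        by (rule measurable_compose[OF _ Am]) measurable
      then show ?thesis by measurable
    qed
    show "AE u in lborel. norm (complex_of_real (std_normal_density u) * A ((1 / real (Suc n)) * u)) \<le> std_normal_density u * (C1 * (LBINT y. cmod (?h2 y)))" for n
      using Ab by (auto simp: norm_mult intro!: mult_left_mono)
    show "AE u in lborel. (\<lambda>n. complex_of_real (std_normal_density u) * A ((1 / real (Suc n)) * u)) \<longlonglongrightarrow> complex_of_real (std_normal_density u) * A 0"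
    proof (intro AE_I2 tendsto_mult tendsto_const)
      fix u :: real
      have "(\<lambda>n. 1 / real (Suc n) * u) \<longlonglongrightarrow> 0 * u"
        by (intro tendsto_mult tendsto_const) (rule LIMSEQ_Suc[OF lim_const_over_n[of 1]])
      then show "(\<lambda>n. A ((1 / real (Suc n)) * u)) \<longlonglongrightarrow> A 0"
        using cutoff_correlation_tendsto[OF K1 p1 K2 p2, of "\<lambda>n. 1 / real (Suc n) * u"] by (simp add: A_def)
    qed
  qed (auto intro!: integrable_mult_left)
  also have "(LBINT u. complex_of_real (std_normal_density u) * A 0) = A 0"
    by (subst integral_mult_left_zero) simp
  finally have "(\<lambda>n. 2 * pi * (LBINT u. complex_of_real (std_normal_density u) * A ((1 / real (Suc n)) * u))) \<longlonglongrightarrow> 2 * pi * A 0"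
    by (intro tendsto_mult tendsto_const)
  moreover have "(LBINT \<omega>. fourier_integral ?h1 \<omega> * cnj (fourier_integral (cutoff K2 p2) \<omega>) *
        complex_of_real (exp (- (\<omega> / real (Suc n))\<^sup>2 / 2))) = 2 * pi * (LBINT u. complex_of_real (std_normal_density u) * A ((1 / real (Suc n)) * u))" for n
    using regularised_parseval[OF i1 C1(2) i2, of "1 / real (Suc n)"] by (simp add: A_def)
  ultimately show ?thesis by (simp only: A_def diff_zero)
qed

text \<open>
  The Gaussian factors increase to \<open>1\<close>, so monotone convergence yields square-integrability and the value of the
  integral together.
\<close>

lemma plancherel_cutoff:
  assumes K: "compact K" and p: "continuous_on UNIV p"
  shows fourier_cutoff_square_integrable: "integrable lborel (\<lambda>\<omega>. (cmod (fourier_integral (cutoff K p) \<omega>))\<^sup>2)"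
    and plancherel_cutoff_eq: "energy (fourier_integral (cutoff K p)) = 2 * pi * energy (cutoff K p)"
proof -
  let ?F = "fourier_integral (cutoff K p)"
  have i: "integrable lborel (cutoff K p)" by (rule cutoff_integrable[OF K p])
  have Fm[measurable]: "?F \<in> borel_measurable borel" by (rule fourier_integral_measurable[OF i])
  define w where "w n \<omega> = exp (- (\<omega> / real (Suc n))\<^sup>2 / 2)" for n and \<omega> :: real
  have cc: "z * cnj z = complex_of_real ((cmod z)\<^sup>2)" for z by (simp only: complex_norm_square)
  have "(\<lambda>n. LBINT \<omega>. ?F \<omega> * cnj (?F \<omega>) * complex_of_real (w n \<omega>)) \<longlonglongrightarrow> 2 * pi * (LBINT y. cnj (cutoff K p y) * cutoff K p y)"
    unfolding w_def by (rule regularised_parseval_tendsto[OF K p K p])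
  then have "(\<lambda>n. complex_of_real (LBINT \<omega>. (cmod (?F \<omega>))\<^sup>2 * w n \<omega>)) \<longlonglongrightarrow> complex_of_real (2 * pi * energy (cutoff K p))"
    by (simp add: cc mult.commute[of "cnj _" for z] flip: integral_complex_of_real)
  then have lim: "(\<lambda>n. LBINT \<omega>. (cmod (?F \<omega>))\<^sup>2 * w n \<omega>) \<longlonglongrightarrow> 2 * pi * energy (cutoff K p)"
    by (simp only: tendsto_of_real_iff)
  have int: "integrable lborel (\<lambda>\<omega>. (cmod (?F \<omega>))\<^sup>2 * w n \<omega>)" for n
  proof (rule Bochner_Integration.integrable_bound)
    have "integrable lborel (w n)" using gaussian_weight_integrable[of "1 / real (Suc n)"] by (simp add: w_def[abs_def])
    then show "integrable lborel (\<lambda>\<omega>. (LBINT x. cmod (cutoff K p x))\<^sup>2 * w n \<omega>)" by simp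
    show "AE \<omega> in lborel. norm ((cmod (?F \<omega>))\<^sup>2 * w n \<omega>) \<le> norm ((LBINT x. cmod (cutoff K p x))\<^sup>2 * w n \<omega>)"
      using fourier_integral_bound by (auto simp: w_def abs_mult intro!: mult_right_mono power_mono)
    show "(\<lambda>\<omega>. (cmod (?F \<omega>))\<^sup>2 * w n \<omega>) \<in> borel_measurable lborel" unfolding w_def by measurable
  qed
  have mono: "mono (\<lambda>n. (cmod (?F \<omega>))\<^sup>2 * w n \<omega>)" for \<omega>
  proof (rule monoI, rule mult_left_mono)
    fix m n :: nat assume "m \<le> n"
    then have "(\<omega> / real (Suc n))\<^sup>2 \<le> (\<omega> / real (Suc m))\<^sup>2"
      unfolding power_divide by (intro divide_left_mono power_mono) auto
    then show "w m \<omega> \<le> w n \<omega>" by (simp add: w_def)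
  qed simp
  have pt: "(\<lambda>n. (cmod (?F \<omega>))\<^sup>2 * w n \<omega>) \<longlonglongrightarrow> (cmod (?F \<omega>))\<^sup>2" for \<omega>
  proof -
    have "(\<lambda>n. w n \<omega>) \<longlonglongrightarrow> exp (- 0\<^sup>2 / 2)"
      unfolding w_def by (intro tendsto_intros) (rule LIMSEQ_Suc[OF lim_const_over_n], simp)
    from tendsto_mult[OF tendsto_const this] show ?thesis by simp
  qed
  show "integrable lborel (\<lambda>\<omega>. (cmod (?F \<omega>))\<^sup>2)"
    by (rule integrable_monotone_convergence[OF int _ _ lim]) (use mono pt in auto)
  show "energy ?F = 2 * pi * energy (cutoff K p)"
    by (rule integral_monotone_convergence[OF int _ _ lim]) (use mono pt in auto)
qed

lemma integrable_mult_complex_L2: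
  fixes u v :: "real \<Rightarrow> complex"
  assumes u: "u \<in> borel_measurable borel" "integrable lborel (\<lambda>x. (cmod (u x))\<^sup>2)"
    and v: "v \<in> borel_measurable borel" "integrable lborel (\<lambda>x. (cmod (v x))\<^sup>2)"
  shows "integrable lborel (\<lambda>x. u x * v x)"
    and "(cmod (LBINT x. u x * v x))\<^sup>2 \<le> energy u * energy v"
proof -
  note [measurable] = u(1) v(1)
  have m: "(\<lambda>x. cmod (u x)) \<in> borel_measurable lborel" "(\<lambda>x. cmod (v x)) \<in> borel_measurable lborel" by measurable
  have "integrable lborel (\<lambda>x. cmod (u x) * cmod (v x))" by (rule integrable_mult_L2[OF m u(2) v(2)])
  then have "integrable lborel (\<lambda>x. cmod (u x * v x))" by (simp add: norm_mult)
  then show i: "integrable lborel (\<lambda>x. u x * v x)" by (subst (asm) integrable_norm_iff) measurable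
  have "cmod (LBINT x. u x * v x) \<le> (LBINT x. \<bar>cmod (u x) * cmod (v x)\<bar>)"
    using integral_norm_bound[of lborel "\<lambda>x. u x * v x"] by (simp add: norm_mult)
  then have "(cmod (LBINT x. u x * v x))\<^sup>2 \<le> (LBINT x. \<bar>cmod (u x) * cmod (v x)\<bar>)\<^sup>2" by (intro power_mono) auto
  also have "\<dots> \<le> energy u * energy v"
    by (rule Cauchy_Schwarz_integral_abs[OF m u(2) v(2)])
  finally show "(cmod (LBINT x. u x * v x))\<^sup>2 \<le> energy u * energy v" .
qed

lemma parseval_cutoff:
  assumes K1: "compact K1" and p1: "continuous_on UNIV p1" and K2: "compact K2" and p2: "continuous_on UNIV p2"
  shows "(LBINT \<omega>. fourier_integral (cutoff K1 p1) \<omega> * cnj (fourier_integral (cutoff K2 p2) \<omega>))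
    = 2 * pi * (LBINT y. cutoff K1 p1 y * cnj (cutoff K2 p2 y))"
proof -
  let ?F = "fourier_integral (cutoff K1 p1)" and ?G = "\<lambda>\<omega>. cnj (fourier_integral (cutoff K2 p2) \<omega>)"
  have Fm[measurable]: "?F \<in> borel_measurable borel" "fourier_integral (cutoff K2 p2) \<in> borel_measurable borel"
    using fourier_integral_measurable cutoff_integrable K1 p1 K2 p2 by auto
  have Gm[measurable]: "?G \<in> borel_measurable borel"
    by (intro borel_measurable_continuous_on[OF _ Fm(2)] continuous_intros)
  have FG: "integrable lborel (\<lambda>\<omega>. ?F \<omega> * ?G \<omega>)"
    by (rule integrable_mult_complex_L2) (use fourier_cutoff_square_integrable K1 p1 K2 p2 in auto)
  have "(\<lambda>n. LBINT \<omega>. ?F \<omega> * ?G \<omega> * complex_of_real (exp (- (\<omega> / real (Suc n))\<^sup>2 / 2))) \<longlonglongrightarrow> (LBINT \<omega>. ?F \<omega> * ?G \<omega>)"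
  proof (rule integral_dominated_convergence[where w="\<lambda>\<omega>. cmod (?F \<omega> * ?G \<omega>)"])
    show "integrable lborel (\<lambda>\<omega>. cmod (?F \<omega> * ?G \<omega>))" by (rule integrable_norm[OF FG])
    show "AE \<omega> in lborel. (\<lambda>n. ?F \<omega> * ?G \<omega> * complex_of_real (exp (- (\<omega> / real (Suc n))\<^sup>2 / 2))) \<longlonglongrightarrow> ?F \<omega> * ?G \<omega>"
    proof (rule AE_I2)
      fix \<omega> :: real
      have "(\<lambda>n. complex_of_real (exp (- (\<omega> / real (Suc n))\<^sup>2 / 2))) \<longlonglongrightarrow> complex_of_real (exp (- 0\<^sup>2 / 2))"
        by (intro tendsto_intros) (rule LIMSEQ_Suc[OF lim_const_over_n], simp)
      from tendsto_mult[OF tendsto_const this]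
      show "(\<lambda>n. ?F \<omega> * ?G \<omega> * complex_of_real (exp (- (\<omega> / real (Suc n))\<^sup>2 / 2))) \<longlonglongrightarrow> ?F \<omega> * ?G \<omega>" by simp
    qed
    show "AE \<omega> in lborel. norm (?F \<omega> * ?G \<omega> * complex_of_real (exp (- (\<omega> / real (Suc n))\<^sup>2 / 2))) \<le> cmod (?F \<omega> * ?G \<omega>)" for n
    proof (rule AE_I2)
      fix \<omega> :: real
      have "cmod (?F \<omega> * ?G \<omega>) * exp (- (\<omega> / real (Suc n))\<^sup>2 / 2) \<le> cmod (?F \<omega> * ?G \<omega>) * 1"
        by (intro mult_left_mono) auto
      then show "norm (?F \<omega> * ?G \<omega> * complex_of_real (exp (- (\<omega> / real (Suc n))\<^sup>2 / 2))) \<le> cmod (?F \<omega> * ?G \<omega>)"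
        by (simp add: norm_mult)
    qed
  qed measurable
  from LIMSEQ_unique[OF this regularised_parseval_tendsto[OF K1 p1 K2 p2]] show ?thesis by (simp add: mult.commute)
qed

section \<open>Functions with compact spectrum\<close>

lemma L2_on_UNIV: "L2_on UNIV f \<longleftrightarrow> f \<in> borel_measurable borel \<and> integrable lborel (\<lambda>x. (cmod (f x))\<^sup>2)"
  by (simp add: L2_on_def set_borel_measurable_def set_integrable_def)

lemma L2_mult_integrable:
  assumes "L2_on UNIV u" "L2_on UNIV v"
  shows "integrable lborel (\<lambda>x. u x * v x)" "integrable lborel (\<lambda>x. u x * cnj (v x))"
    and "(cmod (LBINT x. u x * cnj (v x)))\<^sup>2 \<le> energy u * energy v"
proof -
  have v: "(\<lambda>x. cnj (v x)) \<in> borel_measurable borel" "integrable lborel (\<lambda>x. (cmod (cnj (v x)))\<^sup>2)"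
    using assms(2) by (auto simp: L2_on_UNIV intro!: borel_measurable_continuous_on[of cnj] continuous_intros)
  show "integrable lborel (\<lambda>x. u x * v x)" "integrable lborel (\<lambda>x. u x * cnj (v x))"
    "(cmod (LBINT x. u x * cnj (v x)))\<^sup>2 \<le> energy u * energy v"
    using integrable_mult_complex_L2[of u v] integrable_mult_complex_L2[of u "\<lambda>x. cnj (v x)"] assms v
    by (simp_all add: L2_on_UNIV)
qed

lemma L2_diff:
  assumes "L2_on UNIV u" "L2_on UNIV v"
  shows "L2_on UNIV (\<lambda>x. u x - v x)"
proof -
  have m: "u \<in> borel_measurable borel" "v \<in> borel_measurable borel" using assms by (auto simp: L2_on_UNIV)
  have "integrable lborel (\<lambda>x. (cmod (u x - v x))\<^sup>2)"
  proof (rule Bochner_Integration.integrable_bound)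
    show "integrable lborel (\<lambda>x. 2 * (cmod (u x))\<^sup>2 + 2 * (cmod (v x))\<^sup>2)"
      using assms by (auto simp: L2_on_UNIV)
    have "(cmod (z - w))\<^sup>2 \<le> 2 * (cmod z)\<^sup>2 + 2 * (cmod w)\<^sup>2" for z w
    proof -
      have "(cmod (z - w))\<^sup>2 \<le> (cmod z + cmod w)\<^sup>2" by (intro power_mono norm_triangle_ineq4) auto
      also have "\<dots> \<le> 2 * (cmod z)\<^sup>2 + 2 * (cmod w)\<^sup>2"
        using sum_squares_bound[of "cmod z" "cmod w"] by (simp add: power2_sum)
      finally show ?thesis .
    qed
    then show "AE x in lborel. norm ((cmod (u x - v x))\<^sup>2) \<le> norm (2 * (cmod (u x))\<^sup>2 + 2 * (cmod (v x))\<^sup>2)" by auto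
    show "(\<lambda>x. (cmod (u x - v x))\<^sup>2) \<in> borel_measurable lborel" using m by measurable
  qed
  then show ?thesis using m by (auto simp: L2_on_UNIV)
qed

lemma tendsto_integral_mult_L2:
  assumes u: "\<And>n. L2_on UNIV (u n)" and g: "L2_on UNIV g" and v: "L2_on UNIV v"
    and lim: "(\<lambda>n. energy (\<lambda>x. g x - u n x)) \<longlonglongrightarrow> 0"
  shows "(\<lambda>n. LBINT x. u n x * cnj (v x)) \<longlonglongrightarrow> (LBINT x. g x * cnj (v x))"
proof -
  let ?V = "LBINT x. (cmod (v x))\<^sup>2"
  have "(\<lambda>n. (cmod ((LBINT x. u n x * cnj (v x)) - (LBINT x. g x * cnj (v x))))\<^sup>2) \<longlonglongrightarrow> 0"
  proof (rule tendsto_sandwich[OF _ _ tendsto_const])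
    show "(\<lambda>n. energy (\<lambda>x. g x - u n x) * ?V) \<longlonglongrightarrow> 0"
      using tendsto_mult[OF lim tendsto_const[of ?V]] by simp
    have "(cmod ((LBINT x. u n x * cnj (v x)) - (LBINT x. g x * cnj (v x))))\<^sup>2 \<le> energy (\<lambda>x. g x - u n x) * ?V" for n
    proof -
      have "(LBINT x. g x * cnj (v x)) - (LBINT x. u n x * cnj (v x)) = (LBINT x. (g x - u n x) * cnj (v x))"
        using L2_mult_integrable(2)[OF u v] L2_mult_integrable(2)[OF g v]
        by (subst Bochner_Integration.integral_diff[symmetric]) (auto simp: algebra_simps)
      then show ?thesis
        using L2_mult_integrable(3)[OF L2_diff[OF g u[of n]] v] by (simp add: norm_minus_commute)
    qed
    then show "\<forall>\<^sub>F n in sequentially. (cmod ((LBINT x. u n x * cnj (v x)) - (LBINT x. g x * cnj (v x))))\<^sup>2 \<le> energy (\<lambda>x. g x - u n x) * ?V" by simp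
  qed simp
  from tendsto_real_sqrt[OF this]
  have "(\<lambda>n. cmod ((LBINT x. u n x * cnj (v x)) - (LBINT x. g x * cnj (v x)))) \<longlonglongrightarrow> 0" by simp
  then show ?thesis by (simp add: tendsto_norm_zero_iff LIM_zero_iff)
qed

text \<open>
  Taken as an absolutely convergent integral: a square-integrable \<open>G\<close> with compact support is
  integrable.
\<close>

definition inv_fourier :: "(real \<Rightarrow> complex) \<Rightarrow> real \<Rightarrow> complex" where
  "inv_fourier G x = complex_of_real (1 / (2 * pi)) * (LBINT \<omega>. G \<omega> * iexp (\<omega> * x))"

definition spectrum_in :: "real set \<Rightarrow> (real \<Rightarrow> complex) \<Rightarrow> bool" where
  "spectrum_in \<Omega> G \<longleftrightarrow> L2_on UNIV G \<and> (\<forall>\<omega>. \<omega> \<notin> \<Omega> \<longrightarrow> G \<omega> = 0)"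

lemma spectrum_in_L2: "spectrum_in \<Omega> G \<Longrightarrow> L2_on UNIV G"
  by (simp add: spectrum_in_def)

lemma spectrum_in_measurable: "spectrum_in \<Omega> G \<Longrightarrow> G \<in> borel_measurable borel"
  by (simp add: spectrum_in_def L2_on_UNIV)

lemma cutoff_L2: "compact K \<Longrightarrow> continuous_on UNIV p \<Longrightarrow> L2_on UNIV (cutoff K p)"
  by (simp add: L2_on_UNIV cutoff_measurable cutoff_square_integrable)

lemma cutoff_spectrum_in: "compact K \<Longrightarrow> continuous_on UNIV p \<Longrightarrow> spectrum_in K (cutoff K p)"
  by (simp add: spectrum_in_def cutoff_L2) (simp add: cutoff_def)

lemma spectrum_in_integrable:
  assumes \<Omega>: "compact \<Omega>" and G: "spectrum_in \<Omega> G"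
  shows "integrable lborel G"
proof -
  have "integrable lborel (\<lambda>\<omega>. G \<omega> * cutoff \<Omega> (\<lambda>_. 1) \<omega>)"
    by (rule L2_mult_integrable[OF spectrum_in_L2[OF G] cutoff_L2[OF \<Omega>]]) simp
  moreover have "(\<lambda>\<omega>. G \<omega> * cutoff \<Omega> (\<lambda>_. 1) \<omega>) = G"
    using G by (auto simp: fun_eq_iff cutoff_def indicator_def spectrum_in_def)
  ultimately show ?thesis by simp
qed

lemma spectrum_in_mult:
  assumes \<Omega>: "compact \<Omega>" and G: "spectrum_in \<Omega> G" and q: "continuous_on UNIV q"
    and C: "\<And>\<omega>. \<omega> \<in> \<Omega> \<Longrightarrow> cmod (q \<omega>) \<le> C"
  shows "spectrum_in \<Omega> (\<lambda>\<omega>. q \<omega> * G \<omega>)"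
    and "energy (\<lambda>\<omega>. q \<omega> * G \<omega>) \<le> C\<^sup>2 * energy G"
proof -
  have [measurable]: "q \<in> borel_measurable borel" "G \<in> borel_measurable borel"
    using q G by (auto simp: spectrum_in_measurable intro!: borel_measurable_continuous_onI)
  have G2: "integrable lborel (\<lambda>x. (cmod (G x))\<^sup>2)" using G by (simp add: spectrum_in_def L2_on_UNIV)
  have le: "(cmod (q \<omega> * G \<omega>))\<^sup>2 \<le> C\<^sup>2 * (cmod (G \<omega>))\<^sup>2" for \<omega>
  proof (cases "\<omega> \<in> \<Omega>")
    case True
    then show ?thesis using C[OF True]
      by (auto simp: norm_mult power_mult_distrib intro!: mult_right_mono power_mono)
  qed (use G in \<open>simp add: spectrum_in_def\<close>)
  have i: "integrable lborel (\<lambda>\<omega>. (cmod (q \<omega> * G \<omega>))\<^sup>2)"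
  proof (rule Bochner_Integration.integrable_bound)
    show "integrable lborel (\<lambda>\<omega>. C\<^sup>2 * (cmod (G \<omega>))\<^sup>2)" using G2 by simp
  qed (use le in auto)
  then show "spectrum_in \<Omega> (\<lambda>\<omega>. q \<omega> * G \<omega>)" using G by (auto simp: spectrum_in_def L2_on_UNIV)
  have "energy (\<lambda>\<omega>. q \<omega> * G \<omega>) \<le> (LBINT \<omega>. C\<^sup>2 * (cmod (G \<omega>))\<^sup>2)"
    by (rule integral_mono[OF i]) (use G2 le in auto)
  then show "energy (\<lambda>\<omega>. q \<omega> * G \<omega>) \<le> C\<^sup>2 * energy G" by simp
qed

lemma spectrum_in_power:
  assumes \<Omega>: "compact \<Omega>" and G: "spectrum_in \<Omega> G" and m: "\<And>\<omega>. \<omega> \<in> \<Omega> \<Longrightarrow> \<bar>\<omega>\<bar> \<le> m"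
  shows "spectrum_in \<Omega> (\<lambda>\<omega>. (\<i> * complex_of_real \<omega>) ^ l * G \<omega>)"
    and "energy (\<lambda>\<omega>. (\<i> * complex_of_real \<omega>) ^ l * G \<omega>) \<le> m ^ (2 * l) * energy G"
proof -
  have c: "continuous_on UNIV (\<lambda>\<omega>. (\<i> * complex_of_real \<omega>) ^ l)" by (intro continuous_intros)
  have b: "cmod ((\<i> * complex_of_real \<omega>) ^ l) \<le> m ^ l" if "\<omega> \<in> \<Omega>" for \<omega>
    using m[OF that] by (simp add: norm_power norm_mult power_mono)
  show "spectrum_in \<Omega> (\<lambda>\<omega>. (\<i> * complex_of_real \<omega>) ^ l * G \<omega>)"
    "energy (\<lambda>\<omega>. (\<i> * complex_of_real \<omega>) ^ l * G \<omega>) \<le> m ^ (2 * l) * energy G"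
    using spectrum_in_mult[OF \<Omega> G c b] by (simp_all add: power_mult[symmetric] mult.commute)
qed

text \<open>
  Differentiation under the integral sign, from the second-order Taylor estimate for \<open>e\<^bsup>i\<omega>h\<^esup>\<close>; on the
  compact set \<open>\<Omega>\<close> its remainder is uniformly quadratic in \<open>h\<close>.
\<close>

lemma inv_fourier_has_vector_derivative:
  assumes \<Omega>: "compact \<Omega>" and G: "spectrum_in \<Omega> G"
  shows "(inv_fourier G has_vector_derivative inv_fourier (\<lambda>\<omega>. (\<i> * complex_of_real \<omega>) * G \<omega>) x) (at x)"
proof -
  obtain m where m: "\<And>\<omega>. \<omega> \<in> \<Omega> \<Longrightarrow> \<bar>\<omega>\<bar> \<le> m" using compact_imp_bounded[OF \<Omega>] by (auto simp: bounded_iff)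
  let ?G1 = "\<lambda>\<omega>. (\<i> * complex_of_real \<omega>) * G \<omega>"
  have Gi: "integrable lborel G" by (rule spectrum_in_integrable[OF \<Omega> G])
  have G1i: "integrable lborel ?G1" using spectrum_in_integrable[OF \<Omega> spectrum_in_power(1)[OF \<Omega> G m, of 1]] by simp
  have ei: "integrable lborel (\<lambda>\<omega>. u \<omega> * iexp (\<omega> * x))" if "integrable lborel u" for u x
    by (rule integrable_times_bounded[OF that, where C=1]) auto
  define H where "H = (1 / (2 * pi)) * (m\<^sup>2 / 2 * (LBINT \<omega>. cmod (G \<omega>)))"
  show ?thesis
    unfolding has_vector_derivative_def
  proof (rule has_derivativeI_sandwich[where e=1 and H="\<lambda>y. H * \<bar>y - x\<bar>"])
    show "bounded_linear (\<lambda>h. h *\<^sub>R inv_fourier ?G1 x)" by (rule bounded_linear_scaleR_left)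
    have "((\<lambda>y. H * \<bar>y - x\<bar>) \<longlongrightarrow> H * \<bar>x - x\<bar>) (at x)" by (intro tendsto_intros)
    then show "((\<lambda>y. H * \<bar>y - x\<bar>) \<longlongrightarrow> 0) (at x)" by simp
    fix y :: real assume y: "y \<noteq> x"
    let ?d = "\<lambda>\<omega>. G \<omega> * iexp (\<omega> * y) - G \<omega> * iexp (\<omega> * x) - complex_of_real (y - x) * (?G1 \<omega> * iexp (\<omega> * x))"
    have di: "integrable lborel ?d"
      using ei[OF Gi] ei[OF G1i] by (intro Bochner_Integration.integrable_diff integrable_mult_right)
    have eq: "inv_fourier G y - inv_fourier G x - (y - x) *\<^sub>R inv_fourier ?G1 x = complex_of_real (1 / (2 * pi)) * (LBINT \<omega>. ?d \<omega>)"
    proof -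
      have "(LBINT \<omega>. ?d \<omega>) = (LBINT \<omega>. G \<omega> * iexp (\<omega> * y)) - (LBINT \<omega>. G \<omega> * iexp (\<omega> * x)) - complex_of_real (y - x) * (LBINT \<omega>. ?G1 \<omega> * iexp (\<omega> * x))"
        using ei[OF Gi, of y] ei[OF Gi, of x] ei[OF G1i, of x]
        by (subst Bochner_Integration.integral_diff; (subst Bochner_Integration.integral_diff)?; (intro Bochner_Integration.integrable_diff integrable_mult_right)?; simp?)
      moreover have "k * A - k * B - c * (k * D) = k * (A - B - c * D)" for k A B c D :: complex
        by (simp add: algebra_simps)
      ultimately show ?thesis unfolding inv_fourier_def scaleR_conv_of_real by (simp only:)
    qed
    have "cmod (?d \<omega>) \<le> (m\<^sup>2 / 2 * (y - x)\<^sup>2) * cmod (G \<omega>)" for \<omega>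
    proof (cases "\<omega> \<in> \<Omega>")
      case True
      have "iexp (\<omega> * y) = iexp (\<omega> * x) * iexp (\<omega> * (y - x))"
        by (simp flip: exp_add add: algebra_simps)
      then have "?d \<omega> = G \<omega> * iexp (\<omega> * x) * (iexp (\<omega> * (y - x)) - (\<Sum>k\<le>1. (\<i> * complex_of_real (\<omega> * (y - x))) ^ k / fact k))"
        by (simp add: algebra_simps)
      then have "cmod (?d \<omega>) = cmod (G \<omega>) * cmod (iexp (\<omega> * (y - x)) - (\<Sum>k\<le>1. (\<i> * complex_of_real (\<omega> * (y - x))) ^ k / fact k))"
        by (simp only: norm_mult cmod_exp_i mult_1_right)
      also have "\<dots> \<le> cmod (G \<omega>) * (\<bar>\<omega> * (y - x)\<bar> ^ Suc 1 / fact (Suc 1))"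
        by (intro mult_left_mono iexp_approx1) auto
      also have "\<bar>\<omega> * (y - x)\<bar> ^ Suc 1 / fact (Suc 1) = \<bar>\<omega>\<bar>\<^sup>2 * (y - x)\<^sup>2 / 2"
        by (simp only: Suc_1 power2_abs power_mult_distrib fact_2)
      also have "cmod (G \<omega>) * (\<bar>\<omega>\<bar>\<^sup>2 * (y - x)\<^sup>2 / 2) \<le> cmod (G \<omega>) * (m\<^sup>2 * (y - x)\<^sup>2 / 2)"
        using m[OF True] by (intro mult_left_mono divide_right_mono mult_right_mono power_mono) auto
      finally show ?thesis by (simp add: mult_ac)
    qed (use G in \<open>simp add: spectrum_in_def\<close>)
    then have "cmod (LBINT \<omega>. ?d \<omega>) \<le> (LBINT \<omega>. (m\<^sup>2 / 2 * (y - x)\<^sup>2) * cmod (G \<omega>))"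
      using Gi by (intro Bochner_Integration.integral_norm_bound_integral[OF di]) auto
    then have "cmod (inv_fourier G y - inv_fourier G x - (y - x) *\<^sub>R inv_fourier ?G1 x) \<le> (1 / (2 * pi)) * (LBINT \<omega>. (m\<^sup>2 / 2 * (y - x)\<^sup>2) * cmod (G \<omega>))"
      unfolding eq norm_mult norm_of_real by (intro mult_mono) auto
    also have "\<dots> = H * \<bar>y - x\<bar> * \<bar>y - x\<bar>" by (simp add: H_def power2_eq_square)
    finally show "norm ((inv_fourier G y - inv_fourier G x) - (y - x) *\<^sub>R inv_fourier ?G1 x) / norm (y - x) \<le> H * \<bar>y - x\<bar>"
      using y by (simp add: divide_le_eq)
  qed simp
qed

lemma
  assumes \<Omega>: "compact \<Omega>" and G: "spectrum_in \<Omega> G"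
  shows smooth_inv_fourier: "smooth (inv_fourier G)"
    and nderiv_inv_fourier: "nderiv l (inv_fourier G) = inv_fourier (\<lambda>\<omega>. (\<i> * complex_of_real \<omega>) ^ l * G \<omega>)"
proof -
  obtain m where m: "\<And>\<omega>. \<omega> \<in> \<Omega> \<Longrightarrow> \<bar>\<omega>\<bar> \<le> m" using compact_imp_bounded[OF \<Omega>] by (auto simp: bounded_iff)
  define F where "F l = inv_fourier (\<lambda>\<omega>. (\<i> * complex_of_real \<omega>) ^ l * G \<omega>)" for l
  have F: "(F l has_vector_derivative F (Suc l) x) (at x)" for l x
    using inv_fourier_has_vector_derivative[OF \<Omega> spectrum_in_power(1)[OF \<Omega> G m]] by (simp add: F_def mult.assoc)
  show "smooth (inv_fourier G)" using smoothI_seq[of F, OF F] by (simp add: F_def)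
  show "nderiv l (inv_fourier G) = inv_fourier (\<lambda>\<omega>. (\<i> * complex_of_real \<omega>) ^ l * G \<omega>)"
    using nderiv_eqI[of F l, OF F] by (simp add: F_def)
qed

lemma inv_fourier_continuous: "compact \<Omega> \<Longrightarrow> spectrum_in \<Omega> G \<Longrightarrow> continuous_on UNIV (inv_fourier G)"
  using smooth_continuous_on[OF smooth_inv_fourier, of \<Omega> G UNIV 0] by simp

lemma inv_fourier_adjoint:
  assumes \<Omega>: "compact \<Omega>" and G: "spectrum_in \<Omega> G" and u: "integrable lborel u"
  shows "(LBINT x. u x * cnj (inv_fourier G x)) = complex_of_real (1 / (2 * pi)) * (LBINT \<omega>. fourier_integral u \<omega> * cnj (G \<omega>))"
proof -
  have Gc: "integrable lborel (\<lambda>\<omega>. cnj (G \<omega>))" using spectrum_in_integrable[OF \<Omega> G] by simp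
  have "(LBINT x. u x * cnj (inv_fourier G x)) = (LBINT x. complex_of_real (1 / (2 * pi)) * (u x * (LBINT \<omega>. cnj (G \<omega>) * exp (- \<i> * complex_of_real (x * \<omega>)))))"
  proof (intro Bochner_Integration.integral_cong refl)
    fix x
    have "cnj (LBINT \<omega>. G \<omega> * iexp (\<omega> * x)) = (LBINT \<omega>. cnj (G \<omega>) * exp (- \<i> * complex_of_real (x * \<omega>)))"
      by (subst Bochner_Integration.integral_cnj[symmetric]) (simp add: exp_cnj mult.commute)
    then show "u x * cnj (inv_fourier G x) = complex_of_real (1 / (2 * pi)) * (u x * (LBINT \<omega>. cnj (G \<omega>) * exp (- \<i> * complex_of_real (x * \<omega>))))"
      by (simp add: inv_fourier_def)
  qed
  also have "\<dots> = complex_of_real (1 / (2 * pi)) * (LBINT x. u x * (LBINT \<omega>. cnj (G \<omega>) * exp (- \<i> * complex_of_real (x * \<omega>))))"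
    by (rule integral_mult_right_zero)
  also have "(LBINT x. u x * (LBINT \<omega>. cnj (G \<omega>) * exp (- \<i> * complex_of_real (x * \<omega>))))
     = (LBINT \<omega>. cnj (G \<omega>) * (LBINT x. u x * exp (- \<i> * complex_of_real (x * \<omega>))))"
    by (rule integral_kernel_swap[OF u Gc, where C=1]) (use measurable_exp_i_pair(2) in \<open>simp_all add: case_prod_unfold\<close>)
  also have "\<dots> = (LBINT \<omega>. fourier_integral u \<omega> * cnj (G \<omega>))"
    by (simp add: fourier_integral_def mult.commute)
  finally show ?thesis .
qed

lemma cutoff_self_inner:
  "(LBINT x. cutoff K F x * cnj (F x)) = complex_of_real (energy (cutoff K F))"
  unfolding integral_complex_of_real[symmetric]
  by (intro Bochner_Integration.integral_cong refl)
     (auto simp: cutoff_def indicator_def complex_norm_square[symmetric] simp flip: of_real_power)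

lemma inv_fourier_cutoff_identity:
  assumes \<Omega>: "compact \<Omega>" and G: "spectrum_in \<Omega> G" and K: "compact K"
  defines "F \<equiv> inv_fourier G"
  shows "(LBINT \<omega>. fourier_integral (cutoff K F) \<omega> * cnj (G \<omega>)) = complex_of_real (2 * pi * energy (cutoff K F))"
proof -
  have c: "continuous_on UNIV F" unfolding F_def by (rule inv_fourier_continuous[OF \<Omega> G])
  show ?thesis
    using inv_fourier_adjoint[OF \<Omega> G cutoff_integrable[OF K c]] cutoff_self_inner[of K F]
    by (simp add: F_def field_simps)
qed

lemma fourier_cutoff_L2: "compact K \<Longrightarrow> continuous_on UNIV p \<Longrightarrow> L2_on UNIV (fourier_integral (cutoff K p))"
  by (simp add: L2_on_UNIV fourier_integral_measurable cutoff_integrable fourier_cutoff_square_integrable)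

text \<open>
  By duality. If \<open>a\<close> is the energy of \<open>F\<close> on \<open>[-R, R]\<close>, then \<open>2 \<pi> a\<close> is the inner product of the transform
  of the truncated \<open>F\<close> with \<open>G\<close>, and by Cauchy-Schwarz and Plancherel for the truncated function
  \<open>(2 \<pi> a)\<^sup>2 \<le> 2 \<pi> a \<parallel>G\<parallel>\<^sup>2\<close>. So Plancherel's theorem for cut-offs of continuous functions is enough
  to treat an arbitrary square-integrable \<open>G\<close>.
\<close>

lemma inv_fourier_L2:
  assumes \<Omega>: "compact \<Omega>" and G: "spectrum_in \<Omega> G"
  shows "L2_on UNIV (inv_fourier G)"
    and "energy (inv_fourier G) \<le> 1 / (2 * pi) * energy G"
proof -
  define F where "F = inv_fourier G"
  define g where "g = energy G"
  have c: "continuous_on UNIV F" unfolding F_def by (rule inv_fourier_continuous[OF \<Omega> G])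
  then have Fm[measurable]: "F \<in> borel_measurable borel" by (rule borel_measurable_continuous_onI)
  define a where "a n = energy (cutoff {- real n..real n} F)" for n
  have a0: "0 \<le> a n" for n by (simp add: a_def)
  have ale: "a n \<le> 1 / (2 * pi) * g" for n
  proof (cases "a n = 0")
    case False
    have "(cmod (complex_of_real (2 * pi * a n)))\<^sup>2 \<le> energy (fourier_integral (cutoff {- real n..real n} F)) * g"
      using L2_mult_integrable(3)[OF fourier_cutoff_L2[OF _ c] spectrum_in_L2[OF G], of "{- real n..real n}"]
        inv_fourier_cutoff_identity[OF \<Omega> G, of "{- real n..real n}"]
      by (simp add: a_def F_def g_def)
    also have "\<dots> = 2 * pi * a n * g" by (simp add: plancherel_cutoff_eq c a_def)
    finally have "(2 * pi * a n) * (2 * pi * a n) \<le> (2 * pi * a n) * g" unfolding norm_of_real power2_abs power2_eq_square by simp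
    then have "2 * pi * a n \<le> g" using False a0[of n] by (simp add: mult_le_cancel_left)
    then show ?thesis by (simp add: field_simps)
  qed (simp add: g_def)
  have mono: "mono (\<lambda>n. (cmod (cutoff {- real n..real n} F x))\<^sup>2)" for x
    by (rule monoI) (auto simp: cutoff_def indicator_def)
  have int: "integrable lborel (\<lambda>x. (cmod (cutoff {- real n..real n} F x))\<^sup>2)" for n
    by (rule cutoff_square_integrable[OF _ c]) simp
  have "incseq a" unfolding incseq_def a_def
    using int mono by (auto intro!: integral_mono dest: monoD)
  then obtain L where L: "a \<longlonglongrightarrow> L" using incseq_convergent[of a "1 / (2 * pi) * g"] ale by metis
  have pt: "(\<lambda>n. (cmod (cutoff {- real n..real n} F x))\<^sup>2) \<longlonglongrightarrow> (cmod (F x))\<^sup>2" for x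
  proof (rule tendsto_eventually)
    obtain N where "\<bar>x\<bar> \<le> real N" using real_arch_simple by blast
    then show "\<forall>\<^sub>F n in sequentially. (cmod (cutoff {- real n..real n} F x))\<^sup>2 = (cmod (F x))\<^sup>2"
      by (intro eventually_sequentiallyI[of N]) (auto simp: cutoff_def indicator_def abs_le_iff)
  qed
  have i: "integrable lborel (\<lambda>x. (cmod (F x))\<^sup>2)"
    by (rule integrable_monotone_convergence[OF int _ _ L[unfolded a_def]]) (use mono pt in auto)
  have "energy F = L"
    by (rule integral_monotone_convergence[OF int _ _ L[unfolded a_def]]) (use mono pt in auto)
  moreover have "L \<le> 1 / (2 * pi) * g" by (rule LIMSEQ_le_const2[OF L]) (use ale in auto)
  ultimately show "L2_on UNIV (inv_fourier G)" "energy (inv_fourier G) \<le> 1 / (2 * pi) * energy G"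
    using i Fm by (auto simp: L2_on_UNIV F_def g_def)
qed

section \<open>Bandlimited functions\<close>

lemma cutoff_interval_integral: "(LBINT x:{- R..R}. f x * exp (- \<i> * complex_of_real (\<omega> * x))) = fourier_integral (cutoff {- R..R} f) \<omega>"
  by (simp add: set_lebesgue_integral_def fourier_integral_def cutoff_def)

lemma has_L2_fourier_altdef:
  "has_L2_fourier f g \<longleftrightarrow> L2_on UNIV f \<and> L2_on UNIV g \<and>
    ((\<lambda>R::real. \<integral>\<^sup>+ \<omega>. ennreal ((cmod (g \<omega> - fourier_integral (cutoff {- R..R} f) \<omega>))\<^sup>2) \<partial>lborel) \<longlongrightarrow> 0) at_top"
  by (simp only: has_L2_fourier_def cutoff_interval_integral)

text \<open>
  The union in the definition of the support is uncountable; Lindelof's theorem reduces it to a countable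
  one.
\<close>

lemma ess_supp_subset_AE:
  assumes "ess_supp g \<subseteq> \<Omega>"
  shows "AE \<omega> in lborel. \<omega> \<notin> \<Omega> \<longrightarrow> g \<omega> = 0"
proof -
  define F where "F = {U. open U \<and> (AE \<omega> in lborel. \<omega> \<in> U \<longrightarrow> g \<omega> = 0)}"
  obtain F' where F': "F' \<subseteq> F" "countable F'" "\<Union>F' = \<Union>F"
    using Lindelof[of F] by (auto simp: F_def)
  have "AE \<omega> in lborel. \<forall>U\<in>F'. \<omega> \<in> U \<longrightarrow> g \<omega> = 0"
    using F' by (subst AE_ball_countable) (auto simp: F_def)
  moreover have "- \<Omega> \<subseteq> \<Union>F'" using assms unfolding F'(3) by (auto simp: ess_supp_def F_def)
  ultimately show ?thesis by (auto elim!: eventually_mono)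
qed

abbreviation fourier_limit :: "(real \<Rightarrow> complex) \<Rightarrow> (real \<Rightarrow> complex) \<Rightarrow> bool" where
  "fourier_limit f G \<equiv> (\<lambda>n. energy (\<lambda>\<omega>. G \<omega> - fourier_integral (cutoff {- real n..real n} f) \<omega>)) \<longlonglongrightarrow> 0"

text \<open>
  The transform is only given up to null sets, so it may be changed to vanish everywhere outside \<open>\<Omega>\<close>.
\<close>

lemma bandlimited_spectrum:
  assumes \<Omega>: "compact \<Omega>" and f: "f \<in> bandlimited \<Omega>"
  obtains G where "spectrum_in \<Omega> G"
    "fourier_limit f G"
proof -
  obtain g where g: "has_L2_fourier f g" "ess_supp g \<subseteq> \<Omega>" and sm: "smooth f"
    using f by (auto simp: bandlimited_def)
  have fc: "continuous_on UNIV f" using smooth_continuous_on[OF sm, of UNIV 0] by simp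
  have \<Omega>m[measurable]: "\<Omega> \<in> sets borel" using \<Omega> by (simp add: compact_imp_closed borel_closed)
  have gL2: "L2_on UNIV g" and [measurable]: "g \<in> borel_measurable borel" using g by (auto simp: has_L2_fourier_altdef L2_on_UNIV)
  define G where "G \<omega> = indicator \<Omega> \<omega> *\<^sub>R g \<omega>" for \<omega>
  have Gm[measurable]: "G \<in> borel_measurable borel" unfolding G_def by measurable
  have ae: "AE \<omega> in lborel. g \<omega> = G \<omega>"
    using ess_supp_subset_AE[OF g(2)] by eventually_elim (auto simp: G_def indicator_def)
  have "integrable lborel (\<lambda>x. (cmod (G x))\<^sup>2)"
  proof (rule Bochner_Integration.integrable_bound)
    show "integrable lborel (\<lambda>x. (cmod (g x))\<^sup>2)" using gL2 by (simp add: L2_on_UNIV)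
  qed (auto simp: G_def indicator_def)
  then have G: "spectrum_in \<Omega> G" using Gm by (simp add: spectrum_in_def L2_on_UNIV) (simp add: G_def)
  let ?h = "\<lambda>n. fourier_integral (cutoff {- real n..real n} f)"
  have d: "L2_on UNIV (\<lambda>\<omega>. G \<omega> - ?h n \<omega>)" for n
    by (intro L2_diff spectrum_in_L2[OF G] fourier_cutoff_L2 fc) simp
  have "((\<lambda>n. \<integral>\<^sup>+ \<omega>. ennreal ((cmod (g \<omega> - ?h n \<omega>))\<^sup>2) \<partial>lborel) \<longlonglongrightarrow> 0)"
    using g(1) by (auto simp: has_L2_fourier_altdef intro: filterlim_compose[OF _ filterlim_real_sequentially])
  moreover have "(\<integral>\<^sup>+ \<omega>. ennreal ((cmod (g \<omega> - ?h n \<omega>))\<^sup>2) \<partial>lborel) = ennreal (energy (\<lambda>\<omega>. G \<omega> - ?h n \<omega>))" for n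
  proof -
    have "(\<integral>\<^sup>+ \<omega>. ennreal ((cmod (g \<omega> - ?h n \<omega>))\<^sup>2) \<partial>lborel) = (\<integral>\<^sup>+ \<omega>. ennreal ((cmod (G \<omega> - ?h n \<omega>))\<^sup>2) \<partial>lborel)"
      by (rule nn_integral_cong_AE) (use ae in eventually_elim, simp)
    also have "\<dots> = ennreal (energy (\<lambda>\<omega>. G \<omega> - ?h n \<omega>))"
      using d[of n] by (intro nn_integral_eq_integral) (auto simp: L2_on_UNIV)
    finally show ?thesis .
  qed
  ultimately have "(\<lambda>n. energy (\<lambda>\<omega>. G \<omega> - ?h n \<omega>)) \<longlonglongrightarrow> 0"
    by (simp add: ennreal_tendsto_0_iff)
  then show thesis using that G by blast
qed

lemma continuous_zero_integrals_imp_eq: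
  fixes f g :: "real \<Rightarrow> complex"
  assumes f: "continuous_on UNIV f" and g: "continuous_on UNIV g"
    and eq: "\<And>s t. s < t \<Longrightarrow> (LBINT x:{s..t}. f x) = (LBINT x:{s..t}. g x)"
  shows "f = g"
proof
  fix x :: real
  have fi: "set_integrable lborel {s..t} f" "set_integrable lborel {s..t} g" for s t
    using f g by (auto intro!: borel_integrable_atLeastAtMost' elim: continuous_on_subset)
  have e: "integral {x..t} f = integral {x..t} g" if "t \<in> {x..x + 1}" for t
    using eq[of x t] that set_borel_integral_eq_integral(2)[OF fi(1)[of x t]] set_borel_integral_eq_integral(2)[OF fi(2)[of x t]]
    by (cases "t = x") auto
  have "((\<lambda>u. integral {x..u} f) has_vector_derivative f x) (at x within {x..x + 1})"
    "((\<lambda>u. integral {x..u} g) has_vector_derivative g x) (at x within {x..x + 1})"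
    using f g by (auto intro!: integral_has_vector_derivative elim: continuous_on_subset)
  moreover from this(2) have "((\<lambda>u. integral {x..u} f) has_vector_derivative g x) (at x within {x..x + 1})"
    by (rule has_vector_derivative_transform[rotated 2]) (auto simp: e)
  ultimately show "f x = g x"
    using vector_derivative_unique_within_closed_interval[of x "x + 1" x] by auto
qed

text \<open>
  Tested against the indicator of \<open>[s, t]\<close>: Parseval's identity for the truncations of \<open>f\<close> gives in the limit the
  integral of \<open>G\<close> against the transform of the indicator, which is also what Fubini's theorem gives for
  \<open>inv_fourier G\<close>. Two continuous functions with equal integrals over all intervals agree.
\<close>

lemma bandlimited_inversion:
  assumes \<Omega>: "compact \<Omega>" and sm: "smooth f" and G: "spectrum_in \<Omega> G"
    and lim: "fourier_limit f G"
  shows "f = inv_fourier G"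
proof (rule continuous_zero_integrals_imp_eq)
  show fc: "continuous_on UNIV f" using smooth_continuous_on[OF sm, of UNIV 0] by simp
  show Fc: "continuous_on UNIV (inv_fourier G)" by (rule inv_fourier_continuous[OF \<Omega> G])
  fix s t :: real assume st: "s < t"
  define c where "c = cutoff {s..t} (\<lambda>_. 1)"
  let ?h = "\<lambda>n. cutoff {- real n..real n} f"
  have chat: "L2_on UNIV (fourier_integral c)" unfolding c_def by (rule fourier_cutoff_L2) auto
  have ci: "integrable lborel c" unfolding c_def by (rule cutoff_integrable) auto
  have "(\<lambda>n. LBINT \<omega>. fourier_integral (?h n) \<omega> * cnj (fourier_integral c \<omega>)) \<longlonglongrightarrow> (LBINT \<omega>. G \<omega> * cnj (fourier_integral c \<omega>))"
    by (rule tendsto_integral_mult_L2[OF fourier_cutoff_L2[OF _ fc] spectrum_in_L2[OF G] chat lim]) simp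
  moreover have "(LBINT \<omega>. fourier_integral (?h n) \<omega> * cnj (fourier_integral c \<omega>)) = 2 * pi * (LBINT y. ?h n y * cnj (c y))" for n
    unfolding c_def by (rule parseval_cutoff) (auto intro: fc)
  ultimately have 1: "(\<lambda>n. 2 * pi * (LBINT y. ?h n y * cnj (c y))) \<longlonglongrightarrow> (LBINT \<omega>. G \<omega> * cnj (fourier_integral c \<omega>))" by simp
  obtain N where N: "\<bar>s\<bar> \<le> real N" "\<bar>t\<bar> \<le> real N"
    using real_arch_simple[of "max \<bar>s\<bar> \<bar>t\<bar>"] by auto
  have "(LBINT y. ?h n y * cnj (c y)) = (LBINT x:{s..t}. f x)" if "N \<le> n" for n
    unfolding set_lebesgue_integral_def using N that
    by (intro Bochner_Integration.integral_cong) (auto simp: cutoff_def c_def indicator_def abs_le_iff)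
  then have 2: "(\<lambda>n. 2 * pi * (LBINT y. ?h n y * cnj (c y))) \<longlonglongrightarrow> 2 * pi * (LBINT x:{s..t}. f x)"
    by (intro tendsto_eventually eventually_sequentiallyI[of N]) simp
  have "2 * pi * (LBINT x:{s..t}. f x) = (LBINT \<omega>. G \<omega> * cnj (fourier_integral c \<omega>))"
    by (rule LIMSEQ_unique[OF 2 1])
  also have "\<dots> = cnj (LBINT \<omega>. fourier_integral c \<omega> * cnj (G \<omega>))"
    by (subst Bochner_Integration.integral_cnj[symmetric]) (simp add: mult.commute)
  also have "(LBINT \<omega>. fourier_integral c \<omega> * cnj (G \<omega>)) = 2 * pi * (LBINT x. c x * cnj (inv_fourier G x))"
    using inv_fourier_adjoint[OF \<Omega> G ci] by (simp add: field_simps)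
  also have "cnj (2 * pi * (LBINT x. c x * cnj (inv_fourier G x))) = 2 * pi * (LBINT x. cnj (c x * cnj (inv_fourier G x)))"
    by (subst Bochner_Integration.integral_cnj) simp
  also have "(LBINT x. cnj (c x * cnj (inv_fourier G x))) = (LBINT x:{s..t}. inv_fourier G x)"
    unfolding set_lebesgue_integral_def
    by (intro Bochner_Integration.integral_cong) (auto simp: cutoff_def c_def indicator_def)
  finally show "(LBINT x:{s..t}. f x) = (LBINT x:{s..t}. inv_fourier G x)" by simp
qed

text \<open>
  The inner products of \<open>G\<close> with the transforms of the truncations tend to \<open>\<parallel>G\<parallel>\<^sup>2\<close> and are bounded by
  \<open>\<surd>(2 \<pi>) \<parallel>f\<parallel> \<parallel>G\<parallel>\<close>.
\<close>

lemma spectrum_norm_le: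
  assumes f: "L2_on UNIV f" and fc: "continuous_on UNIV f" and G: "L2_on UNIV G"
    and lim: "fourier_limit f G"
  shows "energy G \<le> 2 * pi * energy f"
proof -
  let ?h = "\<lambda>n. cutoff {- real n..real n} f"
  define g where "g = energy G"
  define a where "a = energy f"
  have hL2: "L2_on UNIV (fourier_integral (?h n))" for n by (rule fourier_cutoff_L2[OF _ fc]) simp
  have g0: "0 \<le> g" "0 \<le> a" by (auto simp: g_def a_def)
  have "(LBINT \<omega>. G \<omega> * cnj (G \<omega>)) = complex_of_real g"
    unfolding g_def integral_complex_of_real[symmetric] complex_norm_square ..
  then have "(\<lambda>n. LBINT \<omega>. fourier_integral (?h n) \<omega> * cnj (G \<omega>)) \<longlonglongrightarrow> complex_of_real g"
    using tendsto_integral_mult_L2[OF hL2 G G lim] by simp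
  then have l: "(\<lambda>n. (cmod (LBINT \<omega>. fourier_integral (?h n) \<omega> * cnj (G \<omega>)))\<^sup>2) \<longlonglongrightarrow> (cmod (complex_of_real g))\<^sup>2"
    by (intro tendsto_power tendsto_norm)
  have "(cmod (LBINT \<omega>. fourier_integral (?h n) \<omega> * cnj (G \<omega>)))\<^sup>2 \<le> 2 * pi * a * g" for n
  proof -
    have "(cmod (LBINT \<omega>. fourier_integral (?h n) \<omega> * cnj (G \<omega>)))\<^sup>2 \<le> energy (fourier_integral (?h n)) * g"
      using L2_mult_integrable(3)[OF hL2 G] by (simp add: g_def)
    also have "energy (fourier_integral (?h n)) = 2 * pi * energy (?h n)"
      by (rule plancherel_cutoff_eq[OF _ fc]) simp
    also have "energy (?h n) \<le> a"
      unfolding a_def by (rule integral_mono[OF cutoff_square_integrable[OF _ fc]])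
        (use f in \<open>auto simp: L2_on_UNIV cutoff_def indicator_def\<close>)
    finally show ?thesis using g0 by (simp add: mult_left_mono mult_right_mono)
  qed
  then have "(cmod (complex_of_real g))\<^sup>2 \<le> 2 * pi * a * g" by (intro LIMSEQ_le_const2[OF l]) auto
  then have "g * g \<le> (2 * pi * a) * g" by (simp add: power2_eq_square)
  then have "g \<le> 2 * pi * a" using g0 by (cases "g = 0") (auto simp: mult_le_cancel_right)
  then show ?thesis by (simp add: g_def a_def)
qed

text \<open>
  Differentiation multiplies the spectrum by \<open>i \<omega>\<close>, which is at most \<open>m\<close> in absolute value on \<open>\<Omega>\<close>. The two inequalities
  between a function and its spectrum, \<open>inv_fourier_L2\<close> and \<open>spectrum_norm_le\<close>, have the constants
  \<open>1 / (2 \<pi>)\<close> and \<open>2 \<pi>\<close>, which cancel.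
\<close>

lemma bandlimited_bernstein:
  assumes \<Omega>: "compact \<Omega>" and f: "f \<in> bandlimited \<Omega>" and m: "\<And>\<omega>. \<omega> \<in> \<Omega> \<Longrightarrow> \<bar>\<omega>\<bar> \<le> m"
  shows "L2_on UNIV (nderiv l f)"
    and "energy (nderiv l f) \<le> m ^ (2 * l) * energy f"
proof -
  obtain G where G: "spectrum_in \<Omega> G"
    "fourier_limit f G"
    using bandlimited_spectrum[OF \<Omega> f] by blast
  have sm: "smooth f" and fL2: "L2_on UNIV f" using f by (auto simp: bandlimited_def)
  have fc: "continuous_on UNIV f" using smooth_continuous_on[OF sm, of UNIV 0] by simp
  let ?Gl = "\<lambda>\<omega>. (\<i> * complex_of_real \<omega>) ^ l * G \<omega>"
  have nd: "nderiv l f = inv_fourier ?Gl"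
    using bandlimited_inversion[OF \<Omega> sm G] nderiv_inv_fourier[OF \<Omega> G(1)] by simp
  note Gl = spectrum_in_power[OF \<Omega> G(1) m, of l]
  show "L2_on UNIV (nderiv l f)" unfolding nd by (rule inv_fourier_L2[OF \<Omega> Gl(1)])
  have mm: "0 \<le> m ^ (2 * l)" by simp
  have "energy (nderiv l f) \<le> 1 / (2 * pi) * energy ?Gl"
    unfolding nd by (rule inv_fourier_L2[OF \<Omega> Gl(1)])
  also have "\<dots> \<le> 1 / (2 * pi) * (m ^ (2 * l) * energy G)"
    by (intro mult_left_mono Gl) auto
  also have "\<dots> \<le> 1 / (2 * pi) * (m ^ (2 * l) * (2 * pi * energy f))"
    using mm by (intro mult_left_mono spectrum_norm_le[OF fL2 fc spectrum_in_L2[OF G(1)] G(2)]) auto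
  also have "\<dots> = m ^ (2 * l) * energy f" by simp
  finally show "energy (nderiv l f) \<le> m ^ (2 * l) * energy f" .
qed

text \<open>
  Up to a reflection and the factor \<open>1 / (2 \<pi>)\<close> the inverse transform is the transform.
\<close>

lemma inv_fourier_cutoff_norm:
  assumes \<Omega>: "compact \<Omega>" and p: "continuous_on UNIV p"
  shows "energy (inv_fourier (cutoff \<Omega> p)) = 1 / (2 * pi) * energy (cutoff \<Omega> p)"
proof -
  have "inv_fourier (cutoff \<Omega> p) x = complex_of_real (1 / (2 * pi)) * fourier_integral (cutoff \<Omega> p) (- x)" for x
    by (simp add: inv_fourier_def fourier_integral_def mult.commute)
  then have "(cmod (inv_fourier (cutoff \<Omega> p) x))\<^sup>2 = (1 / (2 * pi))\<^sup>2 * (cmod (fourier_integral (cutoff \<Omega> p) (- x)))\<^sup>2" for x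
    by (simp only: norm_mult norm_of_real power_mult_distrib power2_abs)
  then have "energy (inv_fourier (cutoff \<Omega> p)) = (1 / (2 * pi))\<^sup>2 * energy (\<lambda>x. fourier_integral (cutoff \<Omega> p) (- x))"
    by (simp only: integral_mult_right_zero)
  also have "energy (\<lambda>x. fourier_integral (cutoff \<Omega> p) (- x)) = 2 * pi * energy (cutoff \<Omega> p)"
    using lborel_integral_real_affine[of "-1" "\<lambda>x. (cmod (fourier_integral (cutoff \<Omega> p) x))\<^sup>2" 0] plancherel_cutoff_eq[OF \<Omega> p] by simp
  finally show ?thesis by (simp add: power2_eq_square)
qed

text \<open>
  The point is that the transforms of the truncations of \<open>F\<close> converge to the prescribed spectrum \<open>G\<close>. Expanding
  the square, the error equals \<open>\<parallel>G\<parallel>\<^sup>2\<close> minus \<open>2 \<pi>\<close> times the energy of \<open>F\<close> on \<open>[-R, R]\<close>, and this tends to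
  \<open>0\<close> by \<open>inv_fourier_cutoff_norm\<close>.
\<close>

lemma inv_fourier_cutoff_bandlimited:
  assumes \<Omega>: "compact \<Omega>" and p: "continuous_on UNIV p"
  shows "inv_fourier (cutoff \<Omega> p) \<in> bandlimited \<Omega>"
proof -
  define G where "G = cutoff \<Omega> p"
  define F where "F = inv_fourier G"
  have G: "spectrum_in \<Omega> G" unfolding G_def by (rule cutoff_spectrum_in[OF \<Omega> p])
  have Fc: "continuous_on UNIV F" unfolding F_def by (rule inv_fourier_continuous[OF \<Omega> G])
  have FL2: "L2_on UNIV F" unfolding F_def by (rule inv_fourier_L2[OF \<Omega> G])
  note GL2 = spectrum_in_L2[OF G]
  define g where "g = energy G"
  define a where "a R = energy (cutoff {- R..R} F)" for R
  have Fn: "energy F = 1 / (2 * pi) * g"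
    unfolding F_def G_def g_def by (rule inv_fourier_cutoff_norm[OF \<Omega> p])
  have err: "(\<integral>\<^sup>+ \<omega>. ennreal ((cmod (G \<omega> - fourier_integral (cutoff {- R..R} F) \<omega>))\<^sup>2) \<partial>lborel) = ennreal (g - 2 * pi * a R)" for R
  proof -
    let ?u = "fourier_integral (cutoff {- R..R} F)"
    have sq: "(cmod (z - w))\<^sup>2 = (cmod z)\<^sup>2 + (cmod w)\<^sup>2 - 2 * Re (w * cnj z)" for z w
      unfolding cmod_power2 by (simp add: power2_eq_square algebra_simps)
    have u: "L2_on UNIV ?u" by (rule fourier_cutoff_L2[OF _ Fc]) simp
    have "(\<integral>\<^sup>+ \<omega>. ennreal ((cmod (G \<omega> - ?u \<omega>))\<^sup>2) \<partial>lborel) = ennreal (energy (\<lambda>\<omega>. G \<omega> - ?u \<omega>))"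
      using L2_diff[OF GL2 u] by (intro nn_integral_eq_integral) (auto simp: L2_on_UNIV)
    also have "energy (\<lambda>\<omega>. G \<omega> - ?u \<omega>) = (LBINT \<omega>. (cmod (G \<omega>))\<^sup>2 + (cmod (?u \<omega>))\<^sup>2 - 2 * Re (?u \<omega> * cnj (G \<omega>)))"
      by (simp only: sq)
    also have "\<dots> = g + energy ?u - 2 * Re (LBINT \<omega>. ?u \<omega> * cnj (G \<omega>))"
    proof -
      have iG: "integrable lborel (\<lambda>\<omega>. (cmod (G \<omega>))\<^sup>2)" and iu: "integrable lborel (\<lambda>\<omega>. (cmod (?u \<omega>))\<^sup>2)"
        using GL2 u by (auto simp: L2_on_UNIV)
      note iuG = L2_mult_integrable(2)[OF u GL2]
      have "(LBINT \<omega>. (cmod (G \<omega>))\<^sup>2 + (cmod (?u \<omega>))\<^sup>2 - 2 * Re (?u \<omega> * cnj (G \<omega>)))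
          = (LBINT \<omega>. (cmod (G \<omega>))\<^sup>2 + (cmod (?u \<omega>))\<^sup>2) - (LBINT \<omega>. 2 * Re (?u \<omega> * cnj (G \<omega>)))"
        by (intro Bochner_Integration.integral_diff Bochner_Integration.integrable_add iG iu integrable_mult_right integrable_Re iuG)
      then show ?thesis
        by (simp only: Bochner_Integration.integral_add[OF iG iu] integral_mult_right_zero integral_Re[OF iuG] g_def)
    qed
    also have "(LBINT \<omega>. ?u \<omega> * cnj (G \<omega>)) = complex_of_real (2 * pi * a R)"
      unfolding F_def a_def by (rule inv_fourier_cutoff_identity[OF \<Omega> G]) simp
    also have "energy ?u = 2 * pi * a R"
      unfolding a_def by (rule plancherel_cutoff_eq[OF _ Fc]) simp
    finally show ?thesis by (simp add: mult.assoc)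
  qed
  have alim: "(a \<longlongrightarrow> energy F) at_top"
    unfolding a_def
  proof (rule integral_dominated_convergence_at_top[where w="\<lambda>x. (cmod (F x))\<^sup>2"])
    show "AE x in lborel. ((\<lambda>R. (cmod (cutoff {- R..R} F x))\<^sup>2) \<longlongrightarrow> (cmod (F x))\<^sup>2) at_top"
    proof (intro AE_I2 tendsto_eventually)
      fix x
      show "\<forall>\<^sub>F R in at_top. (cmod (cutoff {- R..R} F x))\<^sup>2 = (cmod (F x))\<^sup>2"
        using eventually_ge_at_top[of "\<bar>x\<bar>"] by eventually_elim (auto simp: cutoff_def indicator_def)
    qed
    show "(\<lambda>x. (cmod (F x))\<^sup>2) \<in> borel_measurable lborel" "integrable lborel (\<lambda>x. (cmod (F x))\<^sup>2)"
      using FL2 by (auto simp: L2_on_UNIV)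
    show "(\<lambda>x. (cmod (cutoff {- R..R} F x))\<^sup>2) \<in> borel_measurable lborel" for R
      by (rule borel_measurable_integrable[OF cutoff_square_integrable[OF _ Fc]]) simp
    show "\<forall>\<^sub>F R in at_top. AE x in lborel. norm ((cmod (cutoff {- R..R} F x))\<^sup>2) \<le> (cmod (F x))\<^sup>2"
      by (intro always_eventually allI AE_I2) (auto simp: cutoff_def indicator_def)
  qed
  have "((\<lambda>R. g - 2 * pi * a R) \<longlongrightarrow> g - 2 * pi * energy F) at_top"
    by (intro tendsto_intros alim)
  then have "((\<lambda>R. ennreal (g - 2 * pi * a R)) \<longlongrightarrow> ennreal 0) at_top"
    unfolding Fn by (intro tendsto_ennrealI) simp
  then have four: "has_L2_fourier F G"
    unfolding has_L2_fourier_altdef err using FL2 GL2 by simp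
  have "ess_supp G \<subseteq> \<Omega>"
  proof -
    have "open (- \<Omega>) \<and> (AE \<omega> in lborel. \<omega> \<in> - \<Omega> \<longrightarrow> G \<omega> = 0)"
      using \<Omega> G by (auto simp: compact_imp_closed open_Compl spectrum_in_def)
    then show ?thesis unfolding ess_supp_def by blast
  qed
  then show ?thesis
    using four FL2 smooth_inv_fourier[OF \<Omega> G] by (auto simp: bandlimited_def F_def G_def)
qed

lemma bandlimited_inner_inv_fourier:
  assumes \<Omega>: "compact \<Omega>" and f: "f \<in> bandlimited \<Omega>" and H: "spectrum_in \<Omega> H"
    and G: "spectrum_in \<Omega> G"
    "fourier_limit f G"
  shows "L2_inner f (inv_fourier H) = complex_of_real (1 / (2 * pi)) * (LBINT \<omega>. G \<omega> * cnj (H \<omega>))"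
proof -
  have sm: "smooth f" and fL2: "L2_on UNIV f" using f by (auto simp: bandlimited_def)
  have fc: "continuous_on UNIV f" using smooth_continuous_on[OF sm, of UNIV 0] by simp
  let ?F = "inv_fourier H" and ?h = "\<lambda>n. cutoff {- real n..real n} f"
  have FL2: "L2_on UNIV ?F" by (rule inv_fourier_L2[OF \<Omega> H])
  have Fc: "continuous_on UNIV ?F" by (rule inv_fourier_continuous[OF \<Omega> H])
  note fF = L2_mult_integrable(2)[OF fL2 FL2]
  have "(\<lambda>n. LBINT x. ?h n x * cnj (?F x)) \<longlonglongrightarrow> (LBINT x. f x * cnj (?F x))"
  proof (rule integral_dominated_convergence[where w="\<lambda>x. cmod (f x * cnj (?F x))"])
    show "integrable lborel (\<lambda>x. cmod (f x * cnj (?F x)))" by (rule integrable_norm[OF fF])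
    show "(\<lambda>x. f x * cnj (?F x)) \<in> borel_measurable lborel" by (rule borel_measurable_integrable[OF fF])
    show "(\<lambda>x. ?h n x * cnj (?F x)) \<in> borel_measurable lborel" for n
      by (rule borel_measurable_integrable[OF L2_mult_integrable(2)[OF cutoff_L2[OF _ fc] FL2]]) simp
    show "AE x in lborel. norm (?h n x * cnj (?F x)) \<le> cmod (f x * cnj (?F x))" for n
      by (auto simp: cutoff_def indicator_def)
    show "AE x in lborel. (\<lambda>n. ?h n x * cnj (?F x)) \<longlonglongrightarrow> f x * cnj (?F x)"
    proof (intro AE_I2 tendsto_eventually)
      fix x
      obtain N where "\<bar>x\<bar> \<le> real N" using real_arch_simple by blast
      then show "\<forall>\<^sub>F n in sequentially. ?h n x * cnj (?F x) = f x * cnj (?F x)"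
        by (intro eventually_sequentiallyI[of N]) (auto simp: cutoff_def indicator_def abs_le_iff)
    qed
  qed
  moreover have "(LBINT x. ?h n x * cnj (?F x)) = complex_of_real (1 / (2 * pi)) * (LBINT \<omega>. fourier_integral (?h n) \<omega> * cnj (H \<omega>))" for n
    by (rule inv_fourier_adjoint[OF \<Omega> H cutoff_integrable[OF _ fc]]) simp
  moreover have "(\<lambda>n. complex_of_real (1 / (2 * pi)) * (LBINT \<omega>. fourier_integral (?h n) \<omega> * cnj (H \<omega>))) \<longlonglongrightarrow> complex_of_real (1 / (2 * pi)) * (LBINT \<omega>. G \<omega> * cnj (H \<omega>))"
    by (intro tendsto_mult tendsto_const tendsto_integral_mult_L2[OF fourier_cutoff_L2[OF _ fc] spectrum_in_L2[OF G(1)] spectrum_in_L2[OF H] G(2)]) simp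
  ultimately show ?thesis unfolding L2_inner_def by (simp add: LIMSEQ_unique)
qed

section \<open>The sampling atoms\<close>

lemma sampling_atom_eq_inv_fourier:
  assumes \<Omega>: "compact \<Omega>"
  shows "sampling_atom \<Omega> x (n, l) = inv_fourier (cutoff \<Omega> (\<lambda>\<omega>. complex_of_real (sqrt (sampling_weight x n l)) *
    ((\<i> * complex_of_real \<omega>) ^ l * exp (- \<i> * complex_of_real (\<omega> * x n)))))"
proof -
  define p where "p \<omega> = exp (- \<i> * complex_of_real (\<omega> * x n))" for \<omega>
  have p: "continuous_on UNIV p" unfolding p_def by (intro continuous_intros)
  note G = cutoff_spectrum_in[OF \<Omega> p]
  have k: "(\<lambda>s. band_kernel \<Omega> (s - x n)) = inv_fourier (cutoff \<Omega> p)"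
  proof
    fix s
    have "indicator \<Omega> \<omega> *\<^sub>R iexp (\<omega> * (s - x n)) = cutoff \<Omega> p \<omega> * iexp (\<omega> * s)" for \<omega>
      by (simp add: cutoff_def p_def flip: exp_add) (simp add: algebra_simps)
    then show "band_kernel \<Omega> (s - x n) = inv_fourier (cutoff \<Omega> p) s"
      by (simp only: band_kernel_def inv_fourier_def set_lebesgue_integral_def)
  qed
  show ?thesis
  proof
    fix t
    have "sampling_atom \<Omega> x (n, l) t = complex_of_real (sqrt (sampling_weight x n l)) * inv_fourier (\<lambda>\<omega>. (\<i> * complex_of_real \<omega>) ^ l * cutoff \<Omega> p \<omega>) t"
      by (simp add: sampling_atom_def k nderiv_inv_fourier[OF \<Omega> G])
    also have "\<dots> = inv_fourier (\<lambda>\<omega>. complex_of_real (sqrt (sampling_weight x n l)) * ((\<i> * complex_of_real \<omega>) ^ l * cutoff \<Omega> p \<omega>)) t"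
      by (simp add: inv_fourier_def mult.assoc)
    also have "(\<lambda>\<omega>. complex_of_real (sqrt (sampling_weight x n l)) * ((\<i> * complex_of_real \<omega>) ^ l * cutoff \<Omega> p \<omega>))
       = cutoff \<Omega> (\<lambda>\<omega>. complex_of_real (sqrt (sampling_weight x n l)) * ((\<i> * complex_of_real \<omega>) ^ l * exp (- \<i> * complex_of_real (\<omega> * x n))))"
      by (auto simp: cutoff_def p_def fun_eq_iff)
    finally show "sampling_atom \<Omega> x (n, l) t = inv_fourier (cutoff \<Omega> (\<lambda>\<omega>. complex_of_real (sqrt (sampling_weight x n l)) *
    ((\<i> * complex_of_real \<omega>) ^ l * exp (- \<i> * complex_of_real (\<omega> * x n))))) t" .
  qed
qed

lemma sampling_atom_bandlimited:
  assumes \<Omega>: "compact \<Omega>"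
  shows "sampling_atom \<Omega> x (n, l) \<in> bandlimited \<Omega>"
  unfolding sampling_atom_eq_inv_fourier[OF \<Omega>]
  by (intro inv_fourier_cutoff_bandlimited[OF \<Omega>] continuous_intros)

text \<open>
  The spectrum of the atom is \<open>(i \<omega>)\<^sup>l e\<^bsup>-i \<omega> x\<^sub>n\<^esup>\<close> on \<open>\<Omega>\<close>, times the square root of the weight. Its conjugate
  turns the inner product into the inversion formula for \<open>f\<^bsup>(l)\<^esup>(x\<^sub>n)\<close>, up to the factor \<open>(-1)\<^sup>l\<close>.
\<close>

lemma sampling_atom_inner:
  assumes \<Omega>: "compact \<Omega>" and f: "f \<in> bandlimited \<Omega>" and w: "0 \<le> sampling_weight x n l"
  shows "(cmod (L2_inner f (sampling_atom \<Omega> x (n, l))))\<^sup>2 = sampling_weight x n l * (cmod (nderiv l f (x n)))\<^sup>2"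
proof -
  obtain G where G: "spectrum_in \<Omega> G"
    "fourier_limit f G"
    using bandlimited_spectrum[OF \<Omega> f] by blast
  have sm: "smooth f" using f by (auto simp: bandlimited_def)
  let ?w = "complex_of_real (sqrt (sampling_weight x n l))"
  let ?p = "\<lambda>\<omega>. ?w * ((\<i> * complex_of_real \<omega>) ^ l * exp (- \<i> * complex_of_real (\<omega> * x n)))"
  have p: "continuous_on UNIV ?p" by (intro continuous_intros)
  have nd: "nderiv l f (x n) = inv_fourier (\<lambda>\<omega>. (\<i> * complex_of_real \<omega>) ^ l * G \<omega>) (x n)"
    using bandlimited_inversion[OF \<Omega> sm G] nderiv_inv_fourier[OF \<Omega> G(1)] by simp
  have "G \<omega> * cnj (cutoff \<Omega> ?p \<omega>) = (?w * (- 1) ^ l) * ((\<i> * complex_of_real \<omega>) ^ l * G \<omega> * iexp (\<omega> * x n))" for \<omega>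
  proof (cases "\<omega> \<in> \<Omega>")
    case True
    have "cnj ((\<i> * complex_of_real \<omega>) ^ l) = (- 1) ^ l * (\<i> * complex_of_real \<omega>) ^ l"
      by (simp flip: power_mult_distrib)
    then show ?thesis using True by (simp add: cutoff_def exp_cnj)
  qed (use G(1) in \<open>simp add: spectrum_in_def\<close>)
  then have "(LBINT \<omega>. G \<omega> * cnj (cutoff \<Omega> ?p \<omega>)) =
      (?w * (- 1) ^ l) * (LBINT \<omega>. (\<i> * complex_of_real \<omega>) ^ l * G \<omega> * iexp (\<omega> * x n))"
    by (simp only: integral_mult_right_zero)
  then have "L2_inner f (sampling_atom \<Omega> x (n, l)) = (?w * (- 1) ^ l) * nderiv l f (x n)"
    unfolding sampling_atom_eq_inv_fourier[OF \<Omega>] bandlimited_inner_inv_fourier[OF \<Omega> f cutoff_spectrum_in[OF \<Omega> p] G] nd inv_fourier_def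
    by simp
  then show ?thesis using w by (simp add: norm_mult norm_power power_mult_distrib)
qed

section \<open>Voronoi cells of the sampling points\<close>

text \<open>
  The triangle inequality in \<open>L\<^sup>2\<close> in a form that can be summed: \<open>cmod_square_sum_le\<close> is linear in
  the squares, hence survives integration and summation over the cells, and optimising \<open>s\<close> at the very end
  recovers \<open>(a + b)\<^sup>2\<close>.
\<close>

lemma square_sum_leI:
  fixes Z a b :: real
  assumes ab: "0 \<le> a" "0 \<le> b" and Z: "\<And>s. 0 < s \<Longrightarrow> Z \<le> (1 + s) * a\<^sup>2 + (1 + 1 / s) * b\<^sup>2"
  shows "Z \<le> (a + b)\<^sup>2"
proof -
  have "Z \<le> (a + b + 2 * e)\<^sup>2" if e: "0 < e" for e
  proof -
    \<comment> \<open>The optimal \<open>s\<close> is \<open>b / a\<close>; the shift by \<open>e\<close> covers the cases where \<open>a\<close> or \<open>b\<close> is zero.\<close>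
    define p r where "p = a + e" and "r = b + e"
    have pr: "0 < p" "0 < r" using ab e by (auto simp: p_def r_def)
    have "Z \<le> (1 + r / p) * a\<^sup>2 + (1 + 1 / (r / p)) * b\<^sup>2" using pr by (intro Z) auto
    also have "\<dots> \<le> (1 + r / p) * p\<^sup>2 + (1 + 1 / (r / p)) * r\<^sup>2"
      using pr ab e by (intro add_mono mult_left_mono power_mono) (auto simp: p_def r_def)
    also have "\<dots> = (p + r)\<^sup>2" using pr by (simp add: field_simps power2_eq_square)
    also have "p + r = a + b + 2 * e" by (simp add: p_def r_def)
    finally show ?thesis .
  qed
  moreover have "((\<lambda>e. (a + b + 2 * e)\<^sup>2) \<longlongrightarrow> (a + b + 2 * 0)\<^sup>2) (at_right 0)"
    by (intro tendsto_intros)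
  ultimately have "Z \<le> (a + b + 2 * 0)\<^sup>2"
    by (intro tendsto_lowerbound[where F="at_right 0"]) (auto simp: eventually_at_right_field intro!: exI[of _ 1])
  then show ?thesis by simp
qed

lemma cmod_square_sum_le:
  assumes "0 < s"
  shows "(cmod z)\<^sup>2 \<le> (1 + s) * (cmod w)\<^sup>2 + (1 + 1 / s) * (cmod (z - w))\<^sup>2"
proof -
  let ?a = "cmod w" and ?b = "cmod (z - w)"
  have "cmod z \<le> ?a + ?b" using norm_triangle_ineq[of w "z - w"] by simp
  then have "(cmod z)\<^sup>2 \<le> (?a + ?b)\<^sup>2" by (intro power_mono) auto
  also have "\<dots> \<le> (1 + s) * ?a\<^sup>2 + (1 + 1 / s) * ?b\<^sup>2"
  proof -
    have "0 \<le> (s * ?a - ?b)\<^sup>2 / s" using assms by simp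
    also have "(s * ?a - ?b)\<^sup>2 / s = s * ?a\<^sup>2 - 2 * ?a * ?b + ?b\<^sup>2 / s"
      using assms by (simp add: power2_eq_square field_simps)
    finally show ?thesis by (simp add: power2_eq_square algebra_simps)
  qed
  finally show ?thesis .
qed

lemma set_integral_Icc_split:
  fixes u :: "real \<Rightarrow> real"
  assumes "a \<le> b" "b \<le> c" and u: "set_integrable lborel {a..c} u"
  shows "(LBINT t:{a..c}. u t) = (LBINT t:{a..b}. u t) + (LBINT t:{b..c}. u t)"
proof -
  have "{a..c} = {a..b} \<union> {b<..c}" using assms by auto
  then have "(LBINT t:{a..c}. u t) = (LBINT t:{a..b}. u t) + (LBINT t:{b<..c}. u t)"
    using assms by (auto intro!: set_integral_Un set_integrable_subset[OF u])
  also have "(LBINT t:{b<..c}. u t) = (LBINT t:{b..c}. u t)"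
    by (rule set_integral_discrete_difference[where X="{b}"]) auto
  finally show ?thesis .
qed

locale sampling_points =
  fixes x :: "int \<Rightarrow> real"
  assumes x_less: "\<And>n. x n < x (n + 1)" and gap_finite: "max_gap x < \<top>"
begin

abbreviation z :: "int \<Rightarrow> real" where "z \<equiv> midpt x"

definition \<delta> :: real where "\<delta> = enn2real (max_gap x)"

lemma max_gap_eq: "max_gap x = ennreal \<delta>"
  using gap_finite by (simp add: \<delta>_def)

lemma \<delta>_nonneg: "0 \<le> \<delta>" by (simp add: \<delta>_def)

text \<open>
  A point at distance at least \<open>r\<close> from all sampling points is a witness for the supremum that
  defines the gap.
\<close>

lemma gap_geI:
  assumes "\<And>n. r \<le> \<bar>t - x n\<bar>"
  shows "r \<le> \<delta>"
proof -
  have "ennreal r \<le> (INF n. ennreal \<bar>t - x n\<bar>)" by (intro INF_greatest ennreal_leI assms)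
  also have "\<dots> \<le> max_gap x" unfolding max_gap_def by (rule SUP_upper) simp
  finally show ?thesis using \<delta>_nonneg by (simp add: max_gap_eq ennreal_le_iff)
qed

lemma x_strict_mono: "m < n \<Longrightarrow> x m < x n"
proof (induction n rule: int_gr_induct)
  case base then show ?case by (rule x_less)
next
  case (step i) then show ?case using x_less[of i] by simp
qed

lemma x_mono: "m \<le> n \<Longrightarrow> x m \<le> x n"
  using x_strict_mono[of m n] by (cases "m = n") auto

lemma half_gap_le: "(x (n + 1) - x n) / 2 \<le> \<delta>"
proof (rule gap_geI[of _ "(x n + x (n + 1)) / 2"])
  fix k
  have "x k \<le> x n \<or> x (n + 1) \<le> x k" using x_mono[of k n] x_mono[of "n + 1" k] by linarith
  then show "(x (n + 1) - x n) / 2 \<le> \<bar>(x n + x (n + 1)) / 2 - x k\<bar>"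
    using x_less[of n] by (auto simp: abs_if field_simps)
qed

lemma z_bounds: "z n < x n" "x n < z (n + 1)" "x n - z n \<le> \<delta>" "z (n + 1) - x n \<le> \<delta>"
  using x_less[of n] x_less[of "n - 1"] half_gap_le[of n] half_gap_le[of "n - 1"]
  by (auto simp: midpt_def field_simps)

lemma voronoi_eq: "voronoi x n = {z n..z (n + 1)}" by (simp add: voronoi_def)

lemma z_mono: "m \<le> n \<Longrightarrow> z m \<le> z n"
  using x_mono[of m n] x_mono[of "m - 1" "n - 1"] by (simp add: midpt_def)

text \<open>
  Otherwise points far beyond the last sampling point would violate the finiteness of the gap.
\<close>

lemma x_unbounded: "\<exists>n. r \<le> x n" "\<exists>n. x n \<le> r"
proof -
  show "\<exists>n. r \<le> x n"
  proof (rule ccontr)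
    assume "\<not> ?thesis"
    then have lt: "x n < r" for n by (simp add: not_le)
    have "\<delta> + 1 \<le> \<bar>r + \<delta> + 1 - x n\<bar>" for n
      using lt[of n] abs_ge_self[of "r + \<delta> + 1 - x n"] by linarith
    then show False using gap_geI[of "\<delta> + 1" "r + \<delta> + 1"] by simp
  qed
  show "\<exists>n. x n \<le> r"
  proof (rule ccontr)
    assume "\<not> ?thesis"
    then have lt: "r < x n" for n by (simp add: not_le)
    have "\<delta> + 1 \<le> \<bar>r - \<delta> - 1 - x n\<bar>" for n
      using lt[of n] abs_ge_minus_self[of "r - \<delta> - 1 - x n"] by linarith
    then show False using gap_geI[of "\<delta> + 1" "r - \<delta> - 1"] by simp
  qed
qed

lemma z_covers: "(\<Union>k. {z (- int k)..z (int k)}) = UNIV"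
proof -
  have "\<exists>k. z (- int k) \<le> t \<and> t \<le> z (int k)" for t
  proof -
    obtain m n where mn: "x m \<le> t" "t \<le> x n" using x_unbounded by blast
    define k where "k = nat (max \<bar>m\<bar> \<bar>n + 1\<bar>)"
    have "- int k \<le> m" "n + 1 \<le> int k" by (auto simp: k_def max_def)
    then have "z (- int k) \<le> z m" "z (n + 1) \<le> z (int k)" by (auto intro: z_mono)
    then show ?thesis using mn z_bounds(1)[of m] z_bounds(2)[of n] by (intro exI[of _ k]) auto
  qed
  then show ?thesis by auto
qed

lemma voronoi_partial_sum:
  assumes u: "integrable lborel u"
  shows "(\<Sum>n\<in>{a..<a + int k}. LBINT t:voronoi x n. u t) = (LBINT t:{z a..z (a + int k)}. (u t :: real))"
proof (induction k)
  case 0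
  have "(LBINT t:{z a}. u t) = (LBINT t:{}. u t)"
    by (rule set_integral_discrete_difference[where X="{z a}"]) auto
  then show ?case by (simp add: set_lebesgue_integral_def)
next
  case (Suc k)
  have "{a..<a + int (Suc k)} = insert (a + int k) {a..<a + int k}" by auto
  then have "(\<Sum>n\<in>{a..<a + int (Suc k)}. LBINT t:voronoi x n. u t) = (LBINT t:voronoi x (a + int k). u t) + (LBINT t:{z a..z (a + int k)}. u t)"
    using Suc by simp
  also have "\<dots> = (LBINT t:{z a..z (a + int k + 1)}. u t)"
  proof -
    have "set_integrable lborel {z a..z (a + int k + 1)} u"
      unfolding set_integrable_def using u by (intro integrable_mult_indicator) auto
    then have "(LBINT t:{z a..z (a + int k + 1)}. u t) = (LBINT t:{z a..z (a + int k)}. u t) + (LBINT t:{z (a + int k)..z (a + int k + 1)}. u t)"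
      by (intro set_integral_Icc_split z_mono) auto
    then show ?thesis by (simp add: voronoi_eq)
  qed
  finally show ?case by (simp add: algebra_simps)
qed

text \<open>
  Finitely many cells make up an interval, up to common endpoints, and these intervals exhaust the line.
\<close>

lemma voronoi_has_sum:
  assumes u: "integrable lborel u" and nn: "\<And>t. 0 \<le> u t"
  shows "((\<lambda>n. LBINT t:voronoi x n. u t) has_sum (LBINT t. (u t :: real))) UNIV"
proof -
  let ?v = "\<lambda>n. LBINT t:voronoi x n. u t"
  have v0: "0 \<le> ?v n" for n using nn by (simp add: set_lebesgue_integral_def)
  have sI: "set_integrable lborel S u" if "S \<in> sets borel" for S
    unfolding set_integrable_def using u that by (intro integrable_mult_indicator) auto
  have le: "(LBINT t:S. u t) \<le> (LBINT t. u t)" if "S \<in> sets borel" for S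
    unfolding set_lebesgue_integral_def
    by (rule integral_mono) (use u sI[OF that] nn in \<open>auto simp: set_integrable_def indicator_def\<close>)
  have fin: "sum ?v F \<le> (LBINT t. u t)" if F: "finite F" for F
  proof -
    obtain N where N: "F \<subseteq> {- int N..<- int N + int (2 * N)}"
    proof -
      obtain M where "\<forall>n\<in>F. \<bar>n\<bar> \<le> M" using F by (metis finite_imageI Max_ge imageI finite_nat_set_iff_bounded_le)
      then have "F \<subseteq> {- int (nat (\<bar>M\<bar> + 1))..<- int (nat (\<bar>M\<bar> + 1)) + int (2 * nat (\<bar>M\<bar> + 1))}" by fastforce
      then show thesis using that by blast
    qed
    have "sum ?v F \<le> sum ?v {- int N..<- int N + int (2 * N)}" by (rule sum_mono2) (use N v0 in auto)
    also have "\<dots> \<le> (LBINT t. u t)" unfolding voronoi_partial_sum[OF u] by (rule le) simp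
    finally show ?thesis .
  qed
  have sm: "?v summable_on UNIV"
    by (rule nonneg_bdd_above_summable_on) (use v0 fin in \<open>auto intro!: bdd_aboveI2\<close>)
  have "infsum ?v UNIV \<le> (LBINT t. u t)" by (rule infsum_le_finite_sums[OF sm]) (use fin in auto)
  moreover have "(LBINT t. u t) \<le> infsum ?v UNIV"
  proof (rule LIMSEQ_le_const2)
    have "(\<lambda>k. LBINT t:{z (- int k)..z (int k)}. u t) \<longlonglongrightarrow> (LBINT t:(\<Union>k. {z (- int k)..z (int k)}). u t)"
    proof (rule set_integral_cont_up)
      show "incseq (\<lambda>k. {z (- int k)..z (int k)})"
        unfolding incseq_def using z_mono by (meson atLeastatMost_subset_iff int_ops(1) neg_le_iff_le of_nat_mono)
    qed (use sI in auto)
    then show "(\<lambda>k. LBINT t:{z (- int k)..z (int k)}. u t) \<longlonglongrightarrow> (LBINT t. u t)"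
      by (simp add: z_covers set_lebesgue_integral_def)
    have "(LBINT t:{z (- int k)..z (int k)}. u t) \<le> infsum ?v UNIV" for k
      using voronoi_partial_sum[OF u, of "- int k" "2 * k"] finite_sum_le_infsum[OF sm, of "{- int k..<- int k + int (2 * k)}"] v0
      by simp
    then show "\<exists>N. \<forall>k\<ge>N. (LBINT t:{z (- int k)..z (int k)}. u t) \<le> infsum ?v UNIV" by blast
  qed
  ultimately show ?thesis using sm by (simp add: has_sum_iff)
qed

lemma voronoi_sum_le:
  assumes u: "integrable lborel u" "\<And>t. 0 \<le> u t"
    and S: "\<And>n. 0 \<le> S n" "\<And>n. S n \<le> (LBINT t:voronoi x n. u t)"
  shows "S summable_on UNIV" "infsum S UNIV \<le> (LBINT t. (u t :: real))"
proof -
  note h = voronoi_has_sum[OF u]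
  show sm: "S summable_on UNIV"
    by (rule summable_on_comparison_test[OF has_sum_imp_summable[OF h]]) (use S in auto)
  have "infsum S UNIV \<le> (\<Sum>\<^sub>\<infinity>n. LBINT t:voronoi x n. u t)"
    by (rule infsum_mono[OF sm has_sum_imp_summable[OF h]]) (use S in auto)
  then show "infsum S UNIV \<le> (LBINT t. u t)" using infsumI[OF h] by simp
qed

lemma smooth_set_integrable:
  "smooth f \<Longrightarrow> smooth g \<Longrightarrow> set_integrable lborel {a..b} (\<lambda>t. (cmod (nderiv l f t - nderiv j g t))\<^sup>2)"
  "smooth f \<Longrightarrow> set_integrable lborel {a..b} (\<lambda>t. (cmod (nderiv l f t))\<^sup>2)"
  "smooth f \<Longrightarrow> set_integrable lborel {a..b} (\<lambda>t. (cmod (nderiv l f t - c))\<^sup>2)"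
  by (intro borel_integrable_atLeastAtMost' continuous_intros smooth_continuous_on; assumption)+

text \<open>
  Both local inequalities are for functions with zeros at an endpoint, whereas \<open>x n\<close> lies in the interior of
  its cell.
\<close>

lemma voronoi_le_of_half_cells:
  fixes u v :: "real \<Rightarrow> real"
  assumes half: "\<And>a b. a < b \<Longrightarrow> b - a \<le> \<delta> \<Longrightarrow> x n = a \<or> x n = b \<Longrightarrow> (LBINT t:{a..b}. u t) \<le> C * (LBINT t:{a..b}. v t)"
    and u: "\<And>a b. set_integrable lborel {a..b} u" and v: "\<And>a b. set_integrable lborel {a..b} v"
  shows "(LBINT t:voronoi x n. u t) \<le> C * (LBINT t:voronoi x n. v t)"
proof -
  have split: "(LBINT t:voronoi x n. w t) = (LBINT t:{z n..x n}. w t) + (LBINT t:{x n..z (n + 1)}. w t)"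
    if "set_integrable lborel {z n..z (n + 1)} w" for w :: "real \<Rightarrow> real"
    unfolding voronoi_eq using z_bounds[of n] by (intro set_integral_Icc_split that) auto
  show ?thesis
    unfolding split[OF u] split[OF v] distrib_left using z_bounds[of n] by (intro add_mono half) auto
qed

lemma voronoi_wirtinger:
  assumes f: "smooth f"
  shows "energy_on (voronoi x n) (\<lambda>t. nderiv l f t - nderiv l f (x n))
    \<le> (2 * \<delta> / pi)\<^sup>2 * energy_on (voronoi x n) (nderiv (Suc l) f)"
proof -
  let ?g = "\<lambda>t. nderiv l f t - nderiv l f (x n)" and ?g' = "nderiv (Suc l) f"
  have d: "(?g has_vector_derivative ?g' t) (at t)" for t
    using has_vector_derivative_diff[OF smooth_has_vector_derivative[OF f] has_vector_derivative_const] by simp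
  have half: "energy_on {a..b} ?g \<le> (2 * \<delta> / pi)\<^sup>2 * energy_on {a..b} ?g'"
    if ab: "a < b" "b - a \<le> \<delta>" "x n = a \<or> x n = b" for a b
  proof -
    have "energy_on {a..b} ?g \<le> (2 * (b - a) / pi)\<^sup>2 * energy_on {a..b} ?g'"
      by (rule wirtinger_inequality[OF ab(1) d smooth_continuous_on[OF f]]) (use ab in auto)
    also have "\<dots> \<le> (2 * \<delta> / pi)\<^sup>2 * energy_on {a..b} ?g'"
      using ab by (intro mult_right_mono power_mono divide_right_mono) (auto simp: set_lebesgue_integral_def)
    finally show ?thesis .
  qed
  show ?thesis
    by (rule voronoi_le_of_half_cells[OF half smooth_set_integrable(3)[OF f] smooth_set_integrable(2)[OF f]])
qed

lemma voronoi_poincare: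
  fixes n :: int and k :: nat
  assumes f: "smooth f"
  defines "T \<equiv> taylor_poly (\<lambda>i. nderiv i f (x n)) (Suc k) (x n)"
  shows "energy_on (voronoi x n) (\<lambda>t. f t - T t)
    \<le> (poincare_const (Suc k) * \<delta>) ^ (2 * Suc k) * energy_on (voronoi x n) (nderiv (Suc k) f)"
proof -
  let ?r = "\<lambda>t. f t - T t" and ?c = "poincare_const (Suc k)"
  have T: "smooth T" unfolding T_def by (rule smooth_taylor_poly)
  have r: "smooth ?r" by (rule smooth_diff[OF f T])
  have van: "nderiv i ?r (x n) = 0" if "i < Suc k" for i
    using that by (simp only: nderiv_diff[OF f T]) (simp add: T_def nderiv_taylor_poly taylor_poly_at_center)
  have top: "nderiv (Suc k) ?r = nderiv (Suc k) f"
    by (simp only: nderiv_diff[OF f T]) (simp add: T_def nderiv_taylor_poly taylor_poly_def)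
  have c0: "0 < ?c" by (rule poincare_const_pos) simp
  have half: "energy_on {a..b} ?r \<le> (?c * \<delta>) ^ (2 * Suc k) * energy_on {a..b} (nderiv (Suc k) f)"
    if ab: "a < b" "b - a \<le> \<delta>" "x n = a \<or> x n = b" for a b
  proof -
    have "energy_on {a..b} ?r \<le> (?c * (b - a)) ^ (2 * Suc k) * energy_on {a..b} (nderiv (Suc k) ?r)"
      by (rule poincare_smooth[OF r _ ab(1,3) van]) auto
    also have "\<dots> \<le> (?c * \<delta>) ^ (2 * Suc k) * energy_on {a..b} (nderiv (Suc k) f)"
      unfolding top using ab c0 by (intro mult_right_mono power_mono mult_left_mono) (auto simp: set_lebesgue_integral_def)
    finally show ?thesis .
  qed
  show ?thesis
    by (rule voronoi_le_of_half_cells[OF half smooth_set_integrable(1)[OF f T, of _ _ 0 0, simplified] smooth_set_integrable(2)[OF f]])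
qed

lemma sampling_weight_nonneg: "0 \<le> sampling_weight x n l"
  by (simp add: sampling_weight_def set_lebesgue_integral_def)

lemma sampling_weight_le: "sampling_weight x n l \<le> \<delta> ^ (2 * l) / fact l * (z (n + 1) - z n)"
proof -
  have "(LBINT t:voronoi x n. (t - x n) ^ (2 * l)) \<le> (LBINT t:voronoi x n. \<delta> ^ (2 * l))"
  proof (rule set_integral_mono)
    fix t assume "t \<in> voronoi x n"
    then have "\<bar>t - x n\<bar> \<le> \<delta>" using z_bounds[of n] by (auto simp: voronoi_eq abs_le_iff)
    then have "\<bar>t - x n\<bar> ^ (2 * l) \<le> \<delta> ^ (2 * l)" by (intro power_mono) auto
    then show "(t - x n) ^ (2 * l) \<le> \<delta> ^ (2 * l)" by (simp add: power_even_abs)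
  qed (auto simp: voronoi_eq intro!: borel_integrable_atLeastAtMost' continuous_intros)
  also have "\<dots> = (z (n + 1) - z n) * \<delta> ^ (2 * l)"
    unfolding voronoi_eq using z_bounds[of n] by (subst set_integral_const) auto
  finally show ?thesis unfolding sampling_weight_def
    by (simp add: field_simps)
qed

text \<open>
  Cauchy-Schwarz after splitting \<open>1 / l!\<close> into two square roots; one of the sums is at most \<open>e\<close>, the other one
  integrates to the weights.
\<close>

lemma taylor_poly_voronoi_le:
  "energy_on (voronoi x n) (taylor_poly c (Suc k) (x n))
    \<le> exp 1 * (\<Sum>l\<le>k. sampling_weight x n l * (cmod (c l))\<^sup>2)"
proof -
  have pt: "(cmod (taylor_poly c (Suc k) (x n) t))\<^sup>2 \<le> exp 1 * (\<Sum>l\<le>k. 1 / fact l * (cmod (c l))\<^sup>2 * (t - x n) ^ (2 * l))" for t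
  proof -
    let ?y = "t - x n"
    have "cmod (taylor_poly c (Suc k) (x n) t) \<le> (\<Sum>l\<le>k. cmod (c l * complex_of_real (?y ^ l / fact l)))"
      unfolding taylor_poly_def lessThan_Suc_atMost by (rule norm_sum)
    also have "\<dots> = (\<Sum>l\<le>k. sqrt (1 / fact l) * (sqrt (1 / fact l) * (cmod (c l) * \<bar>?y\<bar> ^ l)))"
    proof (intro sum.cong refl)
      fix l
      have "sqrt (1 / fact l) * sqrt (1 / fact l) = (1 / fact l :: real)" by simp
      then have "sqrt (1 / fact l) * (sqrt (1 / fact l) * (cmod (c l) * \<bar>?y\<bar> ^ l)) = 1 / fact l * (cmod (c l) * \<bar>?y\<bar> ^ l)"
        by (simp only: mult.assoc[symmetric])
      then show "cmod (c l * complex_of_real (?y ^ l / fact l)) = sqrt (1 / fact l) * (sqrt (1 / fact l) * (cmod (c l) * \<bar>?y\<bar> ^ l))"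
        unfolding norm_mult norm_of_real by (simp add: power_abs)
    qed
    finally have "(cmod (taylor_poly c (Suc k) (x n) t))\<^sup>2 \<le> (\<Sum>l\<le>k. sqrt (1 / fact l) * (sqrt (1 / fact l) * (cmod (c l) * \<bar>?y\<bar> ^ l)))\<^sup>2"
      by (intro power_mono) auto
    also have "\<dots> \<le> (\<Sum>l\<le>k. (sqrt (1 / fact l))\<^sup>2) * (\<Sum>l\<le>k. (sqrt (1 / fact l) * (cmod (c l) * \<bar>?y\<bar> ^ l))\<^sup>2)"
      by (rule Cauchy_Schwarz_ineq_sum)
    also have "(\<Sum>l\<le>k. (sqrt (1 / fact l))\<^sup>2) = (\<Sum>l\<le>k. 1 / fact l :: real)" by simp
    also have "(\<Sum>l\<le>k. (sqrt (1 / fact l) * (cmod (c l) * \<bar>?y\<bar> ^ l))\<^sup>2) = (\<Sum>l\<le>k. 1 / fact l * (cmod (c l))\<^sup>2 * ?y ^ (2 * l))"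
      by (intro sum.cong refl) (simp add: power_mult_distrib power_mult[symmetric] mult.commute[of _ 2] power_even_abs)
    also have "(\<Sum>l\<le>k. 1 / fact l) * (\<Sum>l\<le>k. 1 / fact l * (cmod (c l))\<^sup>2 * ?y ^ (2 * l)) \<le> exp 1 * (\<Sum>l\<le>k. 1 / fact l * (cmod (c l))\<^sup>2 * ?y ^ (2 * l))"
    proof (rule mult_right_mono)
      have "(\<Sum>l\<le>k. 1 / fact l) \<le> (\<Sum>l. (1::real) ^ l /\<^sub>R fact l)"
        using sum_le_suminf[OF summable_exp_generic[of "1::real"], of "{..k}"] by (simp add: divide_inverse)
      then show "(\<Sum>l\<le>k. 1 / fact l) \<le> exp (1::real)" by (simp add: exp_def)
    qed (auto intro!: sum_nonneg)
    finally show ?thesis .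
  qed
  have "energy_on (voronoi x n) (taylor_poly c (Suc k) (x n))
     \<le> (LBINT t:voronoi x n. exp 1 * (\<Sum>l\<le>k. 1 / fact l * (cmod (c l))\<^sup>2 * (t - x n) ^ (2 * l)))"
    by (rule set_integral_mono)
       (use pt in \<open>auto simp: voronoi_eq taylor_poly_def intro!: borel_integrable_atLeastAtMost' continuous_intros\<close>)
  also have "\<dots> = exp 1 * (\<Sum>l\<le>k. LBINT t:voronoi x n. 1 / fact l * (cmod (c l))\<^sup>2 * (t - x n) ^ (2 * l))"
  proof -
    have "set_integrable lborel (voronoi x n) (\<lambda>t. 1 / fact l * (cmod (c l))\<^sup>2 * (t - x n) ^ (2 * l))" for l
      unfolding voronoi_eq by (intro borel_integrable_atLeastAtMost' continuous_intros)
    then have "(LBINT t:voronoi x n. \<Sum>l\<le>k. 1 / fact l * (cmod (c l))\<^sup>2 * (t - x n) ^ (2 * l))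
        = (\<Sum>l\<le>k. LBINT t:voronoi x n. 1 / fact l * (cmod (c l))\<^sup>2 * (t - x n) ^ (2 * l))"
      unfolding set_lebesgue_integral_def set_integrable_def scaleR_sum_right
      by (intro Bochner_Integration.integral_sum) blast
    then show ?thesis by (simp only: set_integral_mult_right)
  qed
  also have "(\<Sum>l\<le>k. LBINT t:voronoi x n. 1 / fact l * (cmod (c l))\<^sup>2 * (t - x n) ^ (2 * l)) = (\<Sum>l\<le>k. sampling_weight x n l * (cmod (c l))\<^sup>2)"
    by (intro sum.cong refl) (simp add: sampling_weight_def)
  finally show ?thesis .
qed
end

section \<open>The frame bounds\<close>

context sampling_points
begin

text \<open>
  \<open>P n\<close> is the energy on the cell of the constant \<open>f\<^bsup>(l)\<^esup>(x\<^sub>n)\<close>. The function \<open>u s\<close> dominates it after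
  Wirtinger's inequality on the cell, for every value of the parameter \<open>s\<close> of \<open>square_sum_leI\<close>.
\<close>

lemma derivative_samples_upper:
  assumes \<Omega>: "compact \<Omega>" and f: "f \<in> bandlimited \<Omega>"
    and m: "\<And>\<omega>. \<omega> \<in> \<Omega> \<Longrightarrow> \<bar>\<omega>\<bar> \<le> m" and m0: "0 \<le> m"
  defines "S \<equiv> \<lambda>l n. sampling_weight x n l * (cmod (nderiv l f (x n)))\<^sup>2"
  shows "S l summable_on UNIV"
    and "infsum (S l) UNIV \<le> (\<delta> * m) ^ (2 * l) / fact l * ((1 + 2 * \<delta> * m / pi)\<^sup>2 * (L2_norm f)\<^sup>2)"
proof -
  define X where "X = energy f"
  have X0: "0 \<le> X" by (simp add: X_def)
  have sm: "smooth f" using f by (simp add: bandlimited_def)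
  have X_le: "energy (nderiv j f) \<le> m ^ (2 * j) * X" for j
    unfolding X_def by (rule bandlimited_bernstein(2)[OF \<Omega> f m])
  have Xi: "integrable lborel (\<lambda>t. (cmod (nderiv j f t))\<^sup>2)" for j
    using bandlimited_bernstein(1)[OF \<Omega> f m] by (simp add: L2_on_UNIV)
  define P where "P n = (z (n + 1) - z n) * (cmod (nderiv l f (x n)))\<^sup>2" for n
  have P0: "0 \<le> P n" for n using z_bounds[of n] by (simp add: P_def)
  define w where "w = (2 * \<delta> / pi)\<^sup>2"
  have w0: "0 \<le> w" by (simp add: w_def)
  define u where "u s t = (1 + s) * (cmod (nderiv l f t))\<^sup>2 + (1 + 1 / s) * (w * (cmod (nderiv (Suc l) f t))\<^sup>2)" for s t
  have ui: "integrable lborel (u s)" for s unfolding u_def using Xi by simp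
  have Pu: "P n \<le> (LBINT t:voronoi x n. u s t)" if s: "0 < s" for s n
  proof -
    have "P n = energy_on (voronoi x n) (\<lambda>t. nderiv l f (x n))"
      unfolding voronoi_eq P_def using z_bounds[of n] by (subst set_integral_const) auto
    also have "\<dots> \<le> (LBINT t:voronoi x n. (1 + s) * (cmod (nderiv l f t))\<^sup>2 + (1 + 1 / s) * (cmod (nderiv l f t - nderiv l f (x n)))\<^sup>2)"
    proof (rule set_integral_mono)
      show "set_integrable lborel (voronoi x n) (\<lambda>t. (cmod (nderiv l f (x n)))\<^sup>2)"
        unfolding voronoi_eq by (intro borel_integrable_atLeastAtMost' continuous_intros)
      show "set_integrable lborel (voronoi x n) (\<lambda>t. (1 + s) * (cmod (nderiv l f t))\<^sup>2 + (1 + 1 / s) * (cmod (nderiv l f t - nderiv l f (x n)))\<^sup>2)"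
        unfolding voronoi_eq by (intro borel_integrable_atLeastAtMost' continuous_intros smooth_continuous_on[OF sm])
      show "(cmod (nderiv l f (x n)))\<^sup>2 \<le> (1 + s) * (cmod (nderiv l f t))\<^sup>2 + (1 + 1 / s) * (cmod (nderiv l f t - nderiv l f (x n)))\<^sup>2" for t
        using cmod_square_sum_le[OF s, of "nderiv l f (x n)" "nderiv l f t"] by (simp add: norm_minus_commute)
    qed
    also have "\<dots> = (1 + s) * energy_on (voronoi x n) (nderiv l f) + (1 + 1 / s) * energy_on (voronoi x n) (\<lambda>t. nderiv l f t - nderiv l f (x n))"
      unfolding voronoi_eq using smooth_set_integrable(2,3)[OF sm] by simp
    also have "\<dots> \<le> (1 + s) * energy_on (voronoi x n) (nderiv l f) + (1 + 1 / s) * (w * energy_on (voronoi x n) (nderiv (Suc l) f))"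
      using voronoi_wirtinger[OF sm, of n l] s unfolding w_def by (intro add_left_mono mult_left_mono) auto
    also have "\<dots> = (LBINT t:voronoi x n. u s t)"
      unfolding voronoi_eq u_def using smooth_set_integrable(2)[OF sm] by simp
    finally show ?thesis .
  qed
  have u0: "0 \<le> u s t" if "0 < s" for s t using that w0 by (simp add: u_def)
  have Ps: "P summable_on UNIV" using voronoi_sum_le(1)[OF ui u0 P0 Pu, of 1] by simp
  have "infsum P UNIV \<le> (m ^ l * sqrt X + (2 * \<delta> / pi) * (m ^ Suc l * sqrt X))\<^sup>2"
  proof (rule square_sum_leI)
    fix s :: real assume s: "0 < s"
    have "infsum P UNIV \<le> (LBINT t. u s t)" by (rule voronoi_sum_le(2)[OF ui u0[OF s] P0 Pu[OF s]])
    also have "\<dots> = (1 + s) * energy (nderiv l f) + (1 + 1 / s) * (w * energy (nderiv (Suc l) f))"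
      unfolding u_def using Xi by simp
    also have "\<dots> \<le> (1 + s) * (m ^ (2 * l) * X) + (1 + 1 / s) * (w * (m ^ (2 * Suc l) * X))"
      using s w0 by (intro add_mono mult_left_mono X_le) auto
    also have "m ^ (2 * l) * X = (m ^ l * sqrt X)\<^sup>2"
      using X0 by (simp add: power_mult_distrib power_mult[symmetric] mult.commute)
    also have "w * (m ^ (2 * Suc l) * X) = ((2 * \<delta> / pi) * (m ^ Suc l * sqrt X))\<^sup>2"
      using X0 unfolding w_def power_mult_distrib by (simp add: power_mult[symmetric] mult.commute power_mult_distrib del: power_Suc)
    finally show "infsum P UNIV \<le> (1 + s) * (m ^ l * sqrt X)\<^sup>2 + (1 + 1 / s) * ((2 * \<delta> / pi) * (m ^ Suc l * sqrt X))\<^sup>2" .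
  qed (use m0 X0 \<delta>_nonneg in auto)
  also have "\<dots> = ((1 + 2 * \<delta> * m / pi) * (m ^ l * sqrt X))\<^sup>2" by (simp add: algebra_simps)
  also have "\<dots> = m ^ (2 * l) * ((1 + 2 * \<delta> * m / pi)\<^sup>2 * X)"
    using X0 by (simp add: power_mult_distrib power_mult[symmetric] mult_ac)
  finally have P_le: "infsum P UNIV \<le> m ^ (2 * l) * ((1 + 2 * \<delta> * m / pi)\<^sup>2 * X)" .
  have c0: "0 \<le> \<delta> ^ (2 * l) / fact l" using \<delta>_nonneg by simp
  have SP: "S l n \<le> \<delta> ^ (2 * l) / fact l * P n" for n
    using mult_right_mono[OF sampling_weight_le[of n l], of "(cmod (nderiv l f (x n)))\<^sup>2"] by (simp add: S_def P_def mult_ac)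
  have S0: "0 \<le> S l n" for n by (simp add: S_def sampling_weight_nonneg)
  have cPs: "(\<lambda>n. \<delta> ^ (2 * l) / fact l * P n) summable_on UNIV" by (rule summable_on_cmult_right[OF Ps])
  show Ss: "S l summable_on UNIV" by (rule summable_on_comparison_test[OF cPs SP S0])
  have "infsum (S l) UNIV \<le> (\<Sum>\<^sub>\<infinity>n. \<delta> ^ (2 * l) / fact l * P n)" by (rule infsum_mono[OF Ss cPs SP])
  also have "\<dots> = \<delta> ^ (2 * l) / fact l * infsum P UNIV" by (rule infsum_cmult_right')
  also have "\<dots> \<le> \<delta> ^ (2 * l) / fact l * (m ^ (2 * l) * ((1 + 2 * \<delta> * m / pi)\<^sup>2 * X))"
    by (rule mult_left_mono[OF P_le c0])
  also have "\<dots> = (\<delta> * m) ^ (2 * l) / fact l * ((1 + 2 * \<delta> * m / pi)\<^sup>2 * (L2_norm f)\<^sup>2)"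
    using X0 by (simp add: power_mult_distrib L2_norm_def X_def)
  finally show "infsum (S l) UNIV \<le> (\<delta> * m) ^ (2 * l) / fact l * ((1 + 2 * \<delta> * m / pi)\<^sup>2 * (L2_norm f)\<^sup>2)" .
qed

lemma has_sum_finite_sum:
  fixes g :: "nat \<Rightarrow> int \<Rightarrow> real"
  assumes "\<And>l. l \<le> k \<Longrightarrow> g l summable_on UNIV"
  shows "((\<lambda>n. \<Sum>l\<le>k. g l n) has_sum (\<Sum>l\<le>k. infsum (g l) UNIV)) UNIV"
  using assms
proof (induction k)
  case (Suc k)
  then show ?case by (simp add: has_sum_add)
qed (simp add: has_sum_infsum)

lemma samples_upper:
  fixes k :: nat
  assumes \<Omega>: "compact \<Omega>" and f: "f \<in> bandlimited \<Omega>"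
    and m: "\<And>\<omega>. \<omega> \<in> \<Omega> \<Longrightarrow> \<bar>\<omega>\<bar> \<le> m" and m0: "0 \<le> m"
  defines "S \<equiv> \<lambda>n. \<Sum>l\<le>k. sampling_weight x n l * (cmod (nderiv l f (x n)))\<^sup>2"
  shows "S summable_on UNIV"
    and "infsum S UNIV \<le> (1 + 2 * \<delta> * m / pi)\<^sup>2 * exp ((\<delta> * m)\<^sup>2) * (L2_norm f)\<^sup>2"
proof -
  note U = derivative_samples_upper[OF \<Omega> f m m0]
  have hs: "(S has_sum (\<Sum>l\<le>k. \<Sum>\<^sub>\<infinity>n. sampling_weight x n l * (cmod (nderiv l f (x n)))\<^sup>2)) UNIV"
    unfolding S_def by (rule has_sum_finite_sum) (rule U(1))
  then show "S summable_on UNIV" by (rule has_sum_imp_summable)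
  let ?D = "(1 + 2 * \<delta> * m / pi)\<^sup>2 * (L2_norm f)\<^sup>2"
  have "infsum S UNIV \<le> (\<Sum>l\<le>k. (\<delta> * m) ^ (2 * l) / fact l * ?D)"
    unfolding infsumI[OF hs] by (intro sum_mono U(2))
  also have "\<dots> = (\<Sum>l\<le>k. ((\<delta> * m)\<^sup>2) ^ l /\<^sub>R fact l) * ?D"
    unfolding sum_distrib_right
    by (intro sum.cong refl) (simp only: power_mult[of "\<delta> * m" 2] real_scaleR_def divide_inverse mult.commute[of "inverse _"])
  also have "\<dots> \<le> exp ((\<delta> * m)\<^sup>2) * ?D"
  proof (rule mult_right_mono)
    show "(\<Sum>l\<le>k. ((\<delta> * m)\<^sup>2) ^ l /\<^sub>R fact l) \<le> exp ((\<delta> * m)\<^sup>2)"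
      unfolding exp_def by (rule sum_le_suminf[OF summable_exp_generic]) auto
  qed simp
  finally show "infsum S UNIV \<le> (1 + 2 * \<delta> * m / pi)\<^sup>2 * exp ((\<delta> * m)\<^sup>2) * (L2_norm f)\<^sup>2" by (simp add: mult_ac)
qed

text \<open>
  \<open>square_sum_leI\<close> is applied to \<open>f = T + (f - T)\<close> with \<open>T\<close> the Taylor polynomial on each cell. The hypothesis
  on \<open>c \<delta> m\<close> makes \<open>1 - (c \<delta> m)\<^bsup>k+1\<^esup>\<close> nonnegative, so that the resulting inequality may be squared.
\<close>

lemma samples_lower:
  fixes k :: nat
  assumes \<Omega>: "compact \<Omega>" and f: "f \<in> bandlimited \<Omega>"
    and m: "\<And>\<omega>. \<omega> \<in> \<Omega> \<Longrightarrow> \<bar>\<omega>\<bar> \<le> m" and m0: "0 \<le> m"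
    and q: "poincare_const (Suc k) * \<delta> * m \<le> 1"
  defines "S \<equiv> \<lambda>n. \<Sum>l\<le>k. sampling_weight x n l * (cmod (nderiv l f (x n)))\<^sup>2"
  shows "exp (- 1) * (1 - (poincare_const (Suc k) * \<delta> * m) ^ Suc k)\<^sup>2 * (L2_norm f)\<^sup>2 \<le> infsum S UNIV"
proof -
  let ?c = "poincare_const (Suc k)"
  define p where "p = (?c * \<delta>) ^ (2 * Suc k)"
  define X where "X = energy f"
  have X0: "0 \<le> X" by (simp add: X_def)
  have c0: "0 < ?c" by (rule poincare_const_pos) simp
  have p0: "0 \<le> p" unfolding p_def power_mult by (rule zero_le_power) simp
  have sm: "smooth f" using f by (simp add: bandlimited_def)
  have Xi: "integrable lborel (\<lambda>t. (cmod (nderiv j f t))\<^sup>2)" for j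
    using bandlimited_bernstein(1)[OF \<Omega> f m] by (simp add: L2_on_UNIV)
  have XSuc: "energy (nderiv (Suc k) f) \<le> m ^ (2 * Suc k) * X"
    unfolding X_def by (rule bandlimited_bernstein(2)[OF \<Omega> f m])
  have Ssum: "S summable_on UNIV" unfolding S_def by (rule samples_upper(1)[OF \<Omega> f m m0])
  have S0: "0 \<le> S n" for n unfolding S_def by (intro sum_nonneg mult_nonneg_nonneg sampling_weight_nonneg) auto
  have I0: "0 \<le> infsum S UNIV" by (rule infsum_nonneg) (simp add: S0)
  have cell: "energy_on (voronoi x n) f
      \<le> (1 + s) * (exp 1 * S n) + (1 + 1 / s) * (p * energy_on (voronoi x n) (nderiv (Suc k) f))"
    if s: "0 < s" for s n
  proof -
    define T where "T = taylor_poly (\<lambda>i. nderiv i f (x n)) (Suc k) (x n)"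
    have T: "smooth T" unfolding T_def by (rule smooth_taylor_poly)
    have ints: "set_integrable lborel (voronoi x n) (\<lambda>t. (cmod (f t))\<^sup>2)"
      "set_integrable lborel (voronoi x n) (\<lambda>t. (cmod (T t))\<^sup>2)"
      "set_integrable lborel (voronoi x n) (\<lambda>t. (cmod (f t - T t))\<^sup>2)"
      unfolding voronoi_eq
      using smooth_set_integrable(2)[OF sm, of _ _ 0] smooth_set_integrable(2)[OF T, of _ _ 0] smooth_set_integrable(1)[OF sm T, of _ _ 0 0]
      by auto
    have "energy_on (voronoi x n) f \<le> (LBINT t:voronoi x n. (1 + s) * (cmod (T t))\<^sup>2 + (1 + 1 / s) * (cmod (f t - T t))\<^sup>2)"
      by (rule set_integral_mono) (use ints cmod_square_sum_le[OF s] in auto)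
    also have "\<dots> = (1 + s) * energy_on (voronoi x n) T + (1 + 1 / s) * energy_on (voronoi x n) (\<lambda>t. f t - T t)"
      using ints by simp
    also have "\<dots> \<le> (1 + s) * (exp 1 * S n) + (1 + 1 / s) * (p * energy_on (voronoi x n) (nderiv (Suc k) f))"
      using s taylor_poly_voronoi_le[of n "\<lambda>i. nderiv i f (x n)" k] voronoi_poincare[OF sm, of n k]
      by (intro add_mono mult_left_mono) (auto simp: T_def S_def p_def)
    finally show ?thesis .
  qed
  have "X \<le> (sqrt (exp 1 * infsum S UNIV) + (?c * \<delta> * m) ^ Suc k * sqrt X)\<^sup>2"
  proof (rule square_sum_leI)
    fix s :: real assume s: "0 < s"
    note hX = voronoi_has_sum[OF Xi[of 0, simplified] zero_le_power2]
    note hk = voronoi_has_sum[OF Xi[of "Suc k"] zero_le_power2]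
    have "X \<le> (1 + s) * (exp 1 * infsum S UNIV) + (1 + 1 / s) * (p * energy (nderiv (Suc k) f))"
      unfolding X_def
      by (rule has_sum_mono[OF hX has_sum_add[OF has_sum_cmult_right[OF has_sum_cmult_right[OF has_sum_infsum[OF Ssum]]] has_sum_cmult_right[OF has_sum_cmult_right[OF hk]]]])
         (rule cell[OF s])
    also have "\<dots> \<le> (1 + s) * (exp 1 * infsum S UNIV) + (1 + 1 / s) * (p * (m ^ (2 * Suc k) * X))"
      using s p0 by (intro add_left_mono mult_left_mono XSuc) auto
    also have "exp 1 * infsum S UNIV = (sqrt (exp 1 * infsum S UNIV))\<^sup>2" using I0 by simp
    also have "p * (m ^ (2 * Suc k) * X) = ((?c * \<delta> * m) ^ Suc k * sqrt X)\<^sup>2"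
      using X0 unfolding p_def power_mult_distrib by (simp add: power_mult[symmetric] mult.commute mult.left_commute del: power_Suc)
    finally show "X \<le> (1 + s) * (sqrt (exp 1 * infsum S UNIV))\<^sup>2 + (1 + 1 / s) * ((?c * \<delta> * m) ^ Suc k * sqrt X)\<^sup>2" .
  qed (use I0 X0 c0 m0 \<delta>_nonneg in auto)
  then have "sqrt X \<le> sqrt (exp 1 * infsum S UNIV) + (?c * \<delta> * m) ^ Suc k * sqrt X"
    by (rule real_le_lsqrt[rotated -1]) (use I0 X0 c0 m0 \<delta>_nonneg in \<open>auto intro!: add_nonneg_nonneg mult_nonneg_nonneg zero_le_power\<close>)
  then have "(1 - (?c * \<delta> * m) ^ Suc k) * sqrt X \<le> sqrt (exp 1 * infsum S UNIV)" by (simp add: algebra_simps)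
  moreover have "0 \<le> (1 - (?c * \<delta> * m) ^ Suc k) * sqrt X"
    using q X0 c0 m0 \<delta>_nonneg by (intro mult_nonneg_nonneg) (auto intro!: power_le_one mult_nonneg_nonneg simp del: power_Suc)
  ultimately have "((1 - (?c * \<delta> * m) ^ Suc k) * sqrt X)\<^sup>2 \<le> (sqrt (exp 1 * infsum S UNIV))\<^sup>2" by (intro power_mono) auto
  then have "(1 - (?c * \<delta> * m) ^ Suc k)\<^sup>2 * X \<le> exp 1 * infsum S UNIV"
    using X0 I0 by (simp add: power_mult_distrib del: power_Suc)
  then have "exp (- 1) * ((1 - (?c * \<delta> * m) ^ Suc k)\<^sup>2 * X) \<le> exp (- 1) * (exp 1 * infsum S UNIV)" by (intro mult_left_mono) auto
  also have "exp (- 1) * (exp 1 * infsum S UNIV) = infsum S UNIV" by (simp add: exp_minus)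
  finally have "exp (- 1) * ((1 - (?c * \<delta> * m) ^ Suc k)\<^sup>2 * X) \<le> infsum S UNIV" .
  moreover have "(L2_norm f)\<^sup>2 = X" using X0 by (simp add: L2_norm_def X_def)
  ultimately show ?thesis by (simp only: mult.assoc)
qed

end

text \<open>
  Both sides are about the same double series of nonnegative terms, summed once by rows and once over all
  pairs.
\<close>

lemma sampling_bounds_iff_frame:
  assumes \<Omega>: "compact \<Omega>" and AB: "0 < A" "0 < B"
  shows "deriv_sampling_bounds \<Omega> k x A B \<longleftrightarrow> L2_frame (bandlimited \<Omega>) (UNIV \<times> {..k}) (sampling_atom \<Omega> x) A B"
proof -
  define g where "g f = (\<lambda>(n, l). (cmod (L2_inner f (sampling_atom \<Omega> x (n, l))))\<^sup>2)" for f
  define S where "S f n = (\<Sum>l\<le>k. sampling_weight x n l * (cmod (nderiv l f (x n)))\<^sup>2)" for f n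
  have w: "0 \<le> sampling_weight x n l" for n l by (simp add: sampling_weight_def set_lebesgue_integral_def)
  have row: "((\<lambda>l. g f (n, l)) has_sum S f n) {..k}" if f: "f \<in> bandlimited \<Omega>" for f n
    using has_sum_finite[of "{..k}" "\<lambda>l. g f (n, l)"] by (simp add: g_def S_def sampling_atom_inner[OF \<Omega> f w])
  have iff: "(S f has_sum s) UNIV \<longleftrightarrow> (g f has_sum s) (UNIV \<times> {..k})" if f: "f \<in> bandlimited \<Omega>" for f s
  proof
    assume S: "(S f has_sum s) UNIV"
    have "g f summable_on (UNIV \<times> {..k})"
      by (rule summable_on_SigmaI[OF row[OF f] has_sum_imp_summable[OF S]]) (simp add: g_def)
    then show "(g f has_sum s) (UNIV \<times> {..k})" by (rule has_sum_SigmaI[OF row[OF f] S])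
  next
    assume "(g f has_sum s) (UNIV \<times> {..k})"
    then show "(S f has_sum s) UNIV" by (rule has_sum_SigmaD) (rule row[OF f])
  qed
  have iff': "S f summable_on UNIV \<longleftrightarrow> g f summable_on (UNIV \<times> {..k})" "infsum (S f) UNIV = infsum (g f) (UNIV \<times> {..k})"
    if f: "f \<in> bandlimited \<Omega>" for f
  proof -
    show 1: "S f summable_on UNIV \<longleftrightarrow> g f summable_on (UNIV \<times> {..k})" using iff[OF f] by (auto simp: summable_on_def)
    show "infsum (S f) UNIV = infsum (g f) (UNIV \<times> {..k})"
      using 1 iff[OF f] by (cases "S f summable_on UNIV") (auto simp: infsum_not_exists intro!: infsumI[symmetric] dest: has_sum_infsum)
  qed
  have g_eq: "g f = (\<lambda>i. (cmod (L2_inner f (sampling_atom \<Omega> x i)))\<^sup>2)" for f by (auto simp: g_def fun_eq_iff)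
  have atoms: "\<forall>i\<in>UNIV \<times> {..k}. sampling_atom \<Omega> x i \<in> bandlimited \<Omega>" using sampling_atom_bandlimited[OF \<Omega>] by auto
  show ?thesis
    unfolding deriv_sampling_bounds_def L2_frame_def Let_def g_eq[symmetric] S_def[symmetric]
    using AB atoms iff' by auto
qed

theorem theorem3p10:
  fixes \<Omega> :: "real set" and k :: nat and x :: "int \<Rightarrow> real"
  defines "c \<equiv> poincare_const (k + 1)"
    and "\<delta> \<equiv> enn2real (max_gap x)"
    and "m \<equiv> enn2real (band_radius \<Omega>)"
  assumes "compact \<Omega>"
    and "\<forall>n. x n < x (n + 1)"
    and "max_gap x < ennreal (1 / c) / band_radius \<Omega>"
  shows "(\<exists>A B. A \<ge> exp (- 1) * (1 - (c * \<delta> * m) ^ (k + 1))\<^sup>2 \<and>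
            B \<le> (1 + 2 * \<delta> * m / pi)\<^sup>2 * exp ((\<delta> * m)\<^sup>2) \<and>
            deriv_sampling_bounds \<Omega> k x A B \<and>
            L2_frame (bandlimited \<Omega>) (UNIV \<times> {..k}) (sampling_atom \<Omega> x) A B) \<and>
         (\<forall>A>0. \<forall>B>0. deriv_sampling_bounds \<Omega> k x A B \<longleftrightarrow>
            L2_frame (bandlimited \<Omega>) (UNIV \<times> {..k}) (sampling_atom \<Omega> x) A B)"
proof -
  note \<Omega> = \<open>compact \<Omega>\<close>
  interpret sp: sampling_points x
  proof
    show "max_gap x < \<top>" using assms(6) top.not_eq_extremum by fastforce
  qed (use assms(5) in simp)
  have \<delta>: "sp.\<delta> = \<delta>" by (simp add: sp.\<delta>_def \<delta>_def)
  have \<delta>0: "0 \<le> \<delta>" and m0: "0 \<le> m" by (simp_all add: \<delta>_def m_def)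
  have c0: "0 < c" unfolding c_def by (rule poincare_const_pos) simp
  obtain M where M: "\<And>\<omega>. \<omega> \<in> \<Omega> \<Longrightarrow> \<bar>\<omega>\<bar> \<le> M" using compact_imp_bounded[OF \<Omega>] by (auto simp: bounded_iff)
  have "band_radius \<Omega> \<le> ennreal M" unfolding band_radius_def by (intro SUP_least ennreal_leI M)
  then have r: "band_radius \<Omega> = ennreal m" unfolding m_def by (metis ennreal_enn2real ennreal_less_top le_less_trans)
  have m: "\<bar>\<omega>\<bar> \<le> m" if "\<omega> \<in> \<Omega>" for \<omega>
  proof -
    have "ennreal \<bar>\<omega>\<bar> \<le> band_radius \<Omega>" unfolding band_radius_def by (rule SUP_upper[OF that])
    then show ?thesis using m0 by (simp add: r ennreal_le_iff)
  qed
  have q: "c * \<delta> * m < 1"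
  \<comment> \<open>For \<open>m = 0\<close> the quotient in the hypothesis is infinite, but then the product vanishes.\<close>
  proof (cases "m = 0")
    case False
    then have "ennreal \<delta> < ennreal (1 / c / m)"
      using assms(6) m0 c0 by (simp add: r sp.max_gap_eq \<delta> divide_ennreal)
    then have "\<delta> < 1 / c / m" using \<delta>0 by (simp add: ennreal_less_iff)
    then show ?thesis using False m0 c0 by (simp add: field_simps)
  qed simp
  have q0: "0 \<le> c * \<delta> * m" using c0 \<delta>0 m0 by simp
  define A where "A = exp (- 1) * (1 - (c * \<delta> * m) ^ (k + 1))\<^sup>2"
  define B where "B = (1 + 2 * \<delta> * m / pi)\<^sup>2 * exp ((\<delta> * m)\<^sup>2)"
  have "(c * \<delta> * m) ^ (k + 1) < 1" 
    by (rule le_less_trans[OF _ q]) (use power_decreasing[of 1 "k + 1" "c * \<delta> * m"] q0 q in simp)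
  then have A0: "0 < A" by (simp add: A_def)
  have "0 < 1 + 2 * \<delta> * m / pi" using \<delta>0 m0 by (simp add: add_pos_nonneg)
  then have B0: "0 < B" by (simp add: B_def)
  have bounds: "deriv_sampling_bounds \<Omega> k x A B"
    unfolding deriv_sampling_bounds_def Let_def
    using sp.samples_upper[OF \<Omega> _ m m0, where k=k] sp.samples_lower[OF \<Omega> _ m m0, where k=k] q
    by (auto simp: A_def B_def \<delta> c_def)
  show ?thesis
    using bounds sampling_bounds_iff_frame[OF \<Omega>] A0 B0 unfolding A_def B_def by blast
qed

end
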